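(* Let $0<\beta<\alpha<1$, let $h\ge0$ be measurable with $\mathbb{E}[h(T_\beta)]=1$, and $\tilde h_{\beta/\alpha}(v)=\mathbb{E}_{\beta/\alpha}[h(vT_{\beta/\alpha}^{1/\alpha})]$. Let $\hat K_n$ denote the number of blocks in a $\mathrm{PK}_\alpha(\tilde h_{\beta/\alpha}\cdot f_\alpha)$ partition of $[n]$, which has probability mass function, for $k=1,\ldots,n$, $$\mathbb{P}(\hat K_n=k)=\mathbb{E}_\alpha\big[\tilde h_{\beta/\alpha}(T_\alpha)\,\big|\,K_n^{[\alpha]}=k\big]\,\mathbb{P}^{(n)}_{\alpha,0}(k)=\left[\sum_{j=1}^k\mathbb{P}^{(k)}_{\frac{\beta}{\alpha},0}(j)\Psi^{[\beta]}_{n,j}\right]\mathbb{P}^{(n)}_{\alpha,0}(k).$$ Then, as $n\to\infty$, $n^{-\alpha}\hat K_n\to\hat Z$ almost surely, where $\hat Z$ (the $\alpha$-diversity) has density $$\mathbb{E}_{\beta/\alpha}\Big[h\big(s^{-1/\alpha}T_{\beta/\alpha}^{1/\alpha}\big)\Big]g_\alpha(s).$$ Furthermore, $$\hat Z\overset{d}{=}\sum_{k=1}^\infty P_{k,\beta}^\alpha Z^{(k)}_{\alpha,-\beta}\overset{d}{=}\sum_{k=1}^\infty\tilde P_{k,\beta}^\alpha Z^{(k)}_{\alpha,-\beta},$$ where $P_\beta=(P_{k,\beta})\sim\mathrm{PK}_\beta(h\cdot f_\beta)$ and $(\tilde P_{k,\beta})$ is its size-biased rearrangement, independent of the iid sequence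 $(Z^{(k)}_{\alpha,-\beta})_{k\ge1}$ with common law $\mathrm{ML}(\alpha,-\beta)$.
   Context: $\mathcal P_\infty=\{(s_1,s_2,\ldots): s_1\ge s_2\ge\cdots\ge 0,\ \sum_k s_k=1\}$. For $\gamma\in(0,1)$ let $J_1>J_2>\cdots$ be the ranked points of a Poisson process on $(0,\infty)$ with intensity $\frac{\gamma}{\Gamma(1-\gamma)}x^{-\gamma-1}dx$ and $T_\gamma=\sum_i J_i$, a positive $\gamma$-stable variable with $\mathbb{E}[e^{-\lambda T_\gamma}]=e^{-\lambda^\gamma}$ and density $f_\gamma$. $\mathbb{E}_\gamma$ denotes expectation in the $\mathrm{PD}(\gamma,0)$ model (with respect to $T_\gamma$ and the associated partition). $g_\gamma(s)=f_\gamma(s^{-1/\gamma})s^{-1/\gamma-1}/\gamma$ is the density of $T_\gamma^{-\gamma}$. $\mathrm{PD}(\gamma,0)$ is the law of $(J_i/T_\gamma)_i$, $\mathrm{PD}(\gamma|t)$ its regular conditional law given $T_\gamma=t$, and for $h\ge0$ with $\mathbb{E}[h(T_\gamma)]=1$, $\mathrm{PK}_\gamma(h\cdot f_\gamma)=\int_0^\infty \mathrm{PD}(\gamma|t)h(t)f_\gamma(t)\,dt$. Partitions: a random $P\in\mathcal P_\infty$ generates an exchangeable partition of $\mathbb N$, and by restriction of each $[n]=\{1,\dots,n\}$, by sampling, given $P$, iid indices $I_1,I_2,\dots$ with $\mathbb{P}(I_m=i|P)=P_i$, and putting $m,m'$ in the same block iff $I_m=I_{m'}$. A partition of a given law on $\mathcal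 P_\infty$ is one generated by $P$ with that law; the partitions of $[n]$, $n\ge1$, are restrictions of the same partition of $\mathbb N$. $K_n^{[\gamma]}$ is the number of blocks of the $\mathrm{PD}(\gamma,0)$ partition of $[n]$ (generated by $(J_i/T_\gamma)_i$), $\mathbb{P}^{(n)}_{\gamma,0}(k)=\mathbb{P}(K_n^{[\gamma]}=k)$, and $\Psi^{[\beta]}_{n,j}=\mathbb{E}_\beta[h(T_\beta)|K_n^{[\beta]}=j]$. $\mathrm{ML}(\alpha,\theta)$, $\theta>-\alpha$, is the law with density $s^{\theta/\alpha}g_\alpha(s)/\mathbb{E}[T_\alpha^{-\theta}]$, $s>0$. *)

theory Defs
  imports "HOL-Probability.Probability"
begin

text \<open>
  All sequences are indexed from 0: \<open>J \<omega> i\<close> is the point $J_{i+1}$, \<open>I \<omega> m\<close> the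
  index $I_{m+1}$, and the set $[n]$ is represented by \<open>{..<n}\<close>.
  Laws on \<open>ranked_simplex\<close> are represented as measures on \<open>seq_space\<close>.
\<close>

definition seq_space :: "(nat \<Rightarrow> real) measure" where
  "seq_space = (\<Pi>\<^sub>M i\<in>UNIV. borel)"

definition ranked_simplex :: "(nat \<Rightarrow> real) set" where
  "ranked_simplex = {s. decseq s \<and> (\<forall>k. 0 \<le> s k) \<and> s sums 1}"

definition generates_partition ::
  "'a measure \<Rightarrow> ('a \<Rightarrow> nat \<Rightarrow> real) \<Rightarrow> ('a \<Rightarrow> nat \<Rightarrow> nat) \<Rightarrow> bool" where
  "generates_partition M P I \<longleftrightarrow>
     prob_space M \<and>
     P \<in> M \<rightarrow>\<^sub>M seq_space \<and> (AE \<omega> in M. P \<omega> \<in> ranked_simplex) \<and>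
     (\<forall>m. (\<lambda>\<omega>. I \<omega> m) \<in> M \<rightarrow>\<^sub>M count_space UNIV) \<and>
     (\<forall>A\<in>sets seq_space. \<forall>js.
        emeasure M {\<omega>\<in>space M. P \<omega> \<in> A \<and> (\<forall>l<length js. I \<omega> l = js ! l)} =
        (\<integral>\<^sup>+\<omega>. indicator A (P \<omega>) * (\<Prod>l<length js. ennreal (P \<omega> (js ! l))) \<partial>M))"

definition partition_of :: "(nat \<Rightarrow> nat) \<Rightarrow> nat \<Rightarrow> nat set set" where
  "partition_of \<iota> n = {..<n} // {(m, m'). m < n \<and> m' < n \<and> \<iota> m = \<iota> m'}"

definition num_blocks :: "(nat \<Rightarrow> nat) \<Rightarrow> nat \<Rightarrow> nat" where
  "num_blocks \<iota> n = card (partition_of \<iota> n)"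

text \<open>
  The counts are only prescribed on sets of finite intensity. On such sets they are almost
  surely finite, so \<open>card\<close> is the number of points.
\<close>

definition ranked_poisson_points ::
  "'a measure \<Rightarrow> real measure \<Rightarrow> ('a \<Rightarrow> nat \<Rightarrow> real) \<Rightarrow> bool" where
  "ranked_poisson_points M \<mu> J \<longleftrightarrow>
     prob_space M \<and> J \<in> M \<rightarrow>\<^sub>M seq_space \<and>
     (AE \<omega> in M. \<forall>i. 0 < J \<omega> i \<and> J \<omega> (Suc i) < J \<omega> i) \<and>
     (\<forall>A\<in>sets borel. emeasure \<mu> A < \<infinity> \<longrightarrow>
        (AE \<omega> in M. finite {i. J \<omega> i \<in> A}) \<and>
        (\<forall>k. measure M {\<omega>\<in>space M. card {i. J \<omega> i \<in> A} = k} =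
              exp (- measure \<mu> A) * measure \<mu> A ^ k / fact k)) \<and>
     (\<forall>n. \<forall>A :: nat \<Rightarrow> real set.
        (\<forall>l<n. A l \<in> sets borel \<and> emeasure \<mu> (A l) < \<infinity>) \<longrightarrow>
        disjoint_family_on A {..<n} \<longrightarrow>
        prob_space.indep_vars M (\<lambda>_. count_space UNIV)
          (\<lambda>l \<omega>. card {i. J \<omega> i \<in> A l}) {..<n})"

definition stable_intensity :: "real \<Rightarrow> real measure" where
  "stable_intensity \<gamma> =
     density lborel
       (\<lambda>x. indicator {0<..} x * ennreal (\<gamma> / Gamma (1 - \<gamma>) * x powr (- \<gamma> - 1)))"

definition total_mass :: "('a \<Rightarrow> nat \<Rightarrow> real) \<Rightarrow> 'a \<Rightarrow> real" where
  "total_mass J \<omega> = (\<Sum>i. J \<omega> i)"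

definition normalized :: "('a \<Rightarrow> nat \<Rightarrow> real) \<Rightarrow> 'a \<Rightarrow> nat \<Rightarrow> real" where
  "normalized J \<omega> i = J \<omega> i / total_mass J \<omega>"

text \<open>
  The model $\mathrm{PD}(\gamma,0)$: \<open>total_mass J\<close> is $T_\gamma$, \<open>normalized J\<close> is
  $\mathrm{PD}(\gamma,0)$ distributed, and \<open>num_blocks (I \<omega>) n\<close> is $K_n^{[\gamma]}$.
\<close>

definition PD_model ::
  "real \<Rightarrow> 'a measure \<Rightarrow> ('a \<Rightarrow> nat \<Rightarrow> real) \<Rightarrow> ('a \<Rightarrow> nat \<Rightarrow> nat) \<Rightarrow> bool" where
  "PD_model \<gamma> M J I \<longleftrightarrow>
     ranked_poisson_points M (stable_intensity \<gamma>) J \<and>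
     generates_partition M (normalized J) I"

definition K_event :: "'a measure \<Rightarrow> ('a \<Rightarrow> nat \<Rightarrow> nat) \<Rightarrow> nat \<Rightarrow> nat \<Rightarrow> 'a set" where
  "K_event M I n k = {\<omega>\<in>space M. num_blocks (I \<omega>) n = k}"

text \<open>Only used for events \<open>A\<close> of positive probability.\<close>

definition cond_expectation :: "'a measure \<Rightarrow> ('a \<Rightarrow> ennreal) \<Rightarrow> 'a set \<Rightarrow> ennreal" where
  "cond_expectation M X A = (\<integral>\<^sup>+\<omega>. X \<omega> \<partial>uniform_measure M A)"

definition density_of_total ::
  "'a measure \<Rightarrow> ('a \<Rightarrow> nat \<Rightarrow> real) \<Rightarrow> (real \<Rightarrow> real) \<Rightarrow> bool" where
  "density_of_total M J f \<longleftrightarrow>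
     (\<forall>t. 0 \<le> f t) \<and> distributed M lborel (total_mass J) (\<lambda>t. ennreal (f t))"

text \<open>\<open>\<kappa>\<close> is a version of $t \mapsto \mathrm{PD}(\gamma|t)$.\<close>

definition PD_given_total ::
  "'a measure \<Rightarrow> ('a \<Rightarrow> nat \<Rightarrow> real) \<Rightarrow> (real \<Rightarrow> (nat \<Rightarrow> real) measure) \<Rightarrow> bool" where
  "PD_given_total M J \<kappa> \<longleftrightarrow>
     \<kappa> \<in> borel \<rightarrow>\<^sub>M prob_algebra seq_space \<and>
     (\<forall>A\<in>sets seq_space. \<forall>B\<in>sets borel.
        emeasure M {\<omega>\<in>space M. normalized J \<omega> \<in> A \<and> total_mass J \<omega> \<in> B} =
        (\<integral>\<^sup>+t\<in>B. emeasure (\<kappa> t) A \<partial>distr M borel (total_mass J)))"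

text \<open>
  $\mathrm{PK}_\gamma(h\cdot f_\gamma)$, for versions \<open>f\<close> of $f_\gamma$ and \<open>\<kappa>\<close> of
  $\mathrm{PD}(\gamma|\cdot)$. The weight is extended-valued because $\tilde h$ may be infinite on a
  null set.
\<close>

definition PK ::
  "(real \<Rightarrow> real) \<Rightarrow> (real \<Rightarrow> (nat \<Rightarrow> real) measure) \<Rightarrow> (real \<Rightarrow> ennreal) \<Rightarrow>
     (nat \<Rightarrow> real) measure" where
  "PK f \<kappa> h = density lborel (\<lambda>t. indicator {0<..} t * (h t * ennreal (f t))) \<bind> \<kappa>"

text \<open>\<open>stable_g \<gamma> f\<close> is $g_\gamma$ when \<open>f\<close> is $f_\gamma$; used for positive arguments only.\<close>

definition stable_g :: "real \<Rightarrow> (real \<Rightarrow> real) \<Rightarrow> real \<Rightarrow> real" where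
  "stable_g \<gamma> f s = f (s powr (- 1 / \<gamma>)) * s powr (- 1 / \<gamma> - 1) / \<gamma>"

text \<open>\<open>M\<close>, \<open>J\<close> and \<open>f\<close> come from the model $\mathrm{PD}(\alpha,0)$.\<close>

definition mittag_leffler_law ::
  "'a measure \<Rightarrow> ('a \<Rightarrow> nat \<Rightarrow> real) \<Rightarrow> (real \<Rightarrow> real) \<Rightarrow> real \<Rightarrow> real \<Rightarrow> real measure" where
  "mittag_leffler_law M J f \<alpha> \<theta> =
     density lborel
       (\<lambda>s. indicator {0<..} s *
          ennreal (s powr (\<theta> / \<alpha>) * stable_g \<alpha> f s / (\<integral>\<omega>. total_mass J \<omega> powr (- \<theta>) \<partial>M)))"

text \<open>$\tilde h_{\beta/\alpha}$, where \<open>M\<close> and \<open>J\<close> come from the model $\mathrm{PD}(\beta/\alpha,0)$.\<close>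

definition h_tilde ::
  "'a measure \<Rightarrow> ('a \<Rightarrow> nat \<Rightarrow> real) \<Rightarrow> real \<Rightarrow> (real \<Rightarrow> real) \<Rightarrow> real \<Rightarrow> ennreal" where
  "h_tilde M J \<alpha> h v = (\<integral>\<^sup>+\<omega>. ennreal (h (v * total_mass J \<omega> powr (1 / \<alpha>))) \<partial>M)"

text \<open>
  Given \<open>P\<close>, the indices \<open>\<sigma> \<omega> 0\<close>, \<open>\<sigma> \<omega> 1\<close>, \dots{} are drawn successively without replacement,
  each remaining index being chosen with probability proportional to its mass. All masses are
  understood to be almost surely positive, so no denominator vanishes.
\<close>

definition size_biased_rearrangement ::
  "'a measure \<Rightarrow> ('a \<Rightarrow> nat \<Rightarrow> real) \<Rightarrow> ('a \<Rightarrow> nat \<Rightarrow> real) \<Rightarrow> bool" where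
  "size_biased_rearrangement M P Q \<longleftrightarrow>
     Q \<in> M \<rightarrow>\<^sub>M seq_space \<and>
     (\<exists>\<sigma> :: 'a \<Rightarrow> nat \<Rightarrow> nat.
        (\<forall>k. (\<lambda>\<omega>. \<sigma> \<omega> k) \<in> M \<rightarrow>\<^sub>M count_space UNIV) \<and>
        (AE \<omega> in M. \<forall>k. Q \<omega> k = P \<omega> (\<sigma> \<omega> k)) \<and>
        (\<forall>A\<in>sets seq_space. \<forall>js.
           emeasure M {\<omega>\<in>space M. P \<omega> \<in> A \<and> (\<forall>l<length js. \<sigma> \<omega> l = js ! l)} =
           (if distinct js
            then \<integral>\<^sup>+\<omega>. indicator A (P \<omega>) *
                   (\<Prod>l<length js. ennreal (P \<omega> (js ! l) / (1 - (\<Sum>m<l. P \<omega> (js ! m))))) \<partial>M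
            else 0)))"

end

theory Submission
  imports Defs "HOL-Real_Asymp.Real_Asymp"
begin

text \<open>
  The law of large numbers for ranked Poisson points makes \<open>T\<close> almost surely a function of the
  normalized weights, so reweighting the mass is the same as reweighting the partition.
  Colouring the blocks turns the joint law of \<open>(T, K\<^sub>n)\<close> into a generating function, which gives
  \<open>E[T^n exp (- l T); K\<^sub>n = k] = C l^(g k - n) exp (- l^g)\<close>; hence both sides of the block
  identity have the same Laplace transform in the mass. For the limit, a sample of
  Poisson size with mean \<open>t T\<close> given the points has a number of blocks that is Poisson with mean
  \<open>t powr g\<close>, hence sharply concentrated; \<open>t = n / T\<close> yields \<open>n powr - g * K\<^sub>n \<longlonglongrightarrow> T powr - g\<close>,
  and absolute continuity carries
  this over to the reweighted model. Finally, Laplace transforms show that attaching the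
  Mittag-Leffler marks realizes a subordination: \<open>(T\<^sub>\<beta>, \<Sum>k. J\<^sub>k powr \<alpha> * Z\<^sub>k)\<close> has the law of
  \<open>(T\<^sub>\<delta> powr (1 / \<alpha>) * T\<^sub>\<alpha>, T\<^sub>\<delta>)\<close> with \<open>\<delta> = \<beta> / \<alpha>\<close>. Size-biasing only permutes the weights,
  and the marks are exchangeable.
\<close>

section \<open>Integrals and series\<close>

text \<open>The sampling formula is homogeneous of degree \<open>n\<close> in the weights
  \<open>J / T\<close>, whereas the Poisson structure is a property of \<open>J\<close>. The factor
  \<open>T ^ n\<close> clears the denominator; this is why transforms are taken of
  \<open>T ^ n\<close> on a block event, and a positive weight is divided out at the end. With
  \<open>u / l\<close> fixed, the generating function times \<open>exp (l powr g)\<close> depends on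
  the colour \<open>z\<close> and on \<open>l\<close> only through \<open>z * l powr g\<close>. This
  forces the power of \<open>l\<close> and leaves one constant for each \<open>n\<close> and
  \<open>k\<close>, which a Gamma integral over \<open>l\<close> identifies. In the product model a
  factor \<open>T\<^sub>\<delta> ^ k\<close> survives the integration over the
  \<open>\<alpha>\<close> model, so the number of blocks there becomes the sample size for index
  \<open>\<beta> / \<alpha>\<close>: this is the origin of the inner law in the block identity.
  Infinite products over points are infima of decreasing partial products in \<open>ennreal\<close>.
  They exist before any summability is known, and convergence of the marked series is itself read
  off from such a product.\<close>

lemma SUP_indicator_incseq:
  fixes c :: ennreal
  assumes "incseq A"
  shows "(SUP n. c * indicator (A n) x) = c * indicator (\<Union>n. A n) x"
proof (cases "x \<in> (\<Union>n. A n)")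
  case True
  then obtain n where "x \<in> A n" by auto
  then show ?thesis using True
    by (intro antisym SUP_least SUP_upper2[of n]) (auto split: split_indicator)
next
  case False
  then show ?thesis by auto
qed

text \<open>Compact intervals, where the substitution rule applies directly, exhaust both sides, and
  monotone convergence covers every nonnegative \<open>F\<close>. Logarithmic coordinates turn the
  power maps used later into linear ones.\<close>

lemma nn_integral_exp_substitution:
  fixes F :: "real \<Rightarrow> ennreal"
  assumes [measurable]: "F \<in> borel_measurable borel"
  shows "(\<integral>\<^sup>+x. F x * indicator {0<..} x \<partial>lborel) = (\<integral>\<^sup>+t. F (exp t) * ennreal (exp t) \<partial>lborel)"
proof -
  have sub: "(\<integral>\<^sup>+x. F x * indicator {exp (- real (Suc n))..exp (real (Suc n))} x \<partial>lborel)
      = (\<integral>\<^sup>+t. F (exp t) * ennreal (exp t) * indicator {- real (Suc n)..real (Suc n)} t \<partial>lborel)" for n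
    by (rule nn_integral_substitution_aux)
       (auto intro!: derivative_eq_intros continuous_intros)
  have inc1: "incseq (\<lambda>n. {exp (- real (Suc n))..exp (real (Suc n))})"
    by (rule incseq_SucI) auto
  have inc2: "incseq (\<lambda>n. {- real (Suc n)..real (Suc n)})"
    by (rule incseq_SucI) auto
  have un2: "(\<Union>n. {- real (Suc n)..real (Suc n)}) = UNIV"
  proof (safe; simp)
    fix x :: real
    obtain n where "\<bar>x\<bar> \<le> real n" using real_arch_simple by blast
    then show "\<exists>n. - 1 - real n \<le> x \<and> x \<le> 1 + real n" by (intro exI[of _ n]) auto
  qed
  have un1: "(\<Union>n. {exp (- real (Suc n))..exp (real (Suc n))}) = {0<..}"
  proof safe
    fix n x assume "x \<in> {exp (- real (Suc n))..exp (real (Suc n))}"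
    then show "0 < x" by (auto intro: less_le_trans[OF exp_gt_zero])
  next
    fix x :: real assume "0 < x"
    have "ln x \<in> (\<Union>n. {- real (Suc n)..real (Suc n)})" unfolding un2 by simp
    then obtain n where "ln x \<in> {- real (Suc n)..real (Suc n)}" by blast
    then have "exp (- real (Suc n)) \<le> exp (ln x)" "exp (ln x) \<le> exp (real (Suc n))"
      by (simp_all del: exp_ln)
    with \<open>0 < x\<close> show "x \<in> (\<Union>n. {exp (- real (Suc n))..exp (real (Suc n))})" by auto
  qed
  have mono: "incseq (\<lambda>n x. F' x * indicator (A n) x :: ennreal)" if "incseq A" for A F'
    using that by (auto simp: incseq_def le_fun_def split: split_indicator)
  have "(\<integral>\<^sup>+x. F x * indicator {0<..} x \<partial>lborel) =
      (\<integral>\<^sup>+x. (SUP n. F x * indicator {exp (- real (Suc n))..exp (real (Suc n))} x) \<partial>lborel)"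
    by (simp only: SUP_indicator_incseq[OF inc1] un1)
  also have "\<dots> = (SUP n. \<integral>\<^sup>+x. F x * indicator {exp (- real (Suc n))..exp (real (Suc n))} x \<partial>lborel)"
    by (rule nn_integral_monotone_convergence_SUP[OF mono[OF inc1]]) auto
  also have "\<dots> = (SUP n. \<integral>\<^sup>+t. F (exp t) * ennreal (exp t) * indicator {- real (Suc n)..real (Suc n)} t \<partial>lborel)"
    by (simp only: sub)
  also have "\<dots> = (\<integral>\<^sup>+t. (SUP n. F (exp t) * ennreal (exp t) * indicator {- real (Suc n)..real (Suc n)} t) \<partial>lborel)"
    by (rule nn_integral_monotone_convergence_SUP[OF mono[OF inc2], symmetric]) auto
  also have "\<dots> = (\<integral>\<^sup>+t. F (exp t) * ennreal (exp t) \<partial>lborel)"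
    by (simp only: SUP_indicator_incseq[OF inc2] un2) simp
  finally show ?thesis .
qed

text \<open>In the coordinate \<open>ln x\<close> the map \<open>x powr a\<close> is multiplication
  by \<open>a\<close>, so an affine change of variable does the work. Negative \<open>a\<close> is
  included because the inversion \<open>s powr (- 1 / g)\<close> is one of the uses.\<close>

lemma nn_integral_powr_substitution:
  fixes F :: "real \<Rightarrow> ennreal"
  assumes [measurable]: "F \<in> borel_measurable borel" and "a \<noteq> 0"
  shows "(\<integral>\<^sup>+y. F y * indicator {0<..} y \<partial>lborel) =
    (\<integral>\<^sup>+x. F (x powr a) * ennreal (\<bar>a\<bar> * x powr (a - 1)) * indicator {0<..} x \<partial>lborel)"
proof -
  have "(\<integral>\<^sup>+x. F (x powr a) * ennreal (\<bar>a\<bar> * x powr (a - 1)) * indicator {0<..} x \<partial>lborel) =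
    (\<integral>\<^sup>+t. F (exp t powr a) * ennreal (\<bar>a\<bar> * exp t powr (a - 1)) * ennreal (exp t) \<partial>lborel)"
    by (rule nn_integral_exp_substitution) measurable
  also have "\<dots> = (\<integral>\<^sup>+t. ennreal \<bar>a\<bar> * (F (exp (a * t)) * ennreal (exp (a * t))) \<partial>lborel)"
  proof (rule nn_integral_cong)
    fix t :: real
    have "ennreal (\<bar>a\<bar> * exp t powr (a - 1)) * ennreal (exp t) = ennreal \<bar>a\<bar> * ennreal (exp (a * t))"
      by (simp add: ennreal_mult''[symmetric] powr_def exp_diff left_diff_distrib)
    moreover have "exp t powr a = exp (a * t)" by (simp add: powr_def)
    ultimately show "F (exp t powr a) * ennreal (\<bar>a\<bar> * exp t powr (a - 1)) * ennreal (exp t) =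
      ennreal \<bar>a\<bar> * (F (exp (a * t)) * ennreal (exp (a * t)))"
      by (metis mult.assoc mult.commute)
  qed
  also have "\<dots> = ennreal \<bar>a\<bar> * (\<integral>\<^sup>+t. F (exp (a * t)) * ennreal (exp (a * t)) \<partial>lborel)"
    by (rule nn_integral_cmult) measurable
  also have "\<dots> = (\<integral>\<^sup>+t. F (exp t) * ennreal (exp t) \<partial>lborel)"
    using nn_integral_real_affine[of "\<lambda>t. F (exp t) * ennreal (exp t)" a 0] \<open>a \<noteq> 0\<close> by simp
  also have "\<dots> = (\<integral>\<^sup>+x. F x * indicator {0<..} x \<partial>lborel)"
    by (rule nn_integral_exp_substitution[symmetric]) measurable
  finally show ?thesis by simp
qed

lemma nn_integral_scale_substitution:
  fixes F :: "real \<Rightarrow> ennreal"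
  assumes [measurable]: "F \<in> borel_measurable borel" and "0 < c"
  shows "(\<integral>\<^sup>+y. F y * indicator {0<..} y \<partial>lborel) =
    ennreal c * (\<integral>\<^sup>+x. F (c * x) * indicator {0<..} x \<partial>lborel)"
proof -
  have "indicator {0<..} (c * x) = (indicator {0<..} x :: ennreal)" for x
    using \<open>0 < c\<close> by (auto split: split_indicator simp: zero_less_mult_iff)
  then show ?thesis
    using nn_integral_real_affine[of "\<lambda>y. F y * indicator {0<..} y" c 0] \<open>0 < c\<close> by simp
qed

lemma nn_integral_Gamma_scaled:
  fixes a s :: real
  assumes "0 < a" "0 < s"
  shows "(\<integral>\<^sup>+y. ennreal (y powr (a - 1) * exp (- (s * y))) * indicator {0<..} y \<partial>lborel) =
    ennreal (Gamma a * s powr (- a))"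
proof -
  have G: "(\<integral>\<^sup>+y. ennreal (y powr (a - 1) * exp (- y)) * indicator {0<..} y \<partial>lborel) = ennreal (Gamma a)"
    unfolding Gamma_conv_nn_integral_real[OF \<open>0 < a\<close>]
    by (intro nn_integral_cong_AE AE_I[where N="{0::real}"])
       (auto simp: exp_minus divide_inverse split: split_indicator)
  have "ennreal (Gamma a) = ennreal s * (\<integral>\<^sup>+y. ennreal ((s * y) powr (a - 1) * exp (- (s * y))) * indicator {0<..} y \<partial>lborel)"
    unfolding G[symmetric] by (rule nn_integral_scale_substitution) (use assms in auto)
  also have "\<dots> = (\<integral>\<^sup>+y. ennreal s * (ennreal ((s * y) powr (a - 1) * exp (- (s * y))) * indicator {0<..} y) \<partial>lborel)"
    by (rule nn_integral_cmult[symmetric]) measurable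
  also have "\<dots> = (\<integral>\<^sup>+y. ennreal (s powr a) * (ennreal (y powr (a - 1) * exp (- (s * y))) * indicator {0<..} y) \<partial>lborel)"
    using \<open>0 < s\<close>
    by (intro nn_integral_cong)
       (auto simp: powr_mult powr_diff ennreal_mult''[symmetric] field_simps split: split_indicator)
  also have "\<dots> = ennreal (s powr a) * (\<integral>\<^sup>+y. ennreal (y powr (a - 1) * exp (- (s * y))) * indicator {0<..} y \<partial>lborel)"
    by (rule nn_integral_cmult) measurable
  finally have E: "ennreal (s powr a) * (\<integral>\<^sup>+y. ennreal (y powr (a - 1) * exp (- (s * y))) * indicator {0<..} y \<partial>lborel) = ennreal (Gamma a)"
    by simp
  have "(\<integral>\<^sup>+y. ennreal (y powr (a - 1) * exp (- (s * y))) * indicator {0<..} y \<partial>lborel) =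
    ennreal (s powr - a) * (ennreal (s powr a) * (\<integral>\<^sup>+y. ennreal (y powr (a - 1) * exp (- (s * y))) * indicator {0<..} y \<partial>lborel))"
    using \<open>0 < s\<close> by (simp add: mult.assoc[symmetric] ennreal_mult''[symmetric] powr_add[symmetric])
  then show ?thesis using E Gamma_real_pos[OF \<open>0 < a\<close>]
    by (simp add: ennreal_mult''[symmetric] mult.commute)
qed

text \<open>Writing \<open>1 - exp (- (l * y))\<close> as the integral of
  \<open>y * exp (- (s * y))\<close> over \<open>s\<close> from 0 to \<open>l\<close> and exchanging
  the integrals leaves a Gamma integral in \<open>y\<close>. Its value \<open>Gamma (1 - g)\<close>
  is what the normalization of the stable intensity cancels.\<close>

lemma nn_integral_Levy_powr:
  fixes g l :: real
  assumes g: "0 < g" "g < 1" and l: "0 \<le> l"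
  shows "(\<integral>\<^sup>+y. ennreal ((1 - exp (- (l * y))) * (g / Gamma (1 - g) * y powr (- g - 1))) * indicator {0<..} y \<partial>lborel) =
    ennreal (l powr g)"
proof -
  have Gpos: "0 < Gamma (1 - g)" using g by (intro Gamma_real_pos) auto
  have inner: "ennreal (1 - exp (- (l * y))) = (\<integral>\<^sup>+s. ennreal (y * exp (- (s * y))) * indicator {0..l} s \<partial>lborel)"
    if "0 < y" for y
  proof -
    have "(\<integral>\<^sup>+s. ennreal (y * exp (- (s * y))) * indicator {0..l} s \<partial>lborel)
        = ennreal (- exp (- (l * y)) - (- exp (- (0 * y))))"
      using that l
      by (intro nn_integral_FTC_Icc) (auto intro!: derivative_eq_intros simp: mult.commute)
    then show ?thesis by simp
  qed
  have step: "ennreal ((1 - exp (- (l * y))) * (g / Gamma (1 - g) * y powr (- g - 1))) * indicator {0<..} y =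
      (\<integral>\<^sup>+s. ennreal (g / Gamma (1 - g)) * (ennreal (y powr ((1 - g) - 1) * exp (- (s * y))) * indicator {0<..} y) * indicator {0..l} s \<partial>lborel)"
    (is "?L y = ?R y") for y
  proof (cases "0 < y")
    case True
    have "ennreal ((1 - exp (- (l * y))) * (g / Gamma (1 - g) * y powr (- g - 1))) =
       ennreal (1 - exp (- (l * y))) * ennreal (g / Gamma (1 - g) * y powr (- g - 1))"
      using True l g Gpos by (intro ennreal_mult) auto
    also have "\<dots> = (\<integral>\<^sup>+s. ennreal (y * exp (- (s * y))) * indicator {0..l} s * ennreal (g / Gamma (1 - g) * y powr (- g - 1)) \<partial>lborel)"
      unfolding inner[OF True] by (rule nn_integral_multc[symmetric]) measurable
    also have "\<dots> = (\<integral>\<^sup>+s. ennreal (g / Gamma (1 - g)) * (ennreal (y powr ((1 - g) - 1) * exp (- (s * y))) * indicator {0<..} y) * indicator {0..l} s \<partial>lborel)"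
    proof (rule nn_integral_cong)
      fix s
      have "y * exp (- (s * y)) * (g / Gamma (1 - g) * y powr (- g - 1)) =
         g / Gamma (1 - g) * (y powr ((1 - g) - 1) * exp (- (s * y)))"
        using True by (simp add: powr_diff powr_minus field_simps)
      then have "ennreal (y * exp (- (s * y))) * ennreal (g / Gamma (1 - g) * y powr (- g - 1)) =
         ennreal (g / Gamma (1 - g)) * ennreal (y powr ((1 - g) - 1) * exp (- (s * y)))"
        using True g Gpos by (simp add: ennreal_mult''[symmetric])
      then show "ennreal (y * exp (- (s * y))) * indicator {0..l} s * ennreal (g / Gamma (1 - g) * y powr (- g - 1)) =
         ennreal (g / Gamma (1 - g)) * (ennreal (y powr ((1 - g) - 1) * exp (- (s * y))) * indicator {0<..} y) * indicator {0..l} s"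
        using True by (auto split: split_indicator)
    qed
    finally show ?thesis using True by simp
  qed simp
  have "(\<integral>\<^sup>+y. ?L y \<partial>lborel) = (\<integral>\<^sup>+y. ?R y \<partial>lborel)"
    by (simp only: step)
  also have "\<dots> = (\<integral>\<^sup>+s. (\<integral>\<^sup>+y. ennreal (g / Gamma (1 - g)) * (ennreal (y powr ((1 - g) - 1) * exp (- (s * y))) * indicator {0<..} y) * indicator {0..l} s \<partial>lborel) \<partial>lborel)"
    by (rule lborel_pair.Fubini') measurable
  also have "\<dots> = (\<integral>\<^sup>+s. ennreal (g / Gamma (1 - g)) * (\<integral>\<^sup>+y. ennreal (y powr ((1 - g) - 1) * exp (- (s * y))) * indicator {0<..} y \<partial>lborel) * indicator {0..l} s \<partial>lborel)"
    by (intro nn_integral_cong, subst nn_integral_multc, measurable, subst nn_integral_cmult, measurable)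
  \<comment> \<open>At \<open>s = 0\<close> the inner integral diverges, so the integrands are
    compared off that point only.\<close>
  also have "\<dots> = (\<integral>\<^sup>+s. ennreal (g * s powr (g - 1)) * indicator {0..l} s \<partial>lborel)"
  proof (rule nn_integral_cong_AE)
    have pos: "ennreal (g / Gamma (1 - g)) * (\<integral>\<^sup>+y. ennreal (y powr ((1 - g) - 1) * exp (- (s * y))) * indicator {0<..} y \<partial>lborel) =
       ennreal (g * s powr (g - 1))" if "0 < s" for s
      using g Gpos that nn_integral_Gamma_scaled[of "1 - g" s] by (simp add: ennreal_mult''[symmetric] less_imp_neq[THEN not_sym])
    show "AE s in lborel. ennreal (g / Gamma (1 - g)) * (\<integral>\<^sup>+y. ennreal (y powr ((1 - g) - 1) * exp (- (s * y))) * indicator {0<..} y \<partial>lborel) * indicator {0..l} s =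
       ennreal (g * s powr (g - 1)) * indicator {0..l} s"
      using AE_lborel_singleton[of 0]
    proof eventually_elim
      case (elim s)
      then show ?case using pos[of s] by (cases "0 < s") auto
    qed
  qed
  also have "\<dots> = ennreal (l powr g)"
  proof -
    have "((\<lambda>s. s powr (g - 1)) has_integral (l powr (g - 1 + 1) / (g - 1 + 1))) {0..l}"
      using g l by (intro has_integral_powr_from_0) auto
    then have "((\<lambda>s. g * s powr (g - 1)) has_integral (g * (l powr g / g))) {0..l}"
      by (intro has_integral_mult_right) simp
    from nn_integral_has_integral_lebesgue[OF _ this] g
    have "(\<integral>\<^sup>+s. ennreal (indicator {0..l} s * (g * s powr (g - 1))) \<partial>lborel) = ennreal (l powr g)"
      by (simp add: nn_integral_completion)
    moreover have "(\<integral>\<^sup>+s. ennreal (g * s powr (g - 1)) * indicator {0..l} s \<partial>lborel) =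
        (\<integral>\<^sup>+s. ennreal (indicator {0..l} s * (g * s powr (g - 1))) \<partial>lborel)"
      by (intro nn_integral_cong) (auto split: split_indicator)
    ultimately show ?thesis by simp
  qed
  finally show ?thesis .
qed

text \<open>Generating functions are available here only for nonnegative arguments, so agreement is
  assumed on a one-sided interval. Dividing by \<open>x\<close> and letting \<open>x\<close> tend to
  0 from the right kills the first remaining coefficient; induction over shifted coefficient
  sequences does the rest.\<close>

lemma powser_unique:
  fixes a b :: "nat \<Rightarrow> real"
  assumes r: "0 < r"
    and a: "\<And>x. 0 \<le> x \<Longrightarrow> x \<le> r \<Longrightarrow> (\<lambda>n. a n * x ^ n) sums f x"
    and b: "\<And>x. 0 \<le> x \<Longrightarrow> x \<le> r \<Longrightarrow> (\<lambda>n. b n * x ^ n) sums f x"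
  shows "a = b"
proof -
  have zero: "d n = 0" if "\<And>x. 0 \<le> x \<Longrightarrow> x \<le> r \<Longrightarrow> (\<lambda>n. d n * x ^ n) sums 0" for d :: "nat \<Rightarrow> real" and n
    using that
  proof (induction n arbitrary: d)
    case 0
    from 0[of 0] r show ?case by simp
  next
    case (Suc n)
    have d0: "d 0 = 0" using Suc.prems[of 0] r by simp
    have pos: "(\<lambda>n. d (Suc n) * x ^ n) sums 0" if "0 < x" "x \<le> r" for x
    proof -
      have "(\<lambda>n. d (Suc n) * x ^ Suc n) sums 0"
        using Suc.prems[of x] that by (subst sums_Suc_iff) (simp add: d0)
      then have "(\<lambda>n. (d (Suc n) * x ^ Suc n) / x) sums (0 / x)"
        by (rule sums_divide)
      then show ?thesis using that by simp
    qed
    have summ: "summable (\<lambda>n. d (Suc n) * x ^ n)" if "norm x < r" for x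
      using powser_inside[OF sums_summable[OF pos[of r]], of x] r that by simp
    have cont: "((\<lambda>x. \<Sum>n. d (Suc n) * x ^ n) \<longlongrightarrow> d (Suc 0)) (at 0)"
      using powser_limit_0[of r "\<lambda>n. d (Suc n)" "\<lambda>x. \<Sum>n. d (Suc n) * x ^ n"] r summ
      by (simp add: summable_sums)
    have "((\<lambda>x. \<Sum>n. d (Suc n) * x ^ n) \<longlongrightarrow> d (Suc 0)) (at_right 0)"
      by (rule filterlim_mono[OF cont]) (auto simp: at_within_le_at)
    moreover have "\<forall>\<^sub>F x in at_right 0. (\<Sum>n. d (Suc n) * x ^ n) = 0"
      using eventually_at_right_less[of "0::real"] eventually_at_right[of 0 r] r
        pos[THEN sums_unique] by (auto intro!: eventually_at_rightI[of 0 r])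
    ultimately have "((\<lambda>x. 0) \<longlongrightarrow> d (Suc 0)) (at_right (0::real))"
      by (rule Lim_transform_eventually)
    then have d1: "d (Suc 0) = 0"
      by (simp add: tendsto_const_iff)
    \<comment> \<open>The limit supplies the value at \<open>x = 0\<close> that was lost in the
      division, so the shifted sequence meets the assumption of the induction hypothesis.\<close>
    have "(\<lambda>n. d (Suc n) * x ^ n) sums 0" if "0 \<le> x" "x \<le> r" for x
      using pos[of x] that d1 by (cases "x = 0") auto
    then show ?case by (rule Suc.IH)
  qed
  have "(\<lambda>n. (a n - b n) * x ^ n) sums 0" if "0 \<le> x" "x \<le> r" for x
    using sums_diff[OF a[OF that] b[OF that]] by (simp add: left_diff_distrib)
  then have "a n - b n = 0" for n by (rule zero)
  then show ?thesis by auto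
qed

lemma polynomial_coeffs_unique:
  fixes a b :: "nat \<Rightarrow> real"
  assumes r: "0 < r"
    and eq: "\<And>x. 0 \<le> x \<Longrightarrow> x \<le> r \<Longrightarrow> (\<Sum>i\<le>n. a i * x ^ i) = (\<Sum>i\<le>n. b i * x ^ i)"
    and i: "i \<le> n"
  shows "a i = b i"
proof -
  have s: "(\<lambda>i. (if i \<le> n then c i else 0) * x ^ i) sums (\<Sum>i\<le>n. c i * x ^ i)" for c :: "nat \<Rightarrow> real" and x
    using sums_If_finite_set[of "{..n}" "\<lambda>i. c i * x ^ i"] by (simp add: if_distrib if_distribR cong: if_cong)
  have "(\<lambda>i. if i \<le> n then a i else 0) = (\<lambda>i. if i \<le> n then b i else 0)"
    using s[of b] s[of a] eq by (intro powser_unique[OF r]) (auto simp: )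
  from fun_cong[OF this, of i] show ?thesis using i by simp
qed


section \<open>Poisson weights and exponential tail bounds\<close>

definition poisson_weight :: "real \<Rightarrow> nat \<Rightarrow> real" where
  "poisson_weight m k = exp (- m) * m ^ k / fact k"

lemma poisson_weight_nonneg: "0 \<le> m \<Longrightarrow> 0 \<le> poisson_weight m k"
  by (simp add: poisson_weight_def)

lemma poisson_weight_pgf: "(\<lambda>k. poisson_weight m k * z ^ k) sums exp (- m * (1 - z))"
proof -
  have "(\<lambda>k. exp (- m) * ((m * z) ^ k /\<^sub>R fact k)) sums (exp (- m) * exp (m * z))"
    by (intro sums_mult exp_converges)
  then show ?thesis
    by (simp add: poisson_weight_def exp_add[symmetric] algebra_simps power_mult_distrib divide_inverse)
qed

lemma poisson_weight_sums_1: "poisson_weight m sums 1"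
  using poisson_weight_pgf[of m 1] by simp

text \<open>The Cramer rate function of the Poisson law of mean 1: a deviation from mean
  \<open>m\<close> to \<open>x * m\<close> costs \<open>poisson_rate x * m\<close> in the
  exponent.\<close>

definition poisson_rate :: "real \<Rightarrow> real" where
  "poisson_rate x = x * ln x - x + 1"

lemma poisson_rate_pos: "0 < x \<Longrightarrow> x \<noteq> 1 \<Longrightarrow> 0 < poisson_rate x"
proof -
  assume x: "0 < x" "x \<noteq> 1"
  have "ln (1 / x) < 1 / x - 1"
    using x ln_le_minus_one[of "1/x"] ln_eq_minus_one[of "1/x"] by fastforce
  then have "x * (- ln x) < x * (1 / x - 1)" using x
    by (intro mult_strict_left_mono) (auto simp: ln_div)
  then show ?thesis using x by (simp add: poisson_rate_def algebra_simps)
qed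

text \<open>Tilting by \<open>x ^ k\<close>, the optimal exponential weight at level
  \<open>x * m\<close>. The sign condition on \<open>B\<close> treats both tails at once: it means
  \<open>k \<ge> x * m\<close> for \<open>x > 1\<close> and \<open>k \<le> x * m\<close> for
  \<open>x < 1\<close>.\<close>

lemma poisson_weight_Chernoff:
  assumes m: "0 \<le> m" and x: "0 < x" and B: "\<And>k. k \<in> B \<Longrightarrow> 0 \<le> (real k - x * m) * ln x"
  shows "(\<Sum>k. ennreal (poisson_weight m k) * indicator B k) \<le> ennreal (exp (- (poisson_rate x * m)))"
proof -
  have "(\<Sum>k. ennreal (poisson_weight m k) * indicator B k) \<le> (\<Sum>k. ennreal (exp (- (x * m * ln x)) * (poisson_weight m k * x ^ k)))"
  proof (rule suminf_le)
    fix k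
    have "1 \<le> exp (- (x * m * ln x)) * x ^ k" if "k \<in> B"
    proof -
      have "exp (- (x * m * ln x)) * x ^ k = exp ((real k - x * m) * ln x)"
        using x powr_realpow[OF x, of k] by (simp add: powr_def left_diff_distrib exp_diff exp_minus divide_inverse)
      then show ?thesis using B[OF that] by simp
    qed
    then have "poisson_weight m k \<le> exp (- (x * m * ln x)) * (poisson_weight m k * x ^ k)" if "k \<in> B"
      using mult_left_mono[of 1 "exp (- (x * m * ln x)) * x ^ k" "poisson_weight m k"] poisson_weight_nonneg[OF m, of k] that
      by (simp add: algebra_simps)
    then show "ennreal (poisson_weight m k) * indicator B k \<le> ennreal (exp (- (x * m * ln x)) * (poisson_weight m k * x ^ k))"
      by (auto split: split_indicator intro: ennreal_leI)
  qed auto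
  also have "\<dots> = ennreal (\<Sum>k. exp (- (x * m * ln x)) * (poisson_weight m k * x ^ k))"
    using m x by (intro suminf_ennreal2 summable_mult sums_summable[OF poisson_weight_pgf])
       (auto simp: poisson_weight_nonneg)
  also have "(\<Sum>k. exp (- (x * m * ln x)) * (poisson_weight m k * x ^ k)) = exp (- (x * m * ln x)) * exp (- m * (1 - x))"
    by (intro sums_unique[symmetric] sums_mult poisson_weight_pgf)
  also have "\<dots> = exp (- (poisson_rate x * m))"
    by (simp add: poisson_rate_def exp_add[symmetric] algebra_simps)
  finally show ?thesis .
qed

section \<open>Uniqueness of Laplace transforms\<close>

text \<open>Under \<open>x \<mapsto> exp (- x)\<close> the transforms at integers become moments of
  measures on the unit interval. Weierstrass approximation extends equality from polynomials to
  continuous functions, and ramps extend it to half-lines.\<close>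

lemma finite_measure_Laplace_unique:
  fixes A B :: "real measure"
  assumes A: "finite_measure A" "sets A = sets borel" "AE x in A. 0 \<le> x"
    and B: "finite_measure B" "sets B = sets borel" "AE x in B. 0 \<le> x"
    and eq: "\<And>n::nat. (\<integral>\<^sup>+x. ennreal (exp (- (real n * x))) \<partial>A) = (\<integral>\<^sup>+x. ennreal (exp (- (real n * x))) \<partial>B)"
  shows "A = B"
proof -
  note [measurable_cong] = A(2) B(2)
  interpret A: finite_measure A by fact
  interpret B: finite_measure B by fact
  have int: "integrable C (\<lambda>x. g (exp (- x)))"
    if C: "finite_measure C" "sets C = sets borel" "AE x in C. 0 \<le> x" and g: "continuous_on UNIV g"
    for C :: "real measure" and g :: "real \<Rightarrow> real"
  proof -
    note [measurable_cong] = C(2)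
    interpret C: finite_measure C by fact
    have [measurable]: "g \<in> borel_measurable borel" using g by (rule borel_measurable_continuous_onI)
    have "compact (g ` {0..1})"
      by (intro compact_continuous_image continuous_on_subset[OF g]) auto
    then obtain K where K: "\<And>u. u \<in> {0..1} \<Longrightarrow> \<bar>g u\<bar> \<le> K"
      using compact_imp_bounded bounded_real by (metis imageI)
    show ?thesis
      using C(3) by (intro C.integrable_const_bound[where B=K]) (auto intro!: K elim!: eventually_mono)
  qed
  have pow: "(\<integral>x. exp (- x) ^ n \<partial>A) = (\<integral>x. exp (- x) ^ n \<partial>B)" for n
    using eq[of n] by (simp add: integral_eq_nn_integral exp_of_nat_mult[symmetric])
  have poly: "(\<integral>x. (\<Sum>i\<le>n. a i * exp (- x) ^ i) \<partial>A) = (\<integral>x. (\<Sum>i\<le>n. a i * exp (- x) ^ i) \<partial>B)" for a :: "nat \<Rightarrow> real" and n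
  proof -
    have "continuous_on UNIV (\<lambda>u::real. u ^ i)" for i by (intro continuous_intros)
    note this[THEN int[OF A]] this[THEN int[OF B]]
    then show ?thesis by (subst (1 2) Bochner_Integration.integral_sum) (auto simp: pow)
  qed
  have cont: "(\<integral>x. g (exp (- x)) \<partial>A) = (\<integral>x. g (exp (- x)) \<partial>B)" if g: "continuous_on UNIV g" for g :: "real \<Rightarrow> real"
  proof -
    \<comment> \<open>The added 1 keeps the divisor positive even when both measures vanish; the
      error \<open>e / K\<close> is later multiplied by the two total masses.\<close>
    define K where "K = measure A (space A) + measure B (space B) + 1"
    have "0 < K" by (simp add: K_def add_nonneg_pos)
    have "\<bar>(\<integral>x. g (exp (- x)) \<partial>A) - (\<integral>x. g (exp (- x)) \<partial>B)\<bar> \<le> e" if "0 < e" for e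
    proof -
      obtain p where p: "real_polynomial_function p" "\<And>u. u \<in> {0..1} \<Longrightarrow> \<bar>g u - p u\<bar> < e / K"
        using Stone_Weierstrass_real_polynomial_function[of "{0..1::real}" g "e / K"]
          continuous_on_subset[OF g] \<open>0 < e\<close> \<open>0 < K\<close> by auto
      then obtain a n where pa: "p = (\<lambda>x. \<Sum>i\<le>n. a i * x ^ i)"
        by (auto simp: real_polynomial_function_iff_sum)
      have cp: "continuous_on UNIV p" unfolding pa by (intro continuous_intros)
      have bd: "\<bar>(\<integral>x. g (exp (- x)) \<partial>C) - (\<integral>x. p (exp (- x)) \<partial>C)\<bar> \<le> e / K * measure C (space C)"
        if C: "finite_measure C" "sets C = sets borel" "AE x in C. 0 \<le> x" for C
      proof -
        interpret C: finite_measure C by fact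
        have "\<bar>(\<integral>x. g (exp (- x)) \<partial>C) - (\<integral>x. p (exp (- x)) \<partial>C)\<bar> = \<bar>\<integral>x. g (exp (- x)) - p (exp (- x)) \<partial>C\<bar>"
          by (simp add: int[OF C g] int[OF C cp])
        also have "\<dots> \<le> (\<integral>x. \<bar>g (exp (- x)) - p (exp (- x))\<bar> \<partial>C)"
          by (rule integral_abs_bound)
        also have "\<dots> \<le> (\<integral>x. e / K \<partial>C)"
        proof (rule integral_mono_AE)
          show "AE x in C. \<bar>g (exp (- x)) - p (exp (- x))\<bar> \<le> e / K"
            using C(3) p(2) by (auto intro: less_imp_le elim!: eventually_mono)
        qed (auto intro!: Bochner_Integration.integrable_diff integrable_abs int[OF C g] int[OF C cp])
        finally show ?thesis by (simp add: mult.commute)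
      qed
      have "\<bar>(\<integral>x. g (exp (- x)) \<partial>A) - (\<integral>x. g (exp (- x)) \<partial>B)\<bar> \<le> e / K * measure A (space A) + e / K * measure B (space B)"
        using bd[OF A] bd[OF B] poly[of a n] unfolding pa by linarith
      also have "\<dots> \<le> e / K * K"
        using \<open>0 < e\<close> \<open>0 < K\<close> unfolding distrib_left[symmetric]
        by (intro mult_left_mono) (auto simp: K_def)
      finally show ?thesis using \<open>0 < K\<close> by simp
    qed
    then have "\<bar>(\<integral>x. g (exp (- x)) \<partial>A) - (\<integral>x. g (exp (- x)) \<partial>B)\<bar> \<le> 0"
      by (rule field_le_epsilon[of _ 0, simplified])
    then show ?thesis by simp
  qed
  \<comment> \<open>Continuous ramps in \<open>u = exp (- x)\<close> that rise with \<open>k\<close>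
    to the indicator of \<open>u < exp (- a)\<close>, that is, of \<open>x > a\<close>.\<close>
  define g where "g k a u = min 1 (max 0 (real k * (exp (- a) - u)))" for k a u
  have lim: "(\<lambda>k. \<integral>x. g k a (exp (- x)) \<partial>C) \<longlonglongrightarrow> measure C {a<..}"
    if C: "finite_measure C" "sets C = sets borel" for C a
  proof -
    note [measurable_cong] = C(2)
    interpret C: finite_measure C by fact
    have "(\<lambda>k. \<integral>x. g k a (exp (- x)) \<partial>C) \<longlonglongrightarrow> (\<integral>x. indicator {a<..} x \<partial>C)"
    proof (rule integral_dominated_convergence[where w="\<lambda>_. 1"])
      show "AE x in C. (\<lambda>k. g k a (exp (- x))) \<longlonglongrightarrow> indicator {a<..} x"
      proof (rule AE_I2)
        fix x
        show "(\<lambda>k. g k a (exp (- x))) \<longlonglongrightarrow> indicator {a<..} x"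
        proof (cases "a < x")
          case True
          define d where "d = exp (- a) - exp (- x)"
          have "0 < d" using True by (simp add: d_def)
          then have "\<forall>\<^sub>F k in sequentially. 1 \<le> real k * d" by real_asymp
          then have "\<forall>\<^sub>F k in sequentially. g k a (exp (- x)) = 1"
            by eventually_elim (simp add: g_def d_def)
          then show ?thesis using True by (simp add: tendsto_eventually)
        next
          case False
          then have "exp (- a) - exp (- x) \<le> 0" by simp
          then have "g k a (exp (- x)) = 0" for k
            unfolding g_def by (metis max.absorb1 min.absorb2 mult_nonneg_nonpos of_nat_0_le_iff zero_le_one)
          then show ?thesis using False by simp
        qed
      qed
    qed (auto simp: g_def)
    then show ?thesis using C(2) by (simp add: sets_eq_imp_space_eq[OF C(2)])
  qed
  have "measure A {a<..} = measure B {a<..}" for a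
  proof -
    have "(\<lambda>k. \<integral>x. g k a (exp (- x)) \<partial>A) = (\<lambda>k. \<integral>x. g k a (exp (- x)) \<partial>B)"
      by (rule ext, rule cont) (auto simp: g_def intro!: continuous_intros)
    then show ?thesis using lim[OF A(1,2), of a] lim[OF B(1,2), of a] by (metis LIMSEQ_unique)
  qed
  then show ?thesis
    by (intro measure_eqI_lessThan A(2) B(2)) (auto simp: A.emeasure_eq_measure B.emeasure_eq_measure)
qed

text \<open>Finiteness is known only after weighting by \<open>X ^ n * exp (- X)\<close>, so
  uniqueness is applied to the weighted image measures and the strictly positive weight is divided
  out again. Hence \<open>\<phi>\<close> may be any measurable nonnegative function, with possibly
  infinite integrals.\<close>

lemma nn_integral_Laplace_unique:
  fixes X :: "'a \<Rightarrow> real" and Y :: "'b \<Rightarrow> real"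
  assumes [measurable]: "X \<in> borel_measurable M" "W \<in> borel_measurable M"
      "Y \<in> borel_measurable N" "V \<in> borel_measurable N"
    and X: "AE \<omega> in M. 0 < X \<omega>" and Y: "AE \<omega> in N. 0 < Y \<omega>"
    and eq: "\<And>s. 0 < s \<Longrightarrow> (\<integral>\<^sup>+\<omega>. ennreal (X \<omega> ^ n * exp (- (s * X \<omega>))) * W \<omega> \<partial>M) =
      (\<integral>\<^sup>+\<omega>. ennreal (Y \<omega> ^ n * exp (- (s * Y \<omega>))) * V \<omega> \<partial>N)"
    and fin: "(\<integral>\<^sup>+\<omega>. ennreal (X \<omega> ^ n * exp (- X \<omega>)) * W \<omega> \<partial>M) < \<infinity>"
    and [measurable]: "\<phi> \<in> borel_measurable borel"
  shows "(\<integral>\<^sup>+\<omega>. \<phi> (X \<omega>) * W \<omega> \<partial>M) = (\<integral>\<^sup>+\<omega>. \<phi> (Y \<omega>) * V \<omega> \<partial>N)"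
proof -
  define w where "w x = ennreal (x ^ n * exp (- x))" for x :: real
  have [measurable]: "w \<in> borel_measurable borel" unfolding w_def by measurable
  define A where "A = distr (density M (\<lambda>\<omega>. w (X \<omega>) * W \<omega>)) borel X"
  define B where "B = distr (density N (\<lambda>\<omega>. w (Y \<omega>) * V \<omega>)) borel Y"
  have nnA: "(\<integral>\<^sup>+x. f x \<partial>A) = (\<integral>\<^sup>+\<omega>. (w (X \<omega>) * W \<omega>) * f (X \<omega>) \<partial>M)" if [measurable]: "f \<in> borel_measurable borel" for f
    by (simp add: A_def nn_integral_distr nn_integral_density)
  have nnB: "(\<integral>\<^sup>+x. f x \<partial>B) = (\<integral>\<^sup>+\<omega>. (w (Y \<omega>) * V \<omega>) * f (Y \<omega>) \<partial>N)" if [measurable]: "f \<in> borel_measurable borel" for f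
    by (simp add: B_def nn_integral_distr nn_integral_density)
  \<comment> \<open>The weight \<open>w\<close> already contains \<open>exp (- x)\<close>, so the
    integer argument \<open>k\<close> corresponds to \<open>s = 1 + k\<close>.\<close>
  have L: "(\<integral>\<^sup>+x. ennreal (exp (- (real k * x))) \<partial>A) = (\<integral>\<^sup>+x. ennreal (exp (- (real k * x))) \<partial>B)" for k
  proof -
    have "(\<integral>\<^sup>+x. ennreal (exp (- (real k * x))) \<partial>A) = (\<integral>\<^sup>+\<omega>. ennreal (X \<omega> ^ n * exp (- ((1 + real k) * X \<omega>))) * W \<omega> \<partial>M)"
      unfolding nnA[of "\<lambda>x. ennreal (exp (- (real k * x)))", simplified] using X
      by (intro nn_integral_cong_AE, eventually_elim)
         (auto simp: w_def mult_ac ennreal_mult''[symmetric] mult.assoc[symmetric] exp_add[symmetric] algebra_simps exp_minus_inverse)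
    moreover have "(\<integral>\<^sup>+x. ennreal (exp (- (real k * x))) \<partial>B) = (\<integral>\<^sup>+\<omega>. ennreal (Y \<omega> ^ n * exp (- ((1 + real k) * Y \<omega>))) * V \<omega> \<partial>N)"
      unfolding nnB[of "\<lambda>x. ennreal (exp (- (real k * x)))", simplified] using Y
      by (intro nn_integral_cong_AE, eventually_elim)
         (auto simp: w_def mult_ac ennreal_mult''[symmetric] mult.assoc[symmetric] exp_add[symmetric] algebra_simps exp_minus_inverse)
    ultimately show ?thesis using eq[of "1 + real k"] by simp
  qed
  have finA: "emeasure A (space A) < \<infinity>"
    using nnA[of "\<lambda>_. 1"] fin by (simp add: w_def)
  have finB: "emeasure B (space B) < \<infinity>"
    using L[of 0] finA by simp
  have AB: "A = B"
  proof (rule finite_measure_Laplace_unique)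
    show "AE x in A. 0 \<le> x" unfolding A_def using X
      by (subst AE_distr_iff) (auto simp: AE_density less_imp_le elim!: eventually_mono)
    show "AE x in B. 0 \<le> x" unfolding B_def using Y
      by (subst AE_distr_iff) (auto simp: AE_density less_imp_le elim!: eventually_mono)
    show "finite_measure A" "finite_measure B" using finA finB by (auto intro!: finite_measureI)
  qed (use L in \<open>auto simp: A_def B_def\<close>)
  have cancel: "w x * c * (\<phi> x * inverse (w x)) = \<phi> x * c" if "0 < x" for x c
  proof -
    have "w x * inverse (w x) = 1"
      using that by (simp add: w_def inverse_ennreal ennreal_mult''[symmetric] field_simps)
    then show ?thesis by (metis mult.assoc mult.commute mult.right_neutral)
  qed
  have "(\<integral>\<^sup>+\<omega>. \<phi> (X \<omega>) * W \<omega> \<partial>M) = (\<integral>\<^sup>+x. \<phi> x * inverse (w x) \<partial>A)"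
    by (subst nnA, measurable, intro nn_integral_cong_AE) (use X in \<open>auto simp: cancel elim!: eventually_mono\<close>)
  also have "\<dots> = (\<integral>\<^sup>+\<omega>. \<phi> (Y \<omega>) * V \<omega> \<partial>N)"
    unfolding AB
    by (subst nnB, measurable, intro nn_integral_cong_AE) (use Y in \<open>auto simp: cancel elim!: eventually_mono\<close>)
  finally show ?thesis .
qed

section \<open>Poisson points with stable intensity\<close>

lemma nn_integral_stable_intensity:
  assumes [measurable]: "F \<in> borel_measurable borel"
  shows "(\<integral>\<^sup>+y. F y \<partial>stable_intensity g) =
    (\<integral>\<^sup>+y. F y * ennreal (g / Gamma (1 - g) * y powr (- g - 1)) * indicator {0<..} y \<partial>lborel)"
  unfolding stable_intensity_def
  by (subst nn_integral_density) (auto intro!: nn_integral_cong simp: mult_ac)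

lemma sets_stable_intensity[measurable_cong]: "sets (stable_intensity g) = sets borel"
  by (simp add: stable_intensity_def)

lemma stable_intensity_tail:
  assumes g: "0 < g" "g < 1" and y: "0 < y"
  shows "emeasure (stable_intensity g) {y<..} = ennreal (y powr (- g) / Gamma (1 - g))"
proof -
  have Gpos: "0 < Gamma (1 - g)" using g by (intro Gamma_real_pos) auto
  have "emeasure (stable_intensity g) {y<..} = (\<integral>\<^sup>+x. indicator {y<..} x \<partial>stable_intensity g)"
    by simp
  also have "\<dots> = (\<integral>\<^sup>+x. ennreal (g / Gamma (1 - g) * x powr (- g - 1)) * indicator {y..} x \<partial>lborel)"
    using y by (subst nn_integral_stable_intensity, simp, intro nn_integral_cong_AE AE_I[where N="{y}"]) (auto split: split_indicator)
  also have "\<dots> = ennreal (0 - (- (y powr (- g)) / Gamma (1 - g)))"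
  proof (rule nn_integral_FTC_atLeast)
    show "((\<lambda>x. - (x powr (- g)) / Gamma (1 - g)) \<longlongrightarrow> 0) at_top"
    proof -
      have "((\<lambda>x. x powr (- g)) \<longlongrightarrow> 0) at_top" using g by real_asymp
      then have "((\<lambda>x. - 1 / Gamma (1 - g) * x powr (- g)) \<longlongrightarrow> - 1 / Gamma (1 - g) * 0) at_top"
        by (intro tendsto_mult_left)
      then show ?thesis by simp
    qed
    fix x assume "y \<le> x"
    then show "((\<lambda>x. - (x powr (- g)) / Gamma (1 - g)) has_real_derivative g / Gamma (1 - g) * x powr (- g - 1)) (at x)"
      using y Gpos by (auto intro!: derivative_eq_intros simp: field_simps)
    show "0 \<le> g / Gamma (1 - g) * x powr (- g - 1)" using g Gpos by simp
  qed measurable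
  finally show ?thesis by simp
qed

lemma stable_intensity_Laplace:
  assumes g: "0 < g" "g < 1" and l: "0 \<le> l"
  shows "(\<integral>\<^sup>+y. ennreal (1 - exp (- (l * y))) \<partial>stable_intensity g) = ennreal (l powr g)"
proof -
  have Gpos: "0 < Gamma (1 - g)" using g by (intro Gamma_real_pos) auto
  show ?thesis
    unfolding nn_integral_Levy_powr[OF assms, symmetric]
    by (subst nn_integral_stable_intensity)
       (use g l Gpos in \<open>auto intro!: nn_integral_cong simp: ennreal_mult''[symmetric] split: split_indicator\<close>)
qed

section \<open>The Laplace functional of ranked Poisson points\<close>

lemma measurable_seq_space_component: "(\<lambda>p. p i) \<in> borel_measurable seq_space"
  unfolding seq_space_def by measurable

lemma decseq_prod_le_1:
  fixes a :: "nat \<Rightarrow> ennreal"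
  assumes "\<And>i. a i \<le> 1"
  shows "decseq (\<lambda>m. \<Prod>i<m. a i)"
proof (rule decseq_SucI)
  fix m
  show "(\<Prod>i<Suc m. a i) \<le> (\<Prod>i<m. a i)"
    using mult_left_mono[OF assms[of m], of "\<Prod>i<m. a i"] by simp
qed

lemma INF_eq_limit:
  fixes a :: "nat \<Rightarrow> ennreal"
  assumes "decseq a" "a \<longlonglongrightarrow> c"
  shows "(INF m. a m) = c"
  using LIMSEQ_INF[OF assms(1)] assms(2) by (rule LIMSEQ_unique)

lemma ranked_poisson_points_finite:
  assumes R: "ranked_poisson_points M \<mu> J" and A: "A \<in> sets borel" "emeasure \<mu> A < \<infinity>"
  shows "AE \<omega> in M. finite {i. J \<omega> i \<in> A}"
    and "measure M {\<omega>\<in>space M. card {i. J \<omega> i \<in> A} = k} = poisson_weight (measure \<mu> A) k"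
proof -
  from R have *: "\<forall>A\<in>sets borel. emeasure \<mu> A < \<infinity> \<longrightarrow>
        (AE \<omega> in M. finite {i. J \<omega> i \<in> A}) \<and>
        (\<forall>k. measure M {\<omega>\<in>space M. card {i. J \<omega> i \<in> A} = k} =
              exp (- measure \<mu> A) * measure \<mu> A ^ k / fact k)"
    unfolding ranked_poisson_points_def by (elim conjE) assumption
  note * = *[THEN bspec, OF A(1), THEN mp, OF A(2)]
  show "AE \<omega> in M. finite {i. J \<omega> i \<in> A}"
    using * by (rule conjunct1)
  show "measure M {\<omega>\<in>space M. card {i. J \<omega> i \<in> A} = k} = poisson_weight (measure \<mu> A) k"
    using *[THEN conjunct2] unfolding poisson_weight_def by (rule spec)
qed

lemma ranked_poisson_points_indep:
  fixes n :: nat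
  assumes R: "ranked_poisson_points M \<mu> J"
    and A: "\<And>l. l < n \<Longrightarrow> A l \<in> sets borel \<and> emeasure \<mu> (A l) < \<infinity>" "disjoint_family_on A {..<n}"
  shows "prob_space.indep_vars M (\<lambda>_. count_space UNIV) (\<lambda>l \<omega>. card {i. J \<omega> i \<in> A l}) {..<n}"
proof -
  from R have "\<forall>n. \<forall>A :: nat \<Rightarrow> real set.
        (\<forall>l<n. A l \<in> sets borel \<and> emeasure \<mu> (A l) < \<infinity>) \<longrightarrow>
        disjoint_family_on A {..<n} \<longrightarrow>
        prob_space.indep_vars M (\<lambda>_. count_space UNIV)
          (\<lambda>l \<omega>. card {i. J \<omega> i \<in> A l}) {..<n}"
    unfolding ranked_poisson_points_def by (elim conjE) assumption
  from this[rule_format, of n A] A show ?thesis by simp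
qed

lemma ranked_poisson_points_count:
  assumes R: "ranked_poisson_points M \<mu> J" and A: "A \<in> sets borel" "emeasure \<mu> A < \<infinity>"
  shows "(\<lambda>\<omega>. card {i. J \<omega> i \<in> A}) \<in> M \<rightarrow>\<^sub>M count_space UNIV"
    and "(\<integral>\<^sup>+\<omega>. f (card {i. J \<omega> i \<in> A}) \<partial>M) = (\<Sum>k. ennreal (poisson_weight (measure \<mu> A) k) * f k)"
proof -
  interpret prob_space M using R by (simp add: ranked_poisson_points_def)
  let ?N = "\<lambda>\<omega>. card {i. J \<omega> i \<in> A}"
  \<comment> \<open>Measurability of a count is contained in the independence clause; a family
    consisting of a single set extracts it.\<close>
  have "indep_vars (\<lambda>_. count_space UNIV) (\<lambda>l \<omega>. card {i. J \<omega> i \<in> (\<lambda>_. A) l}) {..<Suc 0}"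
    by (rule ranked_poisson_points_indep[OF R]) (use A in \<open>auto simp: disjoint_family_on_def\<close>)
  then show N[measurable]: "?N \<in> M \<rightarrow>\<^sub>M count_space UNIV"
    by (auto simp: indep_vars_def)
  have pm: "emeasure M {\<omega>\<in>space M. ?N \<omega> = k} = ennreal (poisson_weight (measure \<mu> A) k)" for k
    by (simp only: emeasure_eq_measure ranked_poisson_points_finite(2)[OF R A])
  have "(\<integral>\<^sup>+\<omega>. f (?N \<omega>) \<partial>M) = (\<integral>\<^sup>+\<omega>. (\<Sum>k. f k * indicator {\<omega>\<in>space M. ?N \<omega> = k} \<omega>) \<partial>M)"
    by (intro nn_integral_cong suminf_cmult_indicator[symmetric]) (auto simp: disjoint_family_on_def)
  also have "\<dots> = (\<Sum>k. f k * emeasure M {\<omega>\<in>space M. ?N \<omega> = k})"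
    by (simp add: nn_integral_suminf nn_integral_cmult)
  finally show "(\<integral>\<^sup>+\<omega>. f (?N \<omega>) \<partial>M) = (\<Sum>k. ennreal (poisson_weight (measure \<mu> A) k) * f k)"
    by (simp add: pm mult.commute)
qed

text \<open>The product over the points splits into factors \<open>(1 - e l) ^ N l\<close> over the
  level sets of \<open>\<phi>\<close>, with independent Poisson counts \<open>N l\<close>, whose
  generating functions multiply to the exponential.\<close>

lemma Laplace_functional_simple:
  fixes \<phi> :: "real \<Rightarrow> real"
  assumes R: "ranked_poisson_points M \<mu> J" and mu[measurable_cong]: "sets \<mu> = sets borel"
    and [measurable]: "\<phi> \<in> borel_measurable borel"
    and \<phi>: "\<And>y. 0 \<le> \<phi> y" "\<And>y. \<phi> y \<le> 1" and simple: "finite (range \<phi>)"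
    and fin: "(\<integral>\<^sup>+y. ennreal (\<phi> y) \<partial>\<mu>) < \<infinity>"
  shows "(\<integral>\<^sup>+\<omega>. (INF m. \<Prod>i<m. ennreal (1 - \<phi> (J \<omega> i))) \<partial>M) =
    ennreal (exp (- enn2real (\<integral>\<^sup>+y. ennreal (\<phi> y) \<partial>\<mu>)))"
proof -
  interpret prob_space M using R by (simp add: ranked_poisson_points_def)
  \<comment> \<open>The value 0 is left out: its level set may have infinite intensity, and its
    points contribute the factor 1.\<close>
  obtain n e where e: "bij_betw e {..<n::nat} (range \<phi> - {0})"
    using ex_bij_betw_nat_finite[of "range \<phi> - {0}"] simple by (auto simp: atLeast0LessThan)
  have inj: "inj_on e {..<n}" using e by (simp add: bij_betw_def)
  have e01: "0 < e l" "e l \<le> 1" "e l \<noteq> 0" "0 \<le> e l" if "l < n" for l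
  proof -
    have "e l \<in> range \<phi> - {0}" using e that by (auto simp: bij_betw_def)
    then obtain y where y: "e l = \<phi> y" "e l \<noteq> 0" by auto
    then show "0 < e l" "e l \<le> 1" "e l \<noteq> 0" "0 \<le> e l" using \<phi>[of y] by auto
  qed
  have ex_l: "\<exists>l<n. \<phi> y = e l" if "\<phi> y \<noteq> 0" for y
  proof -
    have "\<phi> y \<in> e ` {..<n}" using e that by (simp add: bij_betw_def)
    then show ?thesis by auto
  qed
  define A where "A l = \<phi> -` {e l}" for l
  have Am: "A l \<in> sets borel" for l
    using measurable_sets[of \<phi> borel borel "{e l}"] by (simp add: A_def)
  have [measurable]: "A l \<in> sets \<mu>" for l using Am by (simp add: mu)
  have disj: "disjoint_family_on A {..<n}"
    using inj by (auto simp: disjoint_family_on_def A_def inj_on_def)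
  have \<phi>_sum: "ennreal (\<phi> y) = (\<Sum>l<n. ennreal (e l) * indicator (A l) y)" for y
  proof (cases "\<phi> y = 0")
    case True
    then show ?thesis using e01 by (auto simp: A_def intro!: sum.neutral[symmetric])
  next
    case False
    then obtain l where l: "l < n" "\<phi> y = e l" using ex_l by blast
    have "(\<Sum>l<n. ennreal (e l) * indicator (A l) y) = (\<Sum>k\<in>{l}. ennreal (e k) * indicator (A k) y)"
      using l inj by (intro sum.mono_neutral_right) (auto simp: A_def inj_on_def split: split_indicator)
    then show ?thesis using l by (simp add: A_def)
  qed
  have int: "(\<integral>\<^sup>+y. ennreal (\<phi> y) \<partial>\<mu>) = (\<Sum>l<n. ennreal (e l) * emeasure \<mu> (A l))"
    unfolding \<phi>_sum by (subst nn_integral_sum) (measurable, auto intro!: sum.cong nn_integral_cmult_indicator)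
  have finA: "emeasure \<mu> (A l) < \<infinity>" if "l < n" for l
  proof -
    have "ennreal (e l) * emeasure \<mu> (A l) \<le> (\<integral>\<^sup>+y. ennreal (\<phi> y) \<partial>\<mu>)"
      unfolding int using that
      by (intro member_le_sum[of l "{..<n}" "\<lambda>l. ennreal (e l) * emeasure \<mu> (A l)"]) auto
    from le_less_trans[OF this fin] have "ennreal (e l) * emeasure \<mu> (A l) < \<infinity>" .
    then show ?thesis using e01[OF that] by (auto simp: ennreal_mult_less_top)
  qed
  have int': "enn2real (\<integral>\<^sup>+y. ennreal (\<phi> y) \<partial>\<mu>) = (\<Sum>l<n. e l * measure \<mu> (A l))"
  proof -
    have "(\<Sum>l<n. ennreal (e l) * emeasure \<mu> (A l)) = (\<Sum>l<n. ennreal (e l * measure \<mu> (A l)))"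
    proof (rule sum.cong)
      fix l assume "l \<in> {..<n}"
      then have "emeasure \<mu> (A l) = ennreal (measure \<mu> (A l))" "0 < e l"
        using finA[of l] e01[of l] by (auto intro!: emeasure_eq_ennreal_measure)
      then show "ennreal (e l) * emeasure \<mu> (A l) = ennreal (e l * measure \<mu> (A l))"
        by (simp only: ennreal_mult'')  (simp add: ennreal_mult'')
    qed simp
    also have "\<dots> = ennreal (\<Sum>l<n. e l * measure \<mu> (A l))"
      using e01 by (intro sum_ennreal) auto
    finally have "(\<Sum>l<n. ennreal (e l) * emeasure \<mu> (A l)) = ennreal (\<Sum>l<n. e l * measure \<mu> (A l))" .
    moreover have "0 \<le> (\<Sum>l<n. e l * measure \<mu> (A l))"
      using e01(4) by (intro sum_nonneg mult_nonneg_nonneg) auto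
    ultimately show ?thesis unfolding int by (simp only: enn2real_ennreal)
  qed
  define N where "N l \<omega> = card {i. J \<omega> i \<in> A l}" for l \<omega>
  have indep: "indep_vars (\<lambda>_. count_space UNIV) N {..<n}"
    unfolding N_def using finA Am disj by (intro ranked_poisson_points_indep[OF R]) auto
  have fin_ae: "AE \<omega> in M. \<forall>l\<in>{..<n}. finite {i. J \<omega> i \<in> A l}"
    using finA Am by (intro AE_finite_allI ranked_poisson_points_finite[OF R]) auto
  have "AE \<omega> in M. (INF m. \<Prod>i<m. ennreal (1 - \<phi> (J \<omega> i))) = (\<Prod>l<n. ennreal ((1 - e l) ^ N l \<omega>))"
    using fin_ae
  proof eventually_elim
    case (elim \<omega>)
    define F where "F = (\<Union>l<n. {i. J \<omega> i \<in> A l})"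
    have "finite F" unfolding F_def using elim by auto
    then obtain m0 where m0: "F \<subseteq> {..<m0}" using finite_nat_iff_bounded by blast
    have prodF: "(\<Prod>i<m. ennreal (1 - \<phi> (J \<omega> i))) = (\<Prod>l<n. ennreal ((1 - e l) ^ N l \<omega>))" if "m0 \<le> m" for m
    proof -
      have "(\<Prod>i<m. ennreal (1 - \<phi> (J \<omega> i))) = (\<Prod>i\<in>F. ennreal (1 - \<phi> (J \<omega> i)))"
        using m0 that ex_l by (intro prod.mono_neutral_right) (auto simp: F_def A_def)
      also have "\<dots> = (\<Prod>l<n. \<Prod>i\<in>{i. J \<omega> i \<in> A l}. ennreal (1 - \<phi> (J \<omega> i)))"
        unfolding F_def using elim disj
        by (intro prod.UNION_disjoint) (auto simp: disjoint_family_on_def)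
      also have "\<dots> = (\<Prod>l<n. ennreal ((1 - e l) ^ N l \<omega>))"
        using e01 by (intro prod.cong) (auto simp: A_def N_def ennreal_power)
      finally show ?thesis .
    qed
    show ?case
      by (rule INF_eq_limit)
        (auto intro!: decseq_prod_le_1 tendsto_eventually eventually_sequentiallyI[of m0] prodF simp: \<phi>)
  qed
  then have "(\<integral>\<^sup>+\<omega>. (INF m. \<Prod>i<m. ennreal (1 - \<phi> (J \<omega> i))) \<partial>M) = (\<integral>\<^sup>+\<omega>. (\<Prod>l<n. ennreal ((1 - e l) ^ N l \<omega>)) \<partial>M)"
    by (rule nn_integral_cong_AE)
  also have "\<dots> = (\<Prod>l<n. \<integral>\<^sup>+\<omega>. ennreal ((1 - e l) ^ N l \<omega>) \<partial>M)"
    by (intro indep_vars_nn_integral indep_vars_compose2[OF indep]) auto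
  also have "\<dots> = (\<Prod>l<n. ennreal (exp (- (e l * measure \<mu> (A l)))))"
  proof (rule prod.cong)
    fix l assume "l \<in> {..<n}"
    then have l: "l < n" by simp
    have "(\<integral>\<^sup>+\<omega>. ennreal ((1 - e l) ^ N l \<omega>) \<partial>M) = (\<Sum>k. ennreal (poisson_weight (measure \<mu> (A l)) k) * ennreal ((1 - e l) ^ k))"
      unfolding N_def by (rule ranked_poisson_points_count[OF R Am finA[OF l]])
    also have "\<dots> = (\<Sum>k. ennreal (poisson_weight (measure \<mu> (A l)) k * (1 - e l) ^ k))"
      using e01[OF l] by (intro suminf_cong) (simp add: ennreal_mult'')
    also have "\<dots> = ennreal (exp (- measure \<mu> (A l) * (1 - (1 - e l))))"
      using e01[OF l] poisson_weight_pgf[of "measure \<mu> (A l)" "1 - e l"]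
      by (subst suminf_ennreal2) (auto simp: poisson_weight_nonneg sums_iff)
    finally show "(\<integral>\<^sup>+\<omega>. ennreal ((1 - e l) ^ N l \<omega>) \<partial>M) = ennreal (exp (- (e l * measure \<mu> (A l))))"
      by (simp add: mult.commute)
  qed simp
  also have "\<dots> = ennreal (exp (- (\<Sum>l<n. e l * measure \<mu> (A l))))"
    by (simp add: prod_ennreal exp_sum[symmetric] sum_negf)
  finally show ?thesis unfolding int' .
qed

text \<open>Simple functions increasing to \<open>1 - \<psi>\<close> make the products decrease and
  the intensities increase. The infimum over the approximation can then be exchanged with the
  infimum over the number of factors, and both sides pass to the limit.\<close>

theorem Laplace_functional:
  fixes \<psi> :: "real \<Rightarrow> real"
  assumes R: "ranked_poisson_points M \<mu> J" and mu[measurable_cong]: "sets \<mu> = sets borel"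
    and [measurable]: "\<psi> \<in> borel_measurable borel"
    and \<psi>: "\<And>y. 0 \<le> \<psi> y" "\<And>y. \<psi> y \<le> 1"
    and fin: "(\<integral>\<^sup>+y. ennreal (1 - \<psi> y) \<partial>\<mu>) = ennreal c" and c: "0 \<le> c"
  shows "(\<integral>\<^sup>+\<omega>. (INF m. \<Prod>i<m. ennreal (\<psi> (J \<omega> i))) \<partial>M) = ennreal (exp (- c))"
proof -
  interpret prob_space M using R by (simp add: ranked_poisson_points_def)
  have [measurable]: "J \<in> M \<rightarrow>\<^sub>M seq_space" using R by (simp add: ranked_poisson_points_def)
  have [measurable]: "(\<lambda>\<omega>. J \<omega> i) \<in> borel_measurable M" for i
    by (rule measurable_compose[OF _ measurable_seq_space_component]) measurable
  obtain f where f: "\<And>n. simple_function borel (f n)" "incseq f" "\<And>n y. f n y < top"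
    "\<And>y. (SUP n. f n y) = ennreal (1 - \<psi> y)"
    using borel_measurable_implies_simple_function_sequence'[of "\<lambda>y. ennreal (1 - \<psi> y)" borel]
    by (auto simp: image_comp) 
  define \<phi> where "\<phi> n y = enn2real (f n y)" for n y
  have fm[measurable]: "f n \<in> borel_measurable borel" for n using f(1) by (rule borel_measurable_simple_function)
  have [measurable]: "\<phi> n \<in> borel_measurable borel" for n unfolding \<phi>_def by measurable
  have f\<phi>: "f n y = ennreal (\<phi> n y)" for n y using f(3)[of n y] by (simp add: \<phi>_def)
  have f_le: "f n y \<le> ennreal (1 - \<psi> y)" for n y
    unfolding f(4)[symmetric] by (rule SUP_upper) simp
  have \<phi>0: "0 \<le> \<phi> n y" for n y by (simp add: \<phi>_def)
  have \<phi>_le: "\<phi> n y \<le> 1 - \<psi> y" for n y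
    using f_le[of n y] \<psi>(2)[of y] unfolding f\<phi> by (subst (asm) ennreal_le_iff) auto
  have \<phi>1: "\<phi> n y \<le> 1" for n y using \<phi>_le[of n y] \<psi>(1)[of y] by simp
  have \<phi>_mono: "\<phi> n y \<le> \<phi> n' y" if "n \<le> n'" for n n' y
    using incseqD[OF f(2) that] \<phi>0 by (auto simp: le_fun_def f\<phi>)
  have \<phi>_lim: "(\<lambda>n. \<phi> n y) \<longlonglongrightarrow> 1 - \<psi> y" for y
  proof -
    have "(\<lambda>n. f n y) \<longlonglongrightarrow> ennreal (1 - \<psi> y)"
      unfolding f(4)[symmetric] using f(2) by (intro LIMSEQ_SUP) (auto simp: incseq_def le_fun_def)
    then show ?thesis unfolding f\<phi> using \<phi>0 \<psi> by (subst (asm) tendsto_ennreal_iff) auto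
  qed
  have simple: "finite (range (\<phi> n))" for n
  proof -
    have "finite (range (f n))" using f(1)[of n] by (simp add: simple_function_def)
    then have "finite (enn2real ` range (f n))" by (rule finite_imageI)
    then show ?thesis by (simp add: \<phi>_def image_comp comp_def)
  qed
  have int_le: "(\<integral>\<^sup>+y. ennreal (\<phi> n y) \<partial>\<mu>) \<le> ennreal c" for n
    unfolding fin[symmetric] using \<phi>_le by (intro nn_integral_mono ennreal_leI) auto
  have int_fin: "(\<integral>\<^sup>+y. ennreal (\<phi> n y) \<partial>\<mu>) < \<infinity>" for n
    using int_le[of n] by (rule le_less_trans) simp
  have fun_n: "(\<integral>\<^sup>+\<omega>. (INF m. \<Prod>i<m. ennreal (1 - \<phi> n (J \<omega> i))) \<partial>M) =
      ennreal (exp (- enn2real (\<integral>\<^sup>+y. ennreal (\<phi> n y) \<partial>\<mu>)))" for n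
    by (rule Laplace_functional_simple[OF R mu]) (use int_fin in \<open>auto simp: \<phi>0 \<phi>1 simple\<close>)
  have inf_n: "(INF n. \<Prod>i<m. ennreal (1 - \<phi> n (J \<omega> i))) = (\<Prod>i<m. ennreal (\<psi> (J \<omega> i)))" for m \<omega>
  proof (rule INF_eq_limit)
    show "decseq (\<lambda>n. \<Prod>i<m. ennreal (1 - \<phi> n (J \<omega> i)))"
      unfolding decseq_def
      by (intro allI impI prod_mono_ennreal ennreal_leI diff_left_mono \<phi>_mono) auto
    have "(\<lambda>n. \<Prod>i<m. 1 - \<phi> n (J \<omega> i)) \<longlonglongrightarrow> (\<Prod>i<m. 1 - (1 - \<psi> (J \<omega> i)))"
    proof -
      have "(\<lambda>n. 1 - \<phi> n (J \<omega> i)) \<longlonglongrightarrow> 1 - (1 - \<psi> (J \<omega> i))" for i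
        by (rule tendsto_diff[OF tendsto_const \<phi>_lim])
      then show ?thesis
        by (rule tendsto_prod[of "{..<m}" "\<lambda>i n. 1 - \<phi> n (J \<omega> i)" "\<lambda>i. 1 - (1 - \<psi> (J \<omega> i))" sequentially])
    qed
    then have "(\<lambda>n. ennreal (\<Prod>i<m. 1 - \<phi> n (J \<omega> i))) \<longlonglongrightarrow> ennreal (\<Prod>i<m. 1 - (1 - \<psi> (J \<omega> i)))"
      by (rule tendsto_ennrealI)
    then show "(\<lambda>n. \<Prod>i<m. ennreal (1 - \<phi> n (J \<omega> i))) \<longlonglongrightarrow> (\<Prod>i<m. ennreal (\<psi> (J \<omega> i)))"
      using \<phi>1 \<psi>(1) by (simp add: prod_ennreal)
  qed
  have "(\<integral>\<^sup>+\<omega>. (INF m. \<Prod>i<m. ennreal (\<psi> (J \<omega> i))) \<partial>M) =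
      (\<integral>\<^sup>+\<omega>. (INF n. INF m. \<Prod>i<m. ennreal (1 - \<phi> n (J \<omega> i))) \<partial>M)"
    by (subst INF_commute) (simp only: inf_n)
  also have "\<dots> = (INF n. \<integral>\<^sup>+\<omega>. (INF m. \<Prod>i<m. ennreal (1 - \<phi> n (J \<omega> i))) \<partial>M)"
  proof (rule nn_integral_monotone_convergence_INF_decseq)
    show "decseq (\<lambda>n \<omega>. INF m. \<Prod>i<m. ennreal (1 - \<phi> n (J \<omega> i)))"
      unfolding decseq_def
      by (intro allI impI le_funI INF_mono' prod_mono_ennreal ennreal_leI diff_left_mono \<phi>_mono) auto
  qed (auto simp: fun_n)
  also have "\<dots> = ennreal (exp (- c))"
    unfolding fun_n
  proof (rule INF_eq_limit)
    have lim: "(\<lambda>n. \<integral>\<^sup>+y. ennreal (\<phi> n y) \<partial>\<mu>) \<longlonglongrightarrow> ennreal c"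
      unfolding fin[symmetric]
      by (rule nn_integral_LIMSEQ)
         (auto simp: incseq_def le_fun_def measurable_cong_sets[OF mu refl]
           intro!: ennreal_leI \<phi>_mono tendsto_ennrealI \<phi>_lim)
    show "(\<lambda>n. ennreal (exp (- enn2real (\<integral>\<^sup>+y. ennreal (\<phi> n y) \<partial>\<mu>)))) \<longlonglongrightarrow> ennreal (exp (- c))"
      using tendsto_enn2real[OF lim c] by (intro tendsto_ennrealI tendsto_exp tendsto_minus) 
    have "enn2real (\<integral>\<^sup>+y. ennreal (\<phi> n y) \<partial>\<mu>) \<le> enn2real (\<integral>\<^sup>+y. ennreal (\<phi> n' y) \<partial>\<mu>)" if "n \<le> n'" for n n'
      using int_fin[of n'] that by (intro enn2real_mono nn_integral_mono ennreal_leI \<phi>_mono) auto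
    then show "decseq (\<lambda>n. ennreal (exp (- enn2real (\<integral>\<^sup>+y. ennreal (\<phi> n y) \<partial>\<mu>))))"
      by (simp add: decseq_def ennreal_leI)
  qed
  finally show ?thesis .
qed

section \<open>The stable total mass and the asymptotics of the ranked points\<close>

locale stable_model =
  fixes g :: real and M :: "'a measure" and J :: "'a \<Rightarrow> nat \<Rightarrow> real" and I :: "'a \<Rightarrow> nat \<Rightarrow> nat"
  assumes g: "0 < g" "g < 1" and model: "PD_model g M J I"
begin

abbreviation "T \<equiv> total_mass J"
abbreviation "P \<equiv> normalized J"

lemma points: "ranked_poisson_points M (stable_intensity g) J"
  and partition: "generates_partition M P I"
  using model by (auto simp: PD_model_def)

sublocale prob_space M
  using points by (simp add: ranked_poisson_points_def)

lemma J_measurable [measurable]: "J \<in> M \<rightarrow>\<^sub>M seq_space"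
  using points by (simp add: ranked_poisson_points_def)

lemma J_component_measurable [measurable]: "(\<lambda>\<omega>. J \<omega> i) \<in> borel_measurable M"
  by (rule measurable_compose[OF J_measurable measurable_seq_space_component])

lemma P_measurable [measurable]: "P \<in> M \<rightarrow>\<^sub>M seq_space"
  using partition by (simp add: generates_partition_def)

lemma T_measurable [measurable]: "T \<in> borel_measurable M"
  unfolding total_mass_def[abs_def] by measurable

lemma Gamma_pos: "0 < Gamma (1 - g)"
  using g by (intro Gamma_real_pos) auto

lemma AE_points:
  "AE \<omega> in M. (\<forall>i. 0 < J \<omega> i) \<and> decseq (J \<omega>) \<and> summable (J \<omega>) \<and> 0 < T \<omega>"
proof -
  have "AE \<omega> in M. \<forall>i. 0 < J \<omega> i \<and> J \<omega> (Suc i) < J \<omega> i"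
    using points by (simp add: ranked_poisson_points_def)
  moreover have "AE \<omega> in M. P \<omega> \<in> ranked_simplex"
    using partition by (simp add: generates_partition_def)
  ultimately show ?thesis
  proof eventually_elim
    case (elim \<omega>)
    \<comment> \<open>\<open>total_mass\<close> is a \<open>suminf\<close>, whose value alone says
      nothing about convergence. If it were 0, all quotients would be 0 and could not sum to 1; so
      it is nonzero, and \<open>J \<omega>\<close> is summable as a multiple of a summable
      sequence.\<close>
    then have s: "(\<lambda>i. J \<omega> i / T \<omega>) sums 1"
      by (simp add: ranked_simplex_def normalized_def[abs_def])
    then have T: "T \<omega> \<noteq> 0" by (auto simp: sums_iff)
    have "summable (\<lambda>i. J \<omega> i / T \<omega> * T \<omega>)"
      using s by (intro summable_mult2) (rule sums_summable)
    with T have summ: "summable (J \<omega>)" by simp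
    have "0 < (\<Sum>i. J \<omega> i)" using elim by (intro suminf_pos summ) auto
    then show ?case using elim summ
      by (auto simp: total_mass_def intro!: decseq_SucI less_imp_le)
  qed
qed

lemma AE_T_pos: "AE \<omega> in M. 0 < T \<omega>"
  using AE_points by eventually_elim auto

lemma Laplace_functional_stable:
  fixes \<psi> :: "real \<Rightarrow> real"
  assumes [measurable]: "\<psi> \<in> borel_measurable borel"
    and \<psi>: "\<And>y. 0 < y \<Longrightarrow> 0 \<le> \<psi> y" "\<And>y. 0 < y \<Longrightarrow> \<psi> y \<le> 1"
    and int: "(\<integral>\<^sup>+y. ennreal (1 - \<psi> y) \<partial>stable_intensity g) = ennreal c" and c: "0 \<le> c"
  shows "(\<integral>\<^sup>+\<omega>. (INF m. \<Prod>i<m. ennreal (\<psi> (J \<omega> i))) \<partial>M) = ennreal (exp (- c))"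
proof -
  \<comment> \<open>Extended by 1 to the left of 0, where the intensity vanishes and almost surely
    no point lies.\<close>
  define \<psi>' where "\<psi>' y = (if 0 < y then \<psi> y else 1)" for y
  have "(\<integral>\<^sup>+y. ennreal (1 - \<psi>' y) \<partial>stable_intensity g) = ennreal c"
    unfolding int[symmetric] \<psi>'_def
    by (subst (1 2) nn_integral_stable_intensity) (auto intro!: nn_integral_cong split: split_indicator)
  then have "(\<integral>\<^sup>+\<omega>. (INF m. \<Prod>i<m. ennreal (\<psi>' (J \<omega> i))) \<partial>M) = ennreal (exp (- c))"
    using \<psi> c by (intro Laplace_functional[OF points sets_stable_intensity]) (auto simp: \<psi>'_def[abs_def])
  moreover have "(\<integral>\<^sup>+\<omega>. (INF m. \<Prod>i<m. ennreal (\<psi>' (J \<omega> i))) \<partial>M) = (\<integral>\<^sup>+\<omega>. (INF m. \<Prod>i<m. ennreal (\<psi> (J \<omega> i))) \<partial>M)"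
    using AE_points by (intro nn_integral_cong_AE, eventually_elim) (simp add: \<psi>'_def)
  ultimately show ?thesis by simp
qed

lemma prod_exp_limit:
  assumes "summable (J \<omega>)"
  shows "(\<lambda>m. \<Prod>i<m. exp (- (l * J \<omega> i))) \<longlonglongrightarrow> exp (- (l * T \<omega>))"
proof -
  have "(\<lambda>m. \<Sum>i<m. J \<omega> i) \<longlonglongrightarrow> T \<omega>"
    using assms unfolding total_mass_def by (rule summable_LIMSEQ)
  then have "(\<lambda>m. exp (- (l * (\<Sum>i<m. J \<omega> i)))) \<longlonglongrightarrow> exp (- (l * T \<omega>))"
    by (intro tendsto_intros)
  then show ?thesis
    by (simp add: exp_sum[symmetric] sum_distrib_left sum_negf)
qed

lemma Laplace_T:
  assumes "0 \<le> l"
  shows "(\<integral>\<^sup>+\<omega>. ennreal (exp (- (l * T \<omega>))) \<partial>M) = ennreal (exp (- (l powr g)))"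
proof -
  have "(\<integral>\<^sup>+\<omega>. ennreal (exp (- (l * T \<omega>))) \<partial>M) = (\<integral>\<^sup>+\<omega>. (INF m. \<Prod>i<m. ennreal (exp (- (l * J \<omega> i)))) \<partial>M)"
    using AE_points
  proof (intro nn_integral_cong_AE, eventually_elim)
    case (elim \<omega>)
    show ?case
    proof (rule INF_eq_limit[symmetric])
      show "decseq (\<lambda>m. \<Prod>i<m. ennreal (exp (- (l * J \<omega> i))))"
        using elim assms by (intro decseq_prod_le_1) (simp add: less_imp_le)
      show "(\<lambda>m. \<Prod>i<m. ennreal (exp (- (l * J \<omega> i)))) \<longlonglongrightarrow> ennreal (exp (- (l * T \<omega>)))"
        using tendsto_ennrealI[OF prod_exp_limit[of \<omega> l]] elim by (simp add: prod_ennreal)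
    qed
  qed
  also have "\<dots> = ennreal (exp (- (l powr g)))"
    using assms stable_intensity_Laplace[OF g assms] by (intro Laplace_functional_stable) auto
  finally show ?thesis .
qed

text \<open>The level is chosen so that the expected number of points above it is
  \<open>r * i\<close>. Ranks start at 0: if \<open>J \<omega> i\<close> does not exceed the level,
  at most \<open>i\<close> points do, and if it exceeds the level, at least \<open>i\<close> points
  do. Both are Chernoff events at ratio \<open>1 / r\<close>.\<close>

lemma rank_deviation:
  assumes r: "0 < r"
    and A: "A = (if 1 < r then {y. y \<le> (r * real i * Gamma (1 - g)) powr (- 1 / g)}
      else {y. (r * real i * Gamma (1 - g)) powr (- 1 / g) < y})" and i: "0 < i"
  shows "measure M {\<omega>\<in>space M. J \<omega> i \<in> A} \<le> exp (- (poisson_rate (1 / r) * (r * real i)))"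
proof -
  define y where "y = (r * real i * Gamma (1 - g)) powr (- 1 / g)"
  have base: "0 < r * real i * Gamma (1 - g)" using r i Gamma_pos by simp
  then have y: "0 < y" using r i Gamma_pos by (simp add: y_def)
  have "y powr (- g) = r * real i * Gamma (1 - g)"
    unfolding y_def powr_powr using g r i Gamma_pos by simp
  then have tail: "emeasure (stable_intensity g) {y<..} = ennreal (r * real i)"
    using stable_intensity_tail[OF g y] Gamma_pos by simp
  have meas: "measure (stable_intensity g) {y<..} = r * real i"
    using tail r by (simp add: measure_def)
  have [measurable]: "A \<in> sets borel" unfolding A by simp
  define B where "B = {k::nat. 0 \<le> (real k - 1 / r * (r * real i)) * ln (1 / r)}"
  let ?N = "\<lambda>\<omega>. card {k. J \<omega> k \<in> {y<..}}"
  have fin: "emeasure (stable_intensity g) {y<..} < \<infinity>" using tail by simp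
  note cnt = ranked_poisson_points_count[OF points _ fin, simplified]
  have [measurable]: "?N \<in> M \<rightarrow>\<^sub>M count_space UNIV" using cnt(1) by simp
  have "emeasure M {\<omega>\<in>space M. J \<omega> i \<in> A} = (\<integral>\<^sup>+\<omega>. indicator {\<omega>\<in>space M. J \<omega> i \<in> A} \<omega> \<partial>M)"
    by (rule nn_integral_indicator[symmetric]) measurable
  also have "\<dots> \<le> (\<integral>\<^sup>+\<omega>. indicator B (?N \<omega>) \<partial>M)"
  proof (rule nn_integral_mono_AE)
    have "AE \<omega> in M. finite {k. J \<omega> k \<in> {y<..}}"
      by (rule ranked_poisson_points_finite[OF points _ fin]) simp
    with AE_points show "AE \<omega> in M. indicator {\<omega>\<in>space M. J \<omega> i \<in> A} \<omega> \<le> (indicator B (?N \<omega>) :: ennreal)"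
    proof eventually_elim
      case (elim \<omega>)
      then have dec: "J \<omega> b \<le> J \<omega> a" if "a \<le> b" for a b using that by (auto simp: decseq_def)
      have "?N \<omega> \<in> B" if "J \<omega> i \<in> A"
      proof (cases "1 < r")
        case True
        then have "J \<omega> i \<le> y" using that by (simp add: A y_def)
        then have "{k. J \<omega> k \<in> {y<..}} \<subseteq> {..<i}"
          using dec by (auto simp: not_le[symmetric]) (meson dec le_less_trans not_le order_trans)
        then have "?N \<omega> \<le> i" using card_mono[of "{..<i}"] by simp
        then show ?thesis using True by (simp add: B_def ln_div mult_nonpos_nonneg)
      next
        case False
        then have "y < J \<omega> i" using that by (simp add: A y_def)
        then have "{..<i} \<subseteq> {k. J \<omega> k \<in> {y<..}}"
          using dec by (auto simp: less_le_trans)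
        then have "i \<le> ?N \<omega>" using card_mono[OF elim(2), of "{..<i}"] by simp
        then show ?thesis using False r by (simp add: B_def ln_div mult_nonneg_nonpos)
      qed
      then show ?case by (auto split: split_indicator)
    qed
  qed
  also have "\<dots> = (\<Sum>k. ennreal (poisson_weight (r * real i) k) * indicator B k)"
    using cnt(2)[of "\<lambda>k. indicator B k"] by (simp add: meas)
  also have "\<dots> \<le> ennreal (exp (- (poisson_rate (1 / r) * (r * real i))))"
    using r by (intro poisson_weight_Chernoff) (auto simp: B_def)
  finally show ?thesis by (simp add: emeasure_eq_measure)
qed

lemma rank_eventually:
  assumes r: "0 < r" "r \<noteq> 1"
  shows "AE \<omega> in M. \<forall>\<^sub>F i in sequentially.
    (if 1 < r then (r * real i * Gamma (1 - g)) powr (- 1 / g) < J \<omega> i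
     else J \<omega> i \<le> (r * real i * Gamma (1 - g)) powr (- 1 / g))"
proof -
  define A where "A i = (if 1 < r then {y. y \<le> (r * real i * Gamma (1 - g)) powr (- 1 / g)}
      else {y. (r * real i * Gamma (1 - g)) powr (- 1 / g) < y})" for i
  have [measurable]: "A i \<in> sets borel" for i unfolding A_def by simp
  define c where "c = poisson_rate (1 / r) * r"
  have "0 < c" using r poisson_rate_pos[of "1 / r"] by (simp add: c_def)
  \<comment> \<open>The bounds are geometric in the rank, hence summable. The shift by
    \<open>Suc\<close> is there because the deviation bound is for positive ranks.\<close>
  have "AE \<omega> in M. \<forall>\<^sub>F i in sequentially. \<omega> \<in> space M - {\<omega>\<in>space M. J \<omega> (Suc i) \<in> A (Suc i)}"
  proof (rule borel_cantelli_AE1)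
    show "summable (\<lambda>i. measure M {\<omega>\<in>space M. J \<omega> (Suc i) \<in> A (Suc i)})"
    proof (rule summable_comparison_test)
      have "measure M {\<omega>\<in>space M. J \<omega> (Suc i) \<in> A (Suc i)} \<le> exp (- c) ^ Suc i" for i
        using rank_deviation[OF r(1) A_def[of "Suc i"]]
        by (simp add: c_def exp_of_nat_mult[symmetric] mult_ac del: of_nat_Suc power_Suc)
      then show "\<exists>N. \<forall>i\<ge>N. norm (measure M {\<omega>\<in>space M. J \<omega> (Suc i) \<in> A (Suc i)}) \<le> exp (- c) ^ Suc i"
        by simp
      have "summable (\<lambda>i. exp (- c) ^ i)" using \<open>0 < c\<close> by (intro summable_geometric) simp
      then show "summable (\<lambda>i. exp (- c) ^ Suc i)" by (subst summable_Suc_iff)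
    qed
  qed (auto simp: emeasure_eq_measure)
  then show ?thesis
  proof eventually_elim
    case (elim \<omega>)
    then have "\<forall>\<^sub>F i in sequentially. J \<omega> (Suc i) \<notin> A (Suc i)"
      by (rule eventually_mono) auto
    then have "\<forall>\<^sub>F i in sequentially. J \<omega> i \<notin> A i"
      by (rule eventually_sequentially_Suc[THEN iffD1])
    then show ?case by (rule eventually_mono) (auto simp: A_def not_le not_less split: if_splits)
  qed
qed

text \<open>The level function \<open>b\<close> is continuous at 1; ratios \<open>u n\<close>
  decreasing to 1 give lower bounds and ratios \<open>v n\<close> increasing to 1 give upper bounds.
  There are countably many ratios, so one null set suffices for the squeeze.\<close>

lemma rank_limit:
  "AE \<omega> in M. (\<lambda>i. J \<omega> i * real i powr (1 / g)) \<longlonglongrightarrow> Gamma (1 - g) powr (- 1 / g)"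
proof -
  define b where "b r = (r * Gamma (1 - g)) powr (- 1 / g)" for r
  have scale: "(r * real i * Gamma (1 - g)) powr (- 1 / g) * real i powr (1 / g) = b r" if "0 < r" "0 < i" for r i
  proof -
    have "(r * real i * Gamma (1 - g)) powr (- 1 / g) = b r * real i powr (- 1 / g)"
      using that Gamma_pos by (simp add: b_def powr_mult mult_ac)
    then show ?thesis using that by (simp add: powr_add[symmetric])
  qed
  define u where "u n = 1 + 1 / real (Suc n)" for n
  define v where "v n = 1 - 1 / real (Suc (Suc n))" for n
  have u: "1 < u n" and v: "0 < v n" "v n < 1" for n by (auto simp: u_def v_def)
  have "AE \<omega> in M. \<forall>n. \<forall>\<^sub>F i in sequentially.
    (if 1 < u n then (u n * real i * Gamma (1 - g)) powr (- 1 / g) < J \<omega> i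
     else J \<omega> i \<le> (u n * real i * Gamma (1 - g)) powr (- 1 / g))"
    using u by (intro AE_all_countable[THEN iffD2] allI rank_eventually) (auto simp: less_trans[OF zero_less_one] less_imp_neq[THEN not_sym])
  moreover have "AE \<omega> in M. \<forall>n. \<forall>\<^sub>F i in sequentially.
    (if 1 < v n then (v n * real i * Gamma (1 - g)) powr (- 1 / g) < J \<omega> i
     else J \<omega> i \<le> (v n * real i * Gamma (1 - g)) powr (- 1 / g))"
    using v by (intro AE_all_countable[THEN iffD2] allI rank_eventually) (auto simp: less_imp_neq)
  ultimately show ?thesis
  proof eventually_elim
    case (elim \<omega>)
    have lo: "\<forall>\<^sub>F i in sequentially. b (u n) < J \<omega> i * real i powr (1 / g)" for n
      using elim(1)[THEN spec, of n] eventually_gt_at_top[of 0]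
    proof eventually_elim
      case (elim i)
      then have "(u n * real i * Gamma (1 - g)) powr (- 1 / g) * real i powr (1 / g) < J \<omega> i * real i powr (1 / g)"
        using u[of n] by (intro mult_strict_right_mono) auto
      moreover have "0 < u n" using u[of n] by simp
      ultimately show ?case using elim by (simp only: scale)
    qed
    have hi: "\<forall>\<^sub>F i in sequentially. J \<omega> i * real i powr (1 / g) \<le> b (v n)" for n
      using elim(2)[THEN spec, of n] eventually_gt_at_top[of 0]
    proof eventually_elim
      case (elim i)
      then have "J \<omega> i * real i powr (1 / g) \<le> (v n * real i * Gamma (1 - g)) powr (- 1 / g) * real i powr (1 / g)"
        using v[of n] by (intro mult_right_mono) auto
      then show ?case using elim v[of n] by (simp only: scale)
    qed
    have "u \<longlonglongrightarrow> 1" "v \<longlonglongrightarrow> 1" unfolding u_def[abs_def] v_def[abs_def] by real_asymp+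
    moreover have "(\<lambda>n. b (w n)) \<longlonglongrightarrow> b 1" if "w \<longlonglongrightarrow> 1" for w :: "nat \<Rightarrow> real"
      unfolding b_def using Gamma_pos by (intro tendsto_powr tendsto_mult that tendsto_const) auto
    ultimately have bu: "(\<lambda>n. b (u n)) \<longlonglongrightarrow> b 1" and bv: "(\<lambda>n. b (v n)) \<longlonglongrightarrow> b 1"
      by blast+
    have "(\<lambda>i. J \<omega> i * real i powr (1 / g)) \<longlonglongrightarrow> b 1"
    proof (rule order_tendstoI)
      fix a assume "a < b 1"
      then obtain n where "a < b (u n)"
        using order_tendstoD(1)[OF bu] by (meson eventually_happens' sequentially_bot)
      then show "\<forall>\<^sub>F i in sequentially. a < J \<omega> i * real i powr (1 / g)"
        using lo[of n] by (auto elim!: eventually_mono)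
    next
      fix a assume "b 1 < a"
      then obtain n where "b (v n) < a"
        using order_tendstoD(2)[OF bv] by (meson eventually_happens' sequentially_bot)
      then show "\<forall>\<^sub>F i in sequentially. J \<omega> i * real i powr (1 / g) < a"
        using hi[of n] by (auto elim!: eventually_mono)
    qed
    then show ?case by (simp add: b_def)
  qed
qed

end

text \<open>Recovers the total mass of the stable points from their normalized weights.\<close>

definition mass_of_weights :: "real \<Rightarrow> (nat \<Rightarrow> real) \<Rightarrow> real" where
  "mass_of_weights g p = Gamma (1 - g) powr (- 1 / g) / lim (\<lambda>i. p i * real i powr (1 / g))"

lemma measurable_mass_of_weights [measurable]: "mass_of_weights g \<in> borel_measurable seq_space"
  supply [measurable] = measurable_seq_space_component
  unfolding mass_of_weights_def[abs_def] by measurable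

lemma (in stable_model) mass_of_weights_eq: "AE \<omega> in M. mass_of_weights g (P \<omega>) = T \<omega>"
  using rank_limit AE_points
proof eventually_elim
  case (elim \<omega>)
  then have "(\<lambda>i. (J \<omega> i * real i powr (1 / g)) / T \<omega>) \<longlonglongrightarrow> Gamma (1 - g) powr (- 1 / g) / T \<omega>"
    by (intro tendsto_divide) auto
  then have "lim (\<lambda>i. P \<omega> i * real i powr (1 / g)) = Gamma (1 - g) powr (- 1 / g) / T \<omega>"
    by (intro limI) (simp add: normalized_def)
  then show ?case using Gamma_pos elim by (simp add: mass_of_weights_def)
qed

section \<open>Blocks of a sampled partition\<close>

lemma num_blocks_eq_card_image: "num_blocks \<iota> n = card (\<iota> ` {..<n})"
proof -
  let ?R = "{(m, m'). m < n \<and> m' < n \<and> \<iota> m = \<iota> m'}"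
  have "partition_of \<iota> n = (\<lambda>v. {m. m < n \<and> \<iota> m = v}) ` (\<iota> ` {..<n})"
    unfolding partition_of_def quotient_def image_image UNION_singleton_eq_range
    by (rule image_cong) auto
  moreover have "inj_on (\<lambda>v. {m. m < n \<and> \<iota> m = v}) (\<iota> ` {..<n})"
    by (rule inj_onI) blast
  ultimately show ?thesis by (simp add: num_blocks_def card_image)
qed

lemma num_blocks_le: "num_blocks \<iota> n \<le> n"
  unfolding num_blocks_eq_card_image using card_image_le[of "{..<n}" \<iota>] by simp

lemma num_blocks_mono: "m \<le> n \<Longrightarrow> num_blocks \<iota> m \<le> num_blocks \<iota> n"
  unfolding num_blocks_eq_card_image by (intro card_mono) auto

lemma num_blocks_pos: "0 < n \<Longrightarrow> 0 < num_blocks \<iota> n"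
  unfolding num_blocks_eq_card_image by (auto simp: card_gt_0_iff)

lemma num_blocks_cong: "(\<And>l. l < n \<Longrightarrow> \<iota> l = \<kappa> l) \<Longrightarrow> num_blocks \<iota> n = num_blocks \<kappa> n"
  unfolding num_blocks_eq_card_image by (intro arg_cong[where f=card] image_cong) auto

text \<open>For a probability vector \<open>p\<close>, the expectation of \<open>c\<close> of the
  number of distinct indices in \<open>n\<close> draws, restricted to draws below \<open>m\<close>.
  The truncation keeps the sum finite, and the supremum over \<open>m\<close> removes it.\<close>

definition block_weight :: "nat \<Rightarrow> (nat \<Rightarrow> ennreal) \<Rightarrow> nat \<Rightarrow> (nat \<Rightarrow> real) \<Rightarrow> ennreal" where
  "block_weight n c m p =
     (\<Sum>f\<in>{..<n} \<rightarrow>\<^sub>E {..<m}. c (card (f ` {..<n})) * (\<Prod>l<n. ennreal (p (f l))))"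

lemma measurable_block_weight [measurable]: "block_weight n c m \<in> borel_measurable seq_space"
  supply [measurable] = measurable_seq_space_component
  unfolding block_weight_def[abs_def] by measurable

lemma finite_index_maps: "finite ({..<n::nat} \<rightarrow>\<^sub>E {..<m::nat})"
  by (intro finite_PiE) auto

lemma block_weight_incseq: "incseq (\<lambda>m. block_weight n c m p)"
proof (rule incseq_SucI)
  fix m
  have "{..<n} \<rightarrow>\<^sub>E {..<m} \<subseteq> {..<n} \<rightarrow>\<^sub>E {..<Suc m}"
    by (rule PiE_mono) auto
  then show "block_weight n c m p \<le> block_weight n c (Suc m) p"
    unfolding block_weight_def by (intro sum_mono2 finite_index_maps) auto
qed

text \<open>Homogeneity of degree \<open>n\<close>: multiplication by \<open>T ^ n\<close> exchanges
  the normalized weights for the Poisson points themselves.\<close>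

lemma block_weight_scale:
  assumes "0 \<le> t" "\<And>i. 0 \<le> p i"
  shows "ennreal (t ^ n) * block_weight n c m p = block_weight n c m (\<lambda>i. t * p i)"
proof -
  have "(\<Prod>l<n. ennreal (t * p (f l))) = ennreal (t ^ n) * (\<Prod>l<n. ennreal (p (f l)))" for f
    using assms by (simp add: ennreal_mult prod.distrib ennreal_power)
  then show ?thesis
    unfolding block_weight_def sum_distrib_left by (simp add: mult_ac)
qed

locale sampled_partition =
  fixes M :: "'a measure" and P :: "'a \<Rightarrow> nat \<Rightarrow> real" and I :: "'a \<Rightarrow> nat \<Rightarrow> nat"
  assumes generates: "generates_partition M P I"
begin

sublocale prob_space M
  using generates by (simp add: generates_partition_def)

lemma P_measurable [measurable]: "P \<in> M \<rightarrow>\<^sub>M seq_space"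
  using generates by (simp add: generates_partition_def)

lemma P_component_measurable [measurable]: "(\<lambda>\<omega>. P \<omega> i) \<in> borel_measurable M"
  by (rule measurable_compose[OF P_measurable measurable_seq_space_component])

lemma I_measurable [measurable]: "(\<lambda>\<omega>. I \<omega> l) \<in> M \<rightarrow>\<^sub>M count_space UNIV"
  using generates by (simp add: generates_partition_def)

lemma cylinder_measurable: "{\<omega>\<in>space M. \<forall>l<n. I \<omega> l = f l} \<in> sets M"
  by measurable

lemma num_blocks_measurable [measurable]: "(\<lambda>\<omega>. num_blocks (I \<omega>) n) \<in> M \<rightarrow>\<^sub>M count_space UNIV"
proof -
  have "(\<lambda>\<omega>. \<lambda>l\<in>{..<n}. I \<omega> l) \<in> M \<rightarrow>\<^sub>M (\<Pi>\<^sub>M l\<in>{..<n}. count_space UNIV)"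
    by measurable
  also have "(\<Pi>\<^sub>M l\<in>{..<n}. count_space UNIV) = count_space ({..<n} \<rightarrow>\<^sub>E (UNIV :: nat set))"
    by (rule count_space_PiM_finite) auto
  finally have "(\<lambda>\<omega>. num_blocks (\<lambda>l\<in>{..<n}. I \<omega> l) n) \<in> M \<rightarrow>\<^sub>M count_space UNIV"
    by (rule measurable_compose) simp
  then show ?thesis by (simp cong: num_blocks_cong)
qed

text \<open>The sampling rule speaks of measurable sets of weights; equality of two image measures
  on \<open>seq_space\<close> extends it to functions.\<close>

lemma nn_integral_cylinder:
  assumes [measurable]: "F \<in> borel_measurable seq_space"
  shows "(\<integral>\<^sup>+\<omega>. F (P \<omega>) * indicator {\<omega>\<in>space M. \<forall>l<n. I \<omega> l = f l} \<omega> \<partial>M) =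
    (\<integral>\<^sup>+\<omega>. F (P \<omega>) * (\<Prod>l<n. ennreal (P \<omega> (f l))) \<partial>M)"
proof -
  let ?C = "{\<omega>\<in>space M. \<forall>l<n. I \<omega> l = f l}"
  let ?L = "distr (density M (indicator ?C)) seq_space P"
  let ?R = "distr (density M (\<lambda>\<omega>. \<Prod>l<n. ennreal (P \<omega> (f l)))) seq_space P"
  have [measurable]: "?C \<in> sets M" by (rule cylinder_measurable)
  have "?L = ?R"
  proof (rule measure_eqI)
    fix A assume "A \<in> sets ?L"
    then have [measurable]: "A \<in> sets seq_space" by simp
    have "emeasure ?L A = (\<integral>\<^sup>+\<omega>. indicator ?C \<omega> * indicator (P -` A \<inter> space M) \<omega> \<partial>M)"
      by (simp add: emeasure_distr emeasure_density)
    also have "\<dots> = (\<integral>\<^sup>+\<omega>. indicator {\<omega>\<in>space M. P \<omega> \<in> A \<and> (\<forall>l<n. I \<omega> l = f l)} \<omega> \<partial>M)"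
      by (intro nn_integral_cong) (auto split: split_indicator)
    also have "\<dots> = emeasure M {\<omega>\<in>space M. P \<omega> \<in> A \<and> (\<forall>l<n. I \<omega> l = f l)}"
      by (rule nn_integral_indicator) measurable
    also have "\<dots> = (\<integral>\<^sup>+\<omega>. indicator A (P \<omega>) * (\<Prod>l<n. ennreal (P \<omega> (f l))) \<partial>M)"
    proof -
      have "\<forall>A\<in>sets seq_space. \<forall>js.
        emeasure M {\<omega>\<in>space M. P \<omega> \<in> A \<and> (\<forall>l<length js. I \<omega> l = js ! l)} =
        (\<integral>\<^sup>+\<omega>. indicator A (P \<omega>) * (\<Prod>l<length js. ennreal (P \<omega> (js ! l))) \<partial>M)"
        using generates unfolding generates_partition_def by (elim conjE) assumption
      from this[rule_format, of A "map f [0..<n]"] show ?thesis by simp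
    qed
    also have "\<dots> = emeasure ?R A"
      by (subst emeasure_distr, measurable, subst emeasure_density, measurable)
         (auto intro!: nn_integral_cong simp: mult.commute split: split_indicator)
    finally show "emeasure ?L A = emeasure ?R A" .
  qed simp
  then have "(\<integral>\<^sup>+p. F p \<partial>?L) = (\<integral>\<^sup>+p. F p \<partial>?R)" by simp
  then show ?thesis
    by (simp add: nn_integral_distr nn_integral_density mult.commute)
qed

text \<open>Samples that stay below \<open>m\<close> take finitely many values, which reduces the
  block count to a finite sum over index maps. These events increase to the whole space.\<close>

lemma nn_integral_block_weight:
  assumes F[measurable]: "F \<in> borel_measurable seq_space"
  shows "(\<integral>\<^sup>+\<omega>. F (P \<omega>) * c (num_blocks (I \<omega>) n) \<partial>M) =
    (\<integral>\<^sup>+\<omega>. F (P \<omega>) * (SUP m. block_weight n c m (P \<omega>)) \<partial>M)"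
proof -
  define E where "E m = {\<omega>\<in>space M. \<forall>l<n. I \<omega> l < m}" for m
  have [measurable]: "E m \<in> sets M" for m unfolding E_def by measurable
  have "incseq E" by (rule incseq_SucI) (auto simp: E_def less_Suc_eq)
  have unE: "(\<Union>m. E m) = space M"
  proof safe
    fix \<omega> assume "\<omega> \<in> space M"
    moreover have "\<forall>l<n. I \<omega> l < Suc (Max (I \<omega> ` {..<n}))"
      by (auto simp: less_Suc_eq_le)
    ultimately show "\<omega> \<in> (\<Union>m. E m)" unfolding E_def by blast
  qed (auto simp: E_def)
  have fin: "(\<integral>\<^sup>+\<omega>. F (P \<omega>) * c (num_blocks (I \<omega>) n) * indicator (E m) \<omega> \<partial>M) =
      (\<integral>\<^sup>+\<omega>. F (P \<omega>) * block_weight n c m (P \<omega>) \<partial>M)" for m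
  proof -
    have "c (num_blocks (I \<omega>) n) * indicator (E m) \<omega> =
      (\<Sum>f\<in>{..<n} \<rightarrow>\<^sub>E {..<m}. c (card (f ` {..<n})) * indicator {\<omega>\<in>space M. \<forall>l<n. I \<omega> l = f l} \<omega>)"
      if "\<omega> \<in> space M" for \<omega>
    proof (cases "\<omega> \<in> E m")
      case True
      \<comment> \<open>Index maps are extensional, so the sample restricted to
        \<open>{..<n}\<close> is the only map whose cylinder contains the outcome.\<close>
      let ?f = "\<lambda>l\<in>{..<n}. I \<omega> l"
      have mem: "?f \<in> {..<n} \<rightarrow>\<^sub>E {..<m}" using True by (auto simp: E_def)
      have "(\<Sum>f\<in>{..<n} \<rightarrow>\<^sub>E {..<m}. c (card (f ` {..<n})) * indicator {\<omega>\<in>space M. \<forall>l<n. I \<omega> l = f l} \<omega>)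
        = (\<Sum>f\<in>{?f}. c (card (f ` {..<n})) * indicator {\<omega>\<in>space M. \<forall>l<n. I \<omega> l = f l} \<omega>)"
      proof (rule sum.mono_neutral_right[OF finite_index_maps])
        show "\<forall>f\<in>({..<n} \<rightarrow>\<^sub>E {..<m}) - {?f}. c (card (f ` {..<n})) * indicator {\<omega>\<in>space M. \<forall>l<n. I \<omega> l = f l} \<omega> = 0"
        proof
          fix f assume f: "f \<in> ({..<n} \<rightarrow>\<^sub>E {..<m}) - {?f}"
          have "\<not> (\<forall>l<n. I \<omega> l = f l)"
          proof
            assume "\<forall>l<n. I \<omega> l = f l"
            then have "f = ?f" using f by (intro ext) (auto simp: PiE_def extensional_def)
            then show False using f by simp
          qed
          then show "c (card (f ` {..<n})) * indicator {\<omega>\<in>space M. \<forall>l<n. I \<omega> l = f l} \<omega> = 0" by simp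
        qed
      qed (use mem in auto)
      also have "\<dots> = c (card (I \<omega> ` {..<n}))" using that by simp
      finally show ?thesis using True by (simp add: num_blocks_eq_card_image)
    next
      case False
      then have "\<not> (\<forall>l<n. I \<omega> l = f l)" if "f \<in> {..<n} \<rightarrow>\<^sub>E {..<m}" for f
        using that \<open>\<omega> \<in> space M\<close> by (auto simp: E_def PiE_def Pi_def)
      then show ?thesis using False by (auto intro!: sum.neutral[symmetric])
    qed
    then have "(\<integral>\<^sup>+\<omega>. F (P \<omega>) * c (num_blocks (I \<omega>) n) * indicator (E m) \<omega> \<partial>M) =
      (\<integral>\<^sup>+\<omega>. (\<Sum>f\<in>{..<n} \<rightarrow>\<^sub>E {..<m}. c (card (f ` {..<n})) * (F (P \<omega>) * indicator {\<omega>\<in>space M. \<forall>l<n. I \<omega> l = f l} \<omega>)) \<partial>M)"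
      by (intro nn_integral_cong) (simp add: mult.assoc sum_distrib_left mult.left_commute)
    also have "\<dots> = (\<Sum>f\<in>{..<n} \<rightarrow>\<^sub>E {..<m}. c (card (f ` {..<n})) * (\<integral>\<^sup>+\<omega>. F (P \<omega>) * indicator {\<omega>\<in>space M. \<forall>l<n. I \<omega> l = f l} \<omega> \<partial>M))"
      using cylinder_measurable by (subst nn_integral_sum) (auto simp: nn_integral_cmult)
    also have "\<dots> = (\<integral>\<^sup>+\<omega>. (\<Sum>f\<in>{..<n} \<rightarrow>\<^sub>E {..<m}. c (card (f ` {..<n})) * (F (P \<omega>) * (\<Prod>l<n. ennreal (P \<omega> (f l))))) \<partial>M)"
      by (subst nn_integral_sum) (auto simp: nn_integral_cmult nn_integral_cylinder)
    also have "\<dots> = (\<integral>\<^sup>+\<omega>. F (P \<omega>) * block_weight n c m (P \<omega>) \<partial>M)"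
      unfolding block_weight_def sum_distrib_left by (simp add: mult.left_commute)
    finally show ?thesis .
  qed
  have "(\<integral>\<^sup>+\<omega>. F (P \<omega>) * c (num_blocks (I \<omega>) n) \<partial>M) =
      (\<integral>\<^sup>+\<omega>. (SUP m. F (P \<omega>) * c (num_blocks (I \<omega>) n) * indicator (E m) \<omega>) \<partial>M)"
    by (intro nn_integral_cong) (simp add: SUP_indicator_incseq[OF \<open>incseq E\<close>] unE)
  also have "\<dots> = (SUP m. \<integral>\<^sup>+\<omega>. F (P \<omega>) * c (num_blocks (I \<omega>) n) * indicator (E m) \<omega> \<partial>M)"
    using \<open>incseq E\<close>
    by (intro nn_integral_monotone_convergence_SUP)
       (auto simp: incseq_def le_fun_def split: split_indicator)
  also have "\<dots> = (SUP m. \<integral>\<^sup>+\<omega>. F (P \<omega>) * block_weight n c m (P \<omega>) \<partial>M)"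
    by (simp only: fin)
  also have "\<dots> = (\<integral>\<^sup>+\<omega>. (SUP m. F (P \<omega>) * block_weight n c m (P \<omega>)) \<partial>M)"
    using block_weight_incseq
    by (intro nn_integral_monotone_convergence_SUP[symmetric])
       (auto simp: incseq_def le_fun_def intro!: mult_left_mono)
  finally show ?thesis by (simp only: SUP_mult_left_ennreal)
qed

end

section \<open>Colouring identities and exponential generating functions\<close>

lemma sum_colourings:
  fixes z :: "'c :: comm_ring_1"
  assumes S: "S \<subseteq> {..<m}"
  shows "(\<Sum>R\<in>{R\<in>Pow {..<m}. S \<subseteq> R}. z ^ card R * (1 - z) ^ (m - card R)) = z ^ card S"
proof -
  have fS: "finite S" using S by (rule finite_subset) simp
  \<comment> \<open>Each index contributes \<open>z\<close> for coloured plus \<open>1 - z\<close>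
    for uncoloured, the latter being forbidden on \<open>S\<close>. Expanding the product lists the
    colour sets \<open>R\<close> that contain \<open>S\<close>.\<close>
  have "(\<Prod>i<m. z + (if i \<in> S then 0 else 1 - z)) = (\<Prod>i<m. if i \<in> S then z else 1)"
    by (rule prod.cong) auto
  also have "\<dots> = z ^ card S"
    using S by (subst prod.If_cases) (auto simp: Int_absorb1)
  finally have "z ^ card S = (\<Sum>R\<in>Pow {..<m}. (\<Prod>i\<in>R. z) * (\<Prod>i\<in>{..<m} - R. if i \<in> S then 0 else 1 - z))"
    by (subst (asm) prod_add) auto
  also have "\<dots> = (\<Sum>R\<in>Pow {..<m}. if S \<subseteq> R then z ^ card R * (1 - z) ^ (m - card R) else 0)"
  proof (rule sum.cong)
    fix R assume R: "R \<in> Pow {..<m}"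
    then have cR: "card ({..<m} - R) = m - card R" and fR: "finite R"
      by (auto simp: card_Diff_subset finite_subset)
    show "(\<Prod>i\<in>R. z) * (\<Prod>i\<in>{..<m} - R. if i \<in> S then 0 else 1 - z) =
        (if S \<subseteq> R then z ^ card R * (1 - z) ^ (m - card R) else 0)"
    proof (cases "S \<subseteq> R")
      case True
      then have "(\<Prod>i\<in>{..<m} - R. if i \<in> S then 0 else 1 - z) = (\<Prod>i\<in>{..<m} - R. 1 - z)"
        by (intro prod.cong) auto
      then show ?thesis using True cR by simp
    next
      case False
      then obtain i where "i \<in> S" "i \<notin> R" by auto
      then have "(\<Prod>i\<in>{..<m} - R. if i \<in> S then 0 else 1 - z) = 0"
        using S by (intro prod_zero) auto
      then show ?thesis using False by simp
    qed
  qed simp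
  also have "\<dots> = (\<Sum>R\<in>{R\<in>Pow {..<m}. S \<subseteq> R}. z ^ card R * (1 - z) ^ (m - card R))"
    by (rule sum.inter_filter[symmetric]) simp
  finally show ?thesis by simp
qed

text \<open>Colour every index independently with probability \<open>z\<close>: then \<open>z\<close> to the number of distinct
  sampled indices is the probability that all of them are coloured.\<close>

lemma sum_index_maps_colouring:
  fixes z :: "'c :: comm_ring_1" and n m :: nat
  shows "(\<Sum>f\<in>{..<n} \<rightarrow>\<^sub>E {..<m}. z ^ card (f ` {..<n}) * (\<Prod>l<n. p (f l))) =
    (\<Sum>R\<in>Pow {..<m}. z ^ card R * (1 - z) ^ (m - card R) * (\<Sum>i\<in>R. p i) ^ n)"
proof -
  let ?w = "\<lambda>R. z ^ card R * (1 - z) ^ (m - card R)"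
  have pw: "(\<Sum>i\<in>R. p i) ^ n = (\<Sum>f\<in>{f\<in>{..<n} \<rightarrow>\<^sub>E {..<m}. f ` {..<n} \<subseteq> R}. \<Prod>l<n. p (f l))" if "R \<in> Pow {..<m}" for R
  proof -
    have "finite R" using that finite_subset by auto
    then have "(\<Prod>l<n. \<Sum>i\<in>R. p i) = (\<Sum>f\<in>{..<n} \<rightarrow>\<^sub>E R. \<Prod>l<n. p (f l))"
      by (intro prod_sum_PiE) auto
    moreover have "{..<n} \<rightarrow>\<^sub>E R = {f\<in>{..<n} \<rightarrow>\<^sub>E {..<m}. f ` {..<n} \<subseteq> R}"
      using that by (auto simp: PiE_def Pi_def)
    ultimately show ?thesis by simp
  qed
  have "(\<Sum>R\<in>Pow {..<m}. ?w R * (\<Sum>i\<in>R. p i) ^ n) =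
      (\<Sum>R\<in>Pow {..<m}. \<Sum>f\<in>{f\<in>{..<n} \<rightarrow>\<^sub>E {..<m}. f ` {..<n} \<subseteq> R}. ?w R * (\<Prod>l<n. p (f l)))"
    by (intro sum.cong) (auto simp: pw sum_distrib_left)
  also have "\<dots> = (\<Sum>f\<in>{..<n} \<rightarrow>\<^sub>E {..<m}. \<Sum>R\<in>{R\<in>Pow {..<m}. f ` {..<n} \<subseteq> R}. ?w R * (\<Prod>l<n. p (f l)))"
    by (rule sum.swap_restrict) (auto intro: finite_index_maps)
  also have "\<dots> = (\<Sum>f\<in>{..<n} \<rightarrow>\<^sub>E {..<m}. z ^ card (f ` {..<n}) * (\<Prod>l<n. p (f l)))"
  proof (rule sum.cong)
    fix f assume "f \<in> {..<n} \<rightarrow>\<^sub>E {..<m}"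
    then have "f ` {..<n} \<subseteq> {..<m}" by auto
    from sum_colourings[OF this, of z]
    show "(\<Sum>R\<in>{R\<in>Pow {..<m}. f ` {..<n} \<subseteq> R}. ?w R * (\<Prod>l<n. p (f l))) = z ^ card (f ` {..<n}) * (\<Prod>l<n. p (f l))"
      by (simp add: sum_distrib_right[symmetric])
  qed simp
  finally show ?thesis by simp
qed

text \<open>For a fixed colour set \<open>R\<close> the sum over index maps is the
  \<open>n\<close>th power of the mass of \<open>R\<close>, so its exponential series is
  \<open>exp (u * (\<Sum>i\<in>R. p i))\<close>. Summing over the colour sets then factorizes over
  the indices.\<close>

lemma sums_index_maps:
  fixes z u :: real and m :: nat
  shows "(\<lambda>n. u ^ n / fact n * (\<Sum>f\<in>{..<n} \<rightarrow>\<^sub>E {..<m}. z ^ card (f ` {..<n}) * (\<Prod>l<n. p (f l)))) sums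
    (\<Prod>i<m. 1 - z + z * exp (u * p i))"
proof -
  have "(\<lambda>n. \<Sum>R\<in>Pow {..<m}. z ^ card R * (1 - z) ^ (m - card R) * ((u * (\<Sum>i\<in>R. p i)) ^ n /\<^sub>R fact n)) sums
      (\<Sum>R\<in>Pow {..<m}. z ^ card R * (1 - z) ^ (m - card R) * exp (u * (\<Sum>i\<in>R. p i)))"
    by (intro sums_sum sums_mult exp_converges)
  moreover have "(\<Sum>R\<in>Pow {..<m}. z ^ card R * (1 - z) ^ (m - card R) * exp (u * (\<Sum>i\<in>R. p i))) =
      (\<Prod>i<m. z * exp (u * p i) + (1 - z))"
  proof -
    have "(\<Prod>i<m. z * exp (u * p i) + (1 - z)) =
        (\<Sum>R\<in>Pow {..<m}. (\<Prod>i\<in>R. z * exp (u * p i)) * (\<Prod>i\<in>{..<m} - R. 1 - z))"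
      by (rule prod_add) simp
    also have "\<dots> = (\<Sum>R\<in>Pow {..<m}. z ^ card R * (1 - z) ^ (m - card R) * exp (u * (\<Sum>i\<in>R. p i)))"
    proof (rule sum.cong)
      fix R assume R: "R \<in> Pow {..<m}"
      then have "card ({..<m} - R) = m - card R" "finite R"
        by (auto simp: card_Diff_subset finite_subset)
      then show "(\<Prod>i\<in>R. z * exp (u * p i)) * (\<Prod>i\<in>{..<m} - R. 1 - z) =
          z ^ card R * (1 - z) ^ (m - card R) * exp (u * (\<Sum>i\<in>R. p i))"
        by (simp add: prod.distrib sum_distrib_left exp_sum)
    qed simp
    finally show ?thesis by simp
  qed
  moreover have "(\<lambda>n. u ^ n / fact n * (\<Sum>f\<in>{..<n} \<rightarrow>\<^sub>E {..<m}. z ^ card (f ` {..<n}) * (\<Prod>l<n. p (f l)))) =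
      (\<lambda>n. \<Sum>R\<in>Pow {..<m}. z ^ card R * (1 - z) ^ (m - card R) * ((u * (\<Sum>i\<in>R. p i)) ^ n /\<^sub>R fact n))"
    unfolding sum_index_maps_colouring sum_distrib_left
    by (intro ext sum.cong refl) (simp add: power_mult_distrib divide_inverse sum_distrib_left[symmetric] mult_ac)
  ultimately show ?thesis by (simp add: add.commute)
qed

lemma suminf_block_weight:
  fixes z u :: real
  assumes z: "0 \<le> z" "z \<le> 1" and u: "0 \<le> u" and p: "\<And>i. 0 \<le> p i"
  shows "(\<Sum>n. ennreal (u ^ n / fact n) * block_weight n (\<lambda>k. ennreal (z ^ k)) m p) =
    ennreal (\<Prod>i<m. 1 - z + z * exp (u * p i))"
proof -
  let ?c = "\<lambda>n. \<Sum>f\<in>{..<n} \<rightarrow>\<^sub>E {..<m}. z ^ card (f ` {..<n}) * (\<Prod>l<n. p (f l))"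
  have c: "0 \<le> ?c n" for n
    using z p by (intro sum_nonneg mult_nonneg_nonneg prod_nonneg) auto
  have "block_weight n (\<lambda>k. ennreal (z ^ k)) m p = (\<Sum>f\<in>{..<n} \<rightarrow>\<^sub>E {..<m}. ennreal (z ^ card (f ` {..<n}) * (\<Prod>l<n. p (f l))))" for n
    unfolding block_weight_def using z p by (intro sum.cong refl) (simp add: prod_ennreal ennreal_mult')
  also have "\<dots> n = ennreal (?c n)" for n
    using z p by (intro sum_ennreal mult_nonneg_nonneg prod_nonneg) auto
  finally have "ennreal (u ^ n / fact n) * block_weight n (\<lambda>k. ennreal (z ^ k)) m p = ennreal (u ^ n / fact n * ?c n)" for n
    using u by (subst ennreal_mult'[of "u ^ n / fact n"]) simp_all
  then have "(\<Sum>n. ennreal (u ^ n / fact n) * block_weight n (\<lambda>k. ennreal (z ^ k)) m p) = (\<Sum>n. ennreal (u ^ n / fact n * ?c n))"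
    by simp
  also have "\<dots> = ennreal (\<Sum>n. u ^ n / fact n * ?c n)"
    using u c sums_summable[OF sums_index_maps[where u=u and z=z and m=m and p=p]] by (intro suminf_ennreal2 mult_nonneg_nonneg) auto
  also have "(\<Sum>n. u ^ n / fact n * ?c n) = (\<Prod>i<m. 1 - z + z * exp (u * p i))"
    by (rule sums_unique[OF sums_index_maps, symmetric])
  finally show ?thesis .
qed

sublocale stable_model \<subseteq> sampled_partition M "normalized J" I
  by standard (rule partition)

lemma power_exp_bound:
  fixes t l :: real
  assumes "0 \<le> t" "0 < l"
  shows "t ^ n * exp (- (l * t)) \<le> fact n / l ^ n"
proof -
  have "(l * t) ^ n /\<^sub>R fact n \<le> exp (l * t)"
    using sum_le_suminf[OF summable_exp_generic[of "l * t"], of "{n}"] assms by (simp add: exp_def)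
  then show ?thesis using assms
    by (simp add: exp_minus field_simps)
qed

lemma (in sampled_partition) measurable_indicator_num_blocks [measurable]:
  "(\<lambda>\<omega>. indicator A (num_blocks (I \<omega>) n) :: ennreal) \<in> borel_measurable M"
  by (rule measurable_compose[OF num_blocks_measurable]) simp

section \<open>The joint transform of total mass and block count\<close>

context stable_model
begin

abbreviation K :: "'a \<Rightarrow> nat \<Rightarrow> nat" where "K \<omega> n \<equiv> num_blocks (I \<omega>) n"

text \<open>The sampling rule describes \<open>I\<close> jointly with the weights only. It reaches
  \<open>T\<close> because \<open>T\<close> agrees almost surely with
  \<open>mass_of_weights g (P \<omega>)\<close>, a measurable function of the weights.\<close>

lemma nn_integral_T_blocks:
  assumes [measurable]: "\<phi> \<in> borel_measurable borel"
  shows "(\<integral>\<^sup>+\<omega>. \<phi> (T \<omega>) * c (K \<omega> n) \<partial>M) =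
    (\<integral>\<^sup>+\<omega>. \<phi> (T \<omega>) * (SUP m. block_weight n c m (P \<omega>)) \<partial>M)"
proof -
  have "(\<integral>\<^sup>+\<omega>. \<phi> (mass_of_weights g (P \<omega>)) * c (K \<omega> n) \<partial>M) =
    (\<integral>\<^sup>+\<omega>. \<phi> (mass_of_weights g (P \<omega>)) * (SUP m. block_weight n c m (P \<omega>)) \<partial>M)"
    by (rule nn_integral_block_weight) measurable
  moreover have "(\<integral>\<^sup>+\<omega>. \<phi> (mass_of_weights g (P \<omega>)) * c (K \<omega> n) \<partial>M) = (\<integral>\<^sup>+\<omega>. \<phi> (T \<omega>) * c (K \<omega> n) \<partial>M)"
    using mass_of_weights_eq by (intro nn_integral_cong_AE) (auto elim!: eventually_mono)
  moreover have "(\<integral>\<^sup>+\<omega>. \<phi> (mass_of_weights g (P \<omega>)) * (SUP m. block_weight n c m (P \<omega>)) \<partial>M) =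
      (\<integral>\<^sup>+\<omega>. \<phi> (T \<omega>) * (SUP m. block_weight n c m (P \<omega>)) \<partial>M)"
    using mass_of_weights_eq by (intro nn_integral_cong_AE) (auto elim!: eventually_mono)
  ultimately show ?thesis by simp
qed

text \<open>Given the points, the series equals \<open>exp (- (l * T \<omega>))\<close> times the
  product of \<open>1 - z + z * exp (u * J \<omega> i)\<close>, so a point of size \<open>y\<close>
  contributes the factor \<open>\<psi> y\<close>; \<open>u \<le> l\<close> keeps it at most 1. The
  intensity of \<open>1 - \<psi>\<close> is a mixture of two stable exponents.\<close>

lemma blocks_generating_function:
  fixes z u l :: real
  assumes z: "0 \<le> z" "z \<le> 1" and u: "0 \<le> u" "u \<le> l"
  shows "(\<Sum>n. ennreal (u ^ n / fact n) *
      (\<integral>\<^sup>+\<omega>. ennreal (T \<omega> ^ n * exp (- (l * T \<omega>))) * ennreal (z ^ K \<omega> n) \<partial>M)) =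
    ennreal (exp (- ((1 - z) * l powr g + z * (l - u) powr g)))"
proof -
  let ?c = "\<lambda>k. ennreal (z ^ k)"
  define \<psi> where "\<psi> y = (1 - z) * exp (- (l * y)) + z * exp (- ((l - u) * y))" for y
  have [measurable]: "\<psi> \<in> borel_measurable borel" unfolding \<psi>_def[abs_def] by measurable
  have \<psi>0: "0 \<le> \<psi> y" and \<psi>1: "\<psi> y \<le> 1" if "0 < y" for y
  proof -
    show "0 \<le> \<psi> y" using z by (simp add: \<psi>_def)
    have "\<psi> y \<le> (1 - z) * 1 + z * 1"
      unfolding \<psi>_def using z u that by (intro add_mono mult_left_mono) auto
    then show "\<psi> y \<le> 1" by simp
  qed
  have int\<psi>: "(\<integral>\<^sup>+y. ennreal (1 - \<psi> y) \<partial>stable_intensity g) = ennreal ((1 - z) * l powr g + z * (l - u) powr g)"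
  proof -
    have "(\<integral>\<^sup>+y. ennreal (1 - \<psi> y) \<partial>stable_intensity g) =
        (\<integral>\<^sup>+y. ennreal (1 - z) * ennreal (1 - exp (- (l * y))) + ennreal z * ennreal (1 - exp (- ((l - u) * y))) \<partial>stable_intensity g)"
    proof (subst (1 2) nn_integral_stable_intensity; (measurable)?)
      have *: "ennreal (1 - \<psi> y) = ennreal (1 - z) * ennreal (1 - exp (- (l * y))) + ennreal z * ennreal (1 - exp (- ((l - u) * y)))" if "0 < y" for y
      proof -
        have "1 - \<psi> y = (1 - z) * (1 - exp (- (l * y))) + z * (1 - exp (- ((l - u) * y)))"
          by (simp add: \<psi>_def algebra_simps)
        moreover have "0 \<le> 1 - exp (- (l * y))" "0 \<le> 1 - exp (- ((l - u) * y))"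
          using u that by auto
        ultimately show ?thesis using z by (simp only: ennreal_plus ennreal_mult mult_nonneg_nonneg diff_ge_0_iff_ge)
      qed
      show "(\<integral>\<^sup>+y. ennreal (1 - \<psi> y) * ennreal (g / Gamma (1 - g) * y powr (- g - 1)) * indicator {0<..} y \<partial>lborel) =
        (\<integral>\<^sup>+y. (ennreal (1 - z) * ennreal (1 - exp (- (l * y))) + ennreal z * ennreal (1 - exp (- ((l - u) * y)))) *
           ennreal (g / Gamma (1 - g) * y powr (- g - 1)) * indicator {0<..} y \<partial>lborel)"
        by (intro nn_integral_cong) (simp add: * split: split_indicator)
    qed
    also have "\<dots> = ennreal (1 - z) * ennreal (l powr g) + ennreal z * ennreal ((l - u) powr g)"
      using u stable_intensity_Laplace[OF g, of l] stable_intensity_Laplace[OF g, of "l - u"]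
      by (subst nn_integral_add) (measurable, simp add: nn_integral_cmult)
    also have "\<dots> = ennreal ((1 - z) * l powr g + z * (l - u) powr g)"
      using z by (simp add: ennreal_mult)
    finally show ?thesis .
  qed
  \<comment> \<open>One factor decreases and the other increases with \<open>m\<close>, so their
    product is not a monotone limit factor by factor. Both are treated as ordinary limits; the
    combined partial products are decreasing again.\<close>
  have lim: "ennreal (exp (- (l * T \<omega>))) * (SUP m. ennreal (\<Prod>i<m. 1 - z + z * exp (u * J \<omega> i))) =
      (INF m. \<Prod>i<m. ennreal (\<psi> (J \<omega> i)))"
    if pos: "\<And>i. 0 < J \<omega> i" and summ: "summable (J \<omega>)" for \<omega>
  proof (rule INF_eq_limit[symmetric])
    show "decseq (\<lambda>m. \<Prod>i<m. ennreal (\<psi> (J \<omega> i)))"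
      by (intro decseq_prod_le_1) (simp add: \<psi>1[OF pos])
    have one_le: "1 \<le> 1 - z + z * exp (u * J \<omega> i)" for i
      using z u pos[of i] mult_left_mono[of 1 "exp (u * J \<omega> i)" z] by (simp add: less_imp_le)
    have "incseq (\<lambda>m. ennreal (\<Prod>i<m. 1 - z + z * exp (u * J \<omega> i)))"
    proof (rule incseq_SucI, rule ennreal_leI)
      fix m
      have "0 \<le> (\<Prod>i<m. 1 - z + z * exp (u * J \<omega> i))"
        using one_le by (intro prod_nonneg) (auto intro: order_trans[OF zero_le_one])
      then show "(\<Prod>i<m. 1 - z + z * exp (u * J \<omega> i)) \<le> (\<Prod>i<Suc m. 1 - z + z * exp (u * J \<omega> i))"
        using one_le[of m] mult_left_mono[of 1 "1 - z + z * exp (u * J \<omega> m)" "\<Prod>i<m. 1 - z + z * exp (u * J \<omega> i)"] by simp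
    qed
    from LIMSEQ_SUP[OF this]
    have "(\<lambda>m. ennreal (\<Prod>i<m. exp (- (l * J \<omega> i))) * ennreal (\<Prod>i<m. 1 - z + z * exp (u * J \<omega> i))) \<longlonglongrightarrow>
        ennreal (exp (- (l * T \<omega>))) * (SUP m. ennreal (\<Prod>i<m. 1 - z + z * exp (u * J \<omega> i)))"
      by (intro tendsto_mult_ennreal tendsto_ennrealI prod_exp_limit[OF summ]) auto
    moreover have "ennreal (\<Prod>i<m. exp (- (l * J \<omega> i))) * ennreal (\<Prod>i<m. 1 - z + z * exp (u * J \<omega> i)) =
        (\<Prod>i<m. ennreal (\<psi> (J \<omega> i)))" for m
    proof -
      have "exp (- (l * y)) * (1 - z + z * exp (u * y)) = \<psi> y" for y
        by (simp add: \<psi>_def algebra_simps exp_add[symmetric])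
      then have "(\<Prod>i<m. exp (- (l * J \<omega> i))) * (\<Prod>i<m. 1 - z + z * exp (u * J \<omega> i)) = (\<Prod>i<m. \<psi> (J \<omega> i))"
        by (simp add: prod.distrib[symmetric])
      then show ?thesis
        using \<psi>0[OF pos] by (simp add: ennreal_mult'[symmetric] prod_nonneg prod_ennreal)
    qed
    ultimately show "(\<lambda>m. \<Prod>i<m. ennreal (\<psi> (J \<omega> i))) \<longlonglongrightarrow>
        ennreal (exp (- (l * T \<omega>))) * (SUP m. ennreal (\<Prod>i<m. 1 - z + z * exp (u * J \<omega> i)))"
      by simp
  qed
  have bw: "ennreal (T \<omega> ^ n) * (SUP m. block_weight n ?c m (P \<omega>)) = (SUP m. block_weight n ?c m (J \<omega>))"
    if "0 < T \<omega>" and pos: "\<And>i. 0 < J \<omega> i" for \<omega> n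
  proof -
    have P: "0 \<le> P \<omega> i" "T \<omega> * P \<omega> i = J \<omega> i" for i
      using that pos[of i] by (auto simp: normalized_def less_imp_le)
    have "ennreal (T \<omega> ^ n) * block_weight n ?c m (P \<omega>) = block_weight n ?c m (J \<omega>)" for m
      using block_weight_scale[of "T \<omega>" "P \<omega>" n ?c m] that P by simp
    then show ?thesis by (simp only: SUP_mult_left_ennreal)
  qed
  have "(\<Sum>n. ennreal (u ^ n / fact n) *
      (\<integral>\<^sup>+\<omega>. ennreal (T \<omega> ^ n * exp (- (l * T \<omega>))) * ?c (K \<omega> n) \<partial>M)) =
    (\<Sum>n. ennreal (u ^ n / fact n) *
      (\<integral>\<^sup>+\<omega>. ennreal (exp (- (l * T \<omega>))) * (SUP m. block_weight n ?c m (J \<omega>)) \<partial>M))"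
  proof (rule suminf_cong, rule arg_cong2[where f="(*)", OF refl])
    fix n
    have "(\<integral>\<^sup>+\<omega>. ennreal (T \<omega> ^ n * exp (- (l * T \<omega>))) * ?c (K \<omega> n) \<partial>M) =
       (\<integral>\<^sup>+\<omega>. ennreal (T \<omega> ^ n * exp (- (l * T \<omega>))) * (SUP m. block_weight n ?c m (P \<omega>)) \<partial>M)"
      by (rule nn_integral_T_blocks) measurable
    also have "\<dots> = (\<integral>\<^sup>+\<omega>. ennreal (exp (- (l * T \<omega>))) * (SUP m. block_weight n ?c m (J \<omega>)) \<partial>M)"
      using AE_points
    proof (intro nn_integral_cong_AE, eventually_elim)
      case (elim \<omega>)
      then have "ennreal (T \<omega> ^ n * exp (- (l * T \<omega>))) * (SUP m. block_weight n ?c m (P \<omega>)) =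
          ennreal (exp (- (l * T \<omega>))) * (ennreal (T \<omega> ^ n) * (SUP m. block_weight n ?c m (P \<omega>)))"
        by (simp add: ennreal_mult' mult_ac)
      also have "\<dots> = ennreal (exp (- (l * T \<omega>))) * (SUP m. block_weight n ?c m (J \<omega>))"
        using bw[of \<omega> n] elim by simp
      finally show ?case .
    qed
    finally show "(\<integral>\<^sup>+\<omega>. ennreal (T \<omega> ^ n * exp (- (l * T \<omega>))) * ?c (K \<omega> n) \<partial>M) =
      (\<integral>\<^sup>+\<omega>. ennreal (exp (- (l * T \<omega>))) * (SUP m. block_weight n ?c m (J \<omega>)) \<partial>M)" .
  qed
  also have "\<dots> = (\<integral>\<^sup>+\<omega>. (\<Sum>n. ennreal (u ^ n / fact n) * (ennreal (exp (- (l * T \<omega>))) * (SUP m. block_weight n ?c m (J \<omega>)))) \<partial>M)"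
    by (subst nn_integral_suminf) (auto simp: nn_integral_cmult)
  also have "\<dots> = (\<integral>\<^sup>+\<omega>. (INF m. \<Prod>i<m. ennreal (\<psi> (J \<omega> i))) \<partial>M)"
    using AE_points
  proof (intro nn_integral_cong_AE, eventually_elim)
    case (elim \<omega>)
    have "(\<Sum>n. ennreal (u ^ n / fact n) * (ennreal (exp (- (l * T \<omega>))) * (SUP m. block_weight n ?c m (J \<omega>)))) =
        ennreal (exp (- (l * T \<omega>))) * (\<Sum>n. SUP m. ennreal (u ^ n / fact n) * block_weight n ?c m (J \<omega>))"
      by (simp add: ennreal_suminf_cmult[symmetric] SUP_mult_left_ennreal[symmetric] mult.left_commute)
    also have "(\<Sum>n. SUP m. ennreal (u ^ n / fact n) * block_weight n ?c m (J \<omega>)) =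
        (SUP m. \<Sum>n. ennreal (u ^ n / fact n) * block_weight n ?c m (J \<omega>))"
      using block_weight_incseq[of _ ?c "J \<omega>"]
      by (intro ennreal_suminf_SUP_eq) (auto simp: incseq_def intro!: mult_left_mono)
    also have "\<dots> = (SUP m. ennreal (\<Prod>i<m. 1 - z + z * exp (u * J \<omega> i)))"
      using elim by (simp add: suminf_block_weight[OF z u(1)] less_imp_le)
    finally show ?case using lim elim by simp
  qed
  also have "\<dots> = ennreal (exp (- ((1 - z) * l powr g + z * (l - u) powr g)))"
    using z by (intro Laplace_functional_stable int\<psi> \<psi>0 \<psi>1) auto
  finally show ?thesis .
qed

text \<open>Up to sign, the \<open>n\<close>th derivative at \<open>l\<close> of the Laplace
  transform of \<open>T\<close> on the event of \<open>k\<close> blocks. For \<open>l > 0\<close>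
  the integral is finite, so \<open>enn2real\<close> loses nothing.\<close>

definition tilted :: "nat \<Rightarrow> nat \<Rightarrow> real \<Rightarrow> real" where
  "tilted n k l = enn2real (\<integral>\<^sup>+\<omega>. ennreal (T \<omega> ^ n * exp (- (l * T \<omega>))) * indicator {k} (K \<omega> n) \<partial>M)"

lemma tilted_nonneg: "0 \<le> tilted n k l"
  by (simp add: tilted_def)

lemma tilted_finite:
  assumes "0 < l"
  shows "(\<integral>\<^sup>+\<omega>. ennreal (T \<omega> ^ n * exp (- (l * T \<omega>))) * indicator {k} (K \<omega> n) \<partial>M) = ennreal (tilted n k l)"
proof -
  have "(\<integral>\<^sup>+\<omega>. ennreal (T \<omega> ^ n * exp (- (l * T \<omega>))) * indicator {k} (K \<omega> n) \<partial>M) \<le> (\<integral>\<^sup>+\<omega>. ennreal (fact n / l ^ n) \<partial>M)"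
    using AE_T_pos assms power_exp_bound[of "T _" l n]
    by (intro nn_integral_mono_AE) (auto split: split_indicator intro!: ennreal_leI elim!: eventually_mono)
  then have "(\<integral>\<^sup>+\<omega>. ennreal (T \<omega> ^ n * exp (- (l * T \<omega>))) * indicator {k} (K \<omega> n) \<partial>M) < \<infinity>"
    by (rule le_less_trans) (simp add: emeasure_space_1)
  then show ?thesis by (simp add: tilted_def)
qed

lemma tilted_power_series:
  assumes z: "0 \<le> z" "z \<le> 1" and u: "0 \<le> u" "u \<le> l" and l: "0 < l"
  shows "(\<lambda>n. u ^ n / fact n * (\<Sum>k\<le>n. z ^ k * tilted n k l)) sums exp (- ((1 - z) * l powr g + z * (l - u) powr g))"
proof -
  have c: "0 \<le> (\<Sum>k\<le>n. z ^ k * tilted n k l)" for n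
    using z by (intro sum_nonneg mult_nonneg_nonneg tilted_nonneg) auto
  have A: "(\<integral>\<^sup>+\<omega>. ennreal (T \<omega> ^ n * exp (- (l * T \<omega>))) * ennreal (z ^ K \<omega> n) \<partial>M) = ennreal (\<Sum>k\<le>n. z ^ k * tilted n k l)" for n
  proof -
    have "ennreal (z ^ K \<omega> n) = (\<Sum>k\<le>n. ennreal (z ^ k) * indicator {k} (K \<omega> n))" for \<omega>
    proof -
      have "(\<Sum>k\<le>n. ennreal (z ^ k) * indicator {k} (K \<omega> n)) = (\<Sum>k\<in>{K \<omega> n}. ennreal (z ^ k) * indicator {k} (K \<omega> n))"
        using num_blocks_le[of "I \<omega>" n] by (intro sum.mono_neutral_right) (auto split: split_indicator)
      then show ?thesis by simp
    qed
    then have "(\<integral>\<^sup>+\<omega>. ennreal (T \<omega> ^ n * exp (- (l * T \<omega>))) * ennreal (z ^ K \<omega> n) \<partial>M) =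
        (\<integral>\<^sup>+\<omega>. (\<Sum>k\<le>n. ennreal (z ^ k) * (ennreal (T \<omega> ^ n * exp (- (l * T \<omega>))) * indicator {k} (K \<omega> n))) \<partial>M)"
      by (simp only: sum_distrib_left mult.left_commute)
    also have "\<dots> = (\<Sum>k\<le>n. ennreal (z ^ k) * (\<integral>\<^sup>+\<omega>. ennreal (T \<omega> ^ n * exp (- (l * T \<omega>))) * indicator {k} (K \<omega> n) \<partial>M))"
      by (subst nn_integral_sum) (auto intro!: sum.cong nn_integral_cmult)
    also have "\<dots> = (\<Sum>k\<le>n. ennreal (z ^ k * tilted n k l))"
      using z by (simp only: tilted_finite[OF l] ennreal_mult' zero_le_power)
    also have "\<dots> = ennreal (\<Sum>k\<le>n. z ^ k * tilted n k l)"
      using z by (intro sum_ennreal mult_nonneg_nonneg tilted_nonneg) auto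
    finally show ?thesis .
  qed
  have "(\<Sum>n. ennreal (u ^ n / fact n * (\<Sum>k\<le>n. z ^ k * tilted n k l))) = ennreal (exp (- ((1 - z) * l powr g + z * (l - u) powr g)))"
    unfolding blocks_generating_function[OF z u, symmetric] A using u
    by (intro suminf_cong ennreal_mult') auto
  then show ?thesis
    using u c by (intro sums_ennreal[THEN iffD1] ) (auto simp: sums_iff intro!: mult_nonneg_nonneg)
qed

text \<open>With \<open>u = l * x\<close>, multiplying the series by \<open>exp L\<close> leaves
  \<open>exp (z * L * (1 - (1 - x) powr g))\<close>, which involves \<open>l\<close> and
  \<open>z\<close> only through \<open>z * L\<close>. Comparison with \<open>l = 1\<close> at colour
  \<open>z * L\<close>, first by coefficients in \<open>x\<close> and then by coefficients in
  \<open>z\<close>, gives the power of \<open>l\<close>.\<close>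

lemma tilted_scaling:
  assumes l: "0 < l" and k: "k \<le> n"
  shows "tilted n k l = l powr (g * real k - real n) * exp (- (l powr g)) * (exp 1 * tilted n k 1)"
proof -
  define L where "L = l powr g"
  have L: "0 < L" using l by (simp add: L_def)
  \<comment> \<open>Both \<open>z\<close> and \<open>z * L\<close> have to be colouring
    probabilities, hence at most 1.\<close>
  define r where "r = min 1 (1 / L)"
  have r: "0 < r" "r \<le> 1" "r * L \<le> 1" using L by (auto simp: r_def min_def field_simps)
  have eq: "l ^ n * exp L / fact n * (\<Sum>k\<le>n. z ^ k * tilted n k l) = exp 1 / fact n * (\<Sum>k\<le>n. (z * L) ^ k * tilted n k 1)"
    if z: "0 \<le> z" "z \<le> r" for z n
  proof -
    have "z * L \<le> r * L" using z L by (intro mult_right_mono) auto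
    with r(3) have zL1: "z * L \<le> 1" by (rule order_trans[rotated])
    have zL: "0 \<le> z * L" "z * L \<le> 1" using z L zL1 by simp_all
    have "(\<lambda>n. l ^ n * exp L / fact n * (\<Sum>k\<le>n. z ^ k * tilted n k l)) =
        (\<lambda>n. exp 1 / fact n * (\<Sum>k\<le>n. (z * L) ^ k * tilted n k 1))"
    proof (rule powser_unique[where r=1 and f="\<lambda>x. exp (z * L * (1 - (1 - x) powr g))"])
      fix x :: real assume x: "0 \<le> x" "x \<le> 1"
      have "(\<lambda>n. exp L * ((l * x) ^ n / fact n * (\<Sum>k\<le>n. z ^ k * tilted n k l))) sums
          (exp L * exp (- ((1 - z) * l powr g + z * (l - l * x) powr g)))"
        using x l z r by (intro sums_mult tilted_power_series) (auto simp: mult_le_cancel_left1)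
      moreover have "(l - l * x) powr g = L * (1 - x) powr g"
        using x l by (simp add: L_def powr_mult[symmetric] right_diff_distrib)
      ultimately show "(\<lambda>n. l ^ n * exp L / fact n * (\<Sum>k\<le>n. z ^ k * tilted n k l) * x ^ n) sums exp (z * L * (1 - (1 - x) powr g))"
        by (simp add: L_def[symmetric] exp_add[symmetric] power_mult_distrib algebra_simps)
      have "(\<lambda>n. exp 1 * (x ^ n / fact n * (\<Sum>k\<le>n. (z * L) ^ k * tilted n k 1))) sums
          (exp 1 * exp (- ((1 - z * L) * 1 powr g + z * L * (1 - x) powr g)))"
        using x zL by (intro sums_mult tilted_power_series) auto
      then show "(\<lambda>n. exp 1 / fact n * (\<Sum>k\<le>n. (z * L) ^ k * tilted n k 1) * x ^ n) sums exp (z * L * (1 - (1 - x) powr g))"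
        by (simp add: exp_add[symmetric] algebra_simps)
    qed simp
    then show ?thesis by (rule fun_cong)
  qed
  have "(\<lambda>k. l ^ n * exp L * tilted n k l) k = (\<lambda>k. exp 1 * L ^ k * tilted n k 1) k"
  proof (rule polynomial_coeffs_unique[OF r(1) _ k])
    fix z assume "0 \<le> z" "z \<le> r"
    from eq[OF this, of n]
    show "(\<Sum>k\<le>n. l ^ n * exp L * tilted n k l * z ^ k) = (\<Sum>k\<le>n. exp 1 * L ^ k * tilted n k 1 * z ^ k)"
      by (simp add: sum_distrib_left sum_divide_distrib[symmetric] power_mult_distrib mult_ac)
  qed
  then have "tilted n k l = L ^ k / l ^ n * exp (- L) * (exp 1 * tilted n k 1)"
    using l by (simp add: exp_minus field_simps)
  moreover have "L ^ k / l ^ n = l powr (g * real k - real n)"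
    using l by (simp add: L_def powr_diff powr_realpow powr_powr[symmetric])
  ultimately show ?thesis by (simp only: L_def)
qed

end

lemma nn_integral_powr_exp_powr:
  fixes g a :: real
  assumes "0 < g" "0 < a"
  shows "(\<integral>\<^sup>+l. ennreal (l powr (g * a - 1) * exp (- (l powr g))) * indicator {0<..} l \<partial>lborel) = ennreal (Gamma a / g)"
proof -
  have "ennreal (Gamma a) = (\<integral>\<^sup>+y. ennreal (y powr (a - 1) * exp (- y)) * indicator {0<..} y \<partial>lborel)"
    using nn_integral_Gamma_scaled[of a 1] assms by simp
  also have "\<dots> = (\<integral>\<^sup>+l. ennreal ((l powr g) powr (a - 1) * exp (- (l powr g))) * ennreal (\<bar>g\<bar> * l powr (g - 1)) * indicator {0<..} l \<partial>lborel)"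
    using assms by (intro nn_integral_powr_substitution) auto
  also have "\<dots> = (\<integral>\<^sup>+l. ennreal g * (ennreal (l powr (g * a - 1) * exp (- (l powr g))) * indicator {0<..} l) \<partial>lborel)"
  proof (rule nn_integral_cong)
    fix l :: real
    have "(l powr g) powr (a - 1) * exp (- (l powr g)) * (\<bar>g\<bar> * l powr (g - 1)) =
        g * (l powr (g * a - 1) * exp (- (l powr g)))" if "0 < l"
      using that assms by (simp add: powr_powr powr_add[symmetric] algebra_simps)
    then show "ennreal ((l powr g) powr (a - 1) * exp (- (l powr g))) * ennreal (\<bar>g\<bar> * l powr (g - 1)) * indicator {0<..} l =
        ennreal g * (ennreal (l powr (g * a - 1) * exp (- (l powr g))) * indicator {0<..} l)"
      using assms by (auto simp: ennreal_mult''[symmetric] split: split_indicator)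
  qed
  also have "\<dots> = ennreal g * (\<integral>\<^sup>+l. ennreal (l powr (g * a - 1) * exp (- (l powr g))) * indicator {0<..} l \<partial>lborel)"
    by (rule nn_integral_cmult) measurable
  finally have E: "ennreal g * (\<integral>\<^sup>+l. ennreal (l powr (g * a - 1) * exp (- (l powr g))) * indicator {0<..} l \<partial>lborel) = ennreal (Gamma a)"
    by simp
  have "ennreal (1 / g) * (ennreal g * x) = x" for x
    using assms by (simp add: mult.assoc[symmetric] ennreal_mult''[symmetric])
  then have "(\<integral>\<^sup>+l. ennreal (l powr (g * a - 1) * exp (- (l powr g))) * indicator {0<..} l \<partial>lborel) = ennreal (1 / g) * ennreal (Gamma a)"
    unfolding E[symmetric] by simp
  then show ?thesis
    using assms Gamma_real_pos[of a] by (simp add: ennreal_mult''[symmetric])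
qed

context stable_model
begin

definition block_prob :: "nat \<Rightarrow> nat \<Rightarrow> real" where
  "block_prob n k = measure M (K_event M I n k)"

lemma K_event_sets [measurable]: "K_event M I n k \<in> sets M"
  unfolding K_event_def by measurable

lemma emeasure_K_event: "emeasure M (K_event M I n k) = ennreal (block_prob n k)"
  by (simp add: block_prob_def emeasure_eq_measure)

lemma block_prob_nonneg: "0 \<le> block_prob n k"
  by (simp add: block_prob_def)

lemma indicator_K_event: "\<omega> \<in> space M \<Longrightarrow> indicator (K_event M I n k) \<omega> = indicator {k} (K \<omega> n)"
  by (auto simp: K_event_def split: split_indicator)

text \<open>Integrating over \<open>l\<close> against \<open>l powr (real n - 1)\<close> turns
  \<open>T ^ n * exp (- (l * T))\<close> into \<open>Gamma (real n)\<close> for every positive value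
  of \<open>T\<close>, and turns the scaling form into \<open>C * (Gamma (real k) / g)\<close>. The
  comparison expresses the unknown constant by the block probability.\<close>

lemma tilted_eq:
  assumes n: "0 < n" and k: "0 < k" "k \<le> n" and l: "0 < l"
  shows "tilted n k l = block_prob n k * (g * Gamma (real n) / Gamma (real k)) * (l powr (g * real k - real n) * exp (- (l powr g)))"
proof -
  define C where "C = exp 1 * tilted n k 1"
  have C0: "0 \<le> C" by (simp add: C_def tilted_nonneg)
  have Gn: "0 < Gamma (real n)" and Gk: "0 < Gamma (real k)" using n k by (auto intro!: Gamma_real_pos)
  have "ennreal (Gamma (real n) * block_prob n k) = (\<integral>\<^sup>+\<omega>. ennreal (Gamma (real n)) * indicator {k} (K \<omega> n) \<partial>M)"
  proof -
    have "(\<integral>\<^sup>+\<omega>. indicator {k} (K \<omega> n) \<partial>M) = (\<integral>\<^sup>+\<omega>. indicator (K_event M I n k) \<omega> \<partial>M)"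
      by (intro nn_integral_cong) (simp add: indicator_K_event)
    then show ?thesis using Gn
      by (simp add: nn_integral_cmult emeasure_K_event ennreal_mult')
  qed
  also have "\<dots> = (\<integral>\<^sup>+\<omega>. (\<integral>\<^sup>+l. ennreal (l powr (real n - 1)) * (ennreal (T \<omega> ^ n * exp (- (l * T \<omega>))) * indicator {k} (K \<omega> n)) * indicator {0<..} l \<partial>lborel) \<partial>M)"
    using AE_T_pos
  proof (intro nn_integral_cong_AE, eventually_elim)
    case (elim \<omega>)
    have "(\<integral>\<^sup>+l. ennreal (l powr (real n - 1)) * (ennreal (T \<omega> ^ n * exp (- (l * T \<omega>))) * indicator {k} (K \<omega> n)) * indicator {0<..} l \<partial>lborel) =
      (\<integral>\<^sup>+l. (ennreal (T \<omega> ^ n) * indicator {k} (K \<omega> n)) * (ennreal (l powr (real n - 1) * exp (- (T \<omega> * l))) * indicator {0<..} l) \<partial>lborel)"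
      using elim by (intro nn_integral_cong) (auto simp: ennreal_mult''[symmetric] mult_ac split: split_indicator)
    also have "\<dots> = (ennreal (T \<omega> ^ n) * indicator {k} (K \<omega> n)) * ennreal (Gamma (real n) * T \<omega> powr (- real n))"
      using elim n by (subst nn_integral_cmult) (measurable, subst nn_integral_Gamma_scaled, auto)
    also have "\<dots> = ennreal (Gamma (real n)) * indicator {k} (K \<omega> n)"
      using elim Gn by (auto simp: ennreal_mult''[symmetric] powr_minus powr_realpow field_simps split: split_indicator)
    finally show ?case by simp
  qed
  also have "\<dots> = (\<integral>\<^sup>+l. (\<integral>\<^sup>+\<omega>. ennreal (l powr (real n - 1)) * (ennreal (T \<omega> ^ n * exp (- (l * T \<omega>))) * indicator {k} (K \<omega> n)) * indicator {0<..} l \<partial>M) \<partial>lborel)"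
  proof -
    interpret pair_sigma_finite M lborel ..
    show ?thesis by (rule Fubini'[symmetric]) measurable
  qed
  also have "\<dots> = (\<integral>\<^sup>+l. ennreal (l powr (real n - 1)) * ennreal (tilted n k l) * indicator {0<..} l \<partial>lborel)"
  proof (rule nn_integral_cong)
    fix l :: real
    have "(\<integral>\<^sup>+\<omega>. ennreal (l powr (real n - 1)) * (ennreal (T \<omega> ^ n * exp (- (l * T \<omega>))) * indicator {k} (K \<omega> n)) * indicator {0<..} l \<partial>M) =
      ennreal (l powr (real n - 1)) * (\<integral>\<^sup>+\<omega>. ennreal (T \<omega> ^ n * exp (- (l * T \<omega>))) * indicator {k} (K \<omega> n) \<partial>M) * indicator {0<..} l"
      by (simp add: nn_integral_cmult nn_integral_multc)
    then show "(\<integral>\<^sup>+\<omega>. ennreal (l powr (real n - 1)) * (ennreal (T \<omega> ^ n * exp (- (l * T \<omega>))) * indicator {k} (K \<omega> n)) * indicator {0<..} l \<partial>M) =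
        ennreal (l powr (real n - 1)) * ennreal (tilted n k l) * indicator {0<..} l"
      using tilted_finite[of l n k] by (cases "0 < l") auto
  qed
  also have "\<dots> = (\<integral>\<^sup>+l. ennreal C * (ennreal (l powr (g * real k - 1) * exp (- (l powr g))) * indicator {0<..} l) \<partial>lborel)"
  proof (rule nn_integral_cong)
    fix l :: real
    have "l powr (real n - 1) * tilted n k l = C * (l powr (g * real k - 1) * exp (- (l powr g)))" if "0 < l"
      unfolding tilted_scaling[OF that k(2)] C_def[symmetric] using that
      by (simp add: powr_add[symmetric] mult.assoc[symmetric])
    then show "ennreal (l powr (real n - 1)) * ennreal (tilted n k l) * indicator {0<..} l =
        ennreal C * (ennreal (l powr (g * real k - 1) * exp (- (l powr g))) * indicator {0<..} l)"
      using C0 by (auto simp: ennreal_mult''[symmetric] tilted_nonneg split: split_indicator)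
  qed
  also have "\<dots> = ennreal C * ennreal (Gamma (real k) / g)"
    using g k by (subst nn_integral_cmult) (measurable, subst nn_integral_powr_exp_powr, auto)
  also have "\<dots> = ennreal (C * (Gamma (real k) / g))"
    by (rule ennreal_mult''[symmetric]) (use Gk g in simp)
  finally have "Gamma (real n) * block_prob n k = C * (Gamma (real k) / g)"
    using Gn Gk g C0 by (subst (asm) ennreal_inj) (auto simp: block_prob_nonneg)
  then have "C = block_prob n k * (g * Gamma (real n) / Gamma (real k))"
    using Gk g by (simp add: field_simps)
  then show ?thesis
    unfolding tilted_scaling[OF l k(2)] C_def[symmetric] by simp
qed

text \<open>All weights are almost surely positive, so every cylinder has positive probability; the
  pattern \<open>min l (k - 1)\<close> visits exactly \<open>k\<close> indices in \<open>n\<close>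
  draws. This makes the divisions by block probabilities meaningful.\<close>

lemma block_prob_pos:
  assumes "0 < k" "k \<le> n"
  shows "0 < block_prob n k"
proof -
  define f where "f l = min l (k - 1)" for l
  define E where "E = {\<omega>\<in>space M. \<forall>l<n. I \<omega> l = f l}"
  have img: "f ` {..<n} = {..<k}"
  proof
    show "{..<k} \<subseteq> f ` {..<n}"
    proof
      fix x assume "x \<in> {..<k}"
      then have "x = f x" "x < n" using assms by (auto simp: f_def)
      then show "x \<in> f ` {..<n}" by blast
    qed
  qed (use assms in \<open>auto simp: f_def\<close>)
  have "E \<subseteq> K_event M I n k"
  proof
    fix \<omega> assume \<omega>: "\<omega> \<in> E"
    then have "I \<omega> ` {..<n} = f ` {..<n}" by (auto simp: E_def)
    then show "\<omega> \<in> K_event M I n k" using \<omega> img by (simp add: E_def K_event_def num_blocks_eq_card_image)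
  qed
  then have le: "measure M E \<le> block_prob n k"
    unfolding block_prob_def by (intro finite_measure_mono) auto
  have [measurable]: "E \<in> sets M" unfolding E_def by (rule cylinder_measurable)
  have "emeasure M E = (\<integral>\<^sup>+\<omega>. (\<Prod>l<n. ennreal (P \<omega> (f l))) \<partial>M)"
    using nn_integral_cylinder[of "\<lambda>_. 1" n f] by (simp add: E_def[symmetric])
  moreover have "(\<integral>\<^sup>+\<omega>. (\<Prod>l<n. ennreal (P \<omega> (f l))) \<partial>M) \<noteq> 0"
  proof
    assume "(\<integral>\<^sup>+\<omega>. (\<Prod>l<n. ennreal (P \<omega> (f l))) \<partial>M) = 0"
    then have "AE \<omega> in M. (\<Prod>l<n. ennreal (P \<omega> (f l))) = 0"
      by (subst (asm) nn_integral_0_iff_AE) auto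
    with AE_points have "AE \<omega> in M. False"
    proof eventually_elim
      case (elim \<omega>)
      then have "0 < P \<omega> i" for i by (auto simp: normalized_def)
      then show False using elim(2) by (auto simp: not_le[symmetric] ennreal_eq_0_iff prod_zero_iff)
    qed
    then show False by simp
  qed
  ultimately have "ennreal (measure M E) \<noteq> 0"
    by (simp only: emeasure_eq_measure simp_thms)
  then have "0 < measure M E"
    by (simp only: ennreal_eq_0_iff not_le)
  with le show ?thesis by simp
qed

text \<open>A power of \<open>T\<close> carries no block count by itself. Introducing a sample whose
  size is the exponent \<open>k\<close> splits it into transforms that are already known.\<close>

lemma nn_integral_T_power_exp:
  assumes k: "0 < k" and l: "0 < l"
  shows "(\<integral>\<^sup>+\<omega>. ennreal (T \<omega> ^ k * exp (- (l * T \<omega>))) \<partial>M) = (\<Sum>j=1..k. ennreal (tilted k j l))"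
proof -
  have "(\<Sum>j=1..k. indicator {j} (K \<omega> k)) = (1::ennreal)" for \<omega>
  proof -
    have "(\<Sum>j=1..k. indicator {j} (K \<omega> k)) = (\<Sum>j\<in>{K \<omega> k}. indicator {j} (K \<omega> k) :: ennreal)"
      using num_blocks_le[of "I \<omega>" k] num_blocks_pos[OF k, of "I \<omega>"]
      by (intro sum.mono_neutral_right) (auto split: split_indicator)
    then show ?thesis by simp
  qed
  then have "(\<integral>\<^sup>+\<omega>. ennreal (T \<omega> ^ k * exp (- (l * T \<omega>))) \<partial>M) =
      (\<integral>\<^sup>+\<omega>. ennreal (T \<omega> ^ k * exp (- (l * T \<omega>))) * (\<Sum>j=1..k. indicator {j} (K \<omega> k)) \<partial>M)"
    by simp
  also have "\<dots> = (\<integral>\<^sup>+\<omega>. (\<Sum>j=1..k. ennreal (T \<omega> ^ k * exp (- (l * T \<omega>))) * indicator {j} (K \<omega> k)) \<partial>M)"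
    by (simp only: sum_distrib_left)
  also have "\<dots> = (\<Sum>j=1..k. (\<integral>\<^sup>+\<omega>. ennreal (T \<omega> ^ k * exp (- (l * T \<omega>))) * indicator {j} (K \<omega> k) \<partial>M))"
    by (rule nn_integral_sum) measurable
  finally show ?thesis by (simp only: tilted_finite[OF l])
qed

end

section \<open>Composition of the models of index \<alpha> and \<beta> / \<alpha>\<close>

locale stable_triple =
  fixes \<alpha> \<beta> :: real
    and M\<^sub>\<alpha> :: "'a measure" and J\<^sub>\<alpha> I\<^sub>\<alpha>
    and M\<^sub>\<beta> :: "'b measure" and J\<^sub>\<beta> I\<^sub>\<beta>
    and M\<^sub>\<delta> :: "'c measure" and J\<^sub>\<delta> I\<^sub>\<delta>
  assumes order: "0 < \<beta>" "\<beta> < \<alpha>" "\<alpha> < 1"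
    and models: "PD_model \<alpha> M\<^sub>\<alpha> J\<^sub>\<alpha> I\<^sub>\<alpha>" "PD_model \<beta> M\<^sub>\<beta> J\<^sub>\<beta> I\<^sub>\<beta>" "PD_model (\<beta> / \<alpha>) M\<^sub>\<delta> J\<^sub>\<delta> I\<^sub>\<delta>"

sublocale stable_triple \<subseteq> a: stable_model \<alpha> M\<^sub>\<alpha> J\<^sub>\<alpha> I\<^sub>\<alpha>
  using order models by unfold_locales auto
sublocale stable_triple \<subseteq> b: stable_model \<beta> M\<^sub>\<beta> J\<^sub>\<beta> I\<^sub>\<beta>
  using order models by unfold_locales auto
sublocale stable_triple \<subseteq> d: stable_model "\<beta> / \<alpha>" M\<^sub>\<delta> J\<^sub>\<delta> I\<^sub>\<delta>
  using order models by unfold_locales auto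

context stable_triple
begin

text \<open>For fixed \<open>c = d.T y powr (1 / \<alpha>)\<close> the inner integral is
  \<open>c ^ n\<close> times the transform at \<open>s * c\<close>. Since
  \<open>c powr \<alpha> = d.T y\<close>, the powers of \<open>c\<close> combine to
  \<open>d.T y ^ k\<close> and the exponential to \<open>exp (- (s powr \<alpha> * d.T y))\<close>;
  what remains is decomposed by a sample of size \<open>k\<close>.\<close>

lemma tilted_composition:
  assumes n: "0 < n" and k: "0 < k" "k \<le> n" and s: "0 < s"
  shows "(\<integral>\<^sup>+y. \<integral>\<^sup>+x. ennreal ((a.T x * d.T y powr (1 / \<alpha>)) ^ n * exp (- (s * (a.T x * d.T y powr (1 / \<alpha>))))) *
        indicator {k} (a.K x n) \<partial>M\<^sub>\<alpha> \<partial>M\<^sub>\<delta>) =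
    ennreal (\<Sum>j=1..k. a.block_prob n k * d.block_prob k j * (\<beta> * Gamma (real n) / Gamma (real j)) * (s powr (\<beta> * real j - real n) * exp (- (s powr \<beta>))))"
proof -
  define A where "A = a.block_prob n k * (\<alpha> * Gamma (real n) / Gamma (real k)) * s powr (\<alpha> * real k - real n)"
  have Gn: "0 < Gamma (real n)" and Gk: "0 < Gamma (real k)" using n k by (auto intro!: Gamma_real_pos)
  have A0: "0 \<le> A" using Gn Gk order by (simp add: A_def a.block_prob_nonneg)
  have inner: "(\<integral>\<^sup>+x. ennreal ((a.T x * d.T y powr (1 / \<alpha>)) ^ n * exp (- (s * (a.T x * d.T y powr (1 / \<alpha>))))) *
        indicator {k} (a.K x n) \<partial>M\<^sub>\<alpha>) = ennreal A * ennreal (d.T y ^ k * exp (- (s powr \<alpha> * d.T y)))" if y: "0 < d.T y" for y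
  proof -
    define c where "c = d.T y powr (1 / \<alpha>)"
    have c: "0 < c" using y by (simp add: c_def)
    have sc: "0 < s * c" using s c by simp
    have "(\<integral>\<^sup>+x. ennreal ((a.T x * c) ^ n * exp (- (s * (a.T x * c)))) * indicator {k} (a.K x n) \<partial>M\<^sub>\<alpha>) =
        (\<integral>\<^sup>+x. ennreal (c ^ n) * (ennreal (a.T x ^ n * exp (- ((s * c) * a.T x))) * indicator {k} (a.K x n)) \<partial>M\<^sub>\<alpha>)"
      using c by (intro nn_integral_cong) (auto simp: ennreal_mult'[symmetric] power_mult_distrib mult_ac split: split_indicator)
    also have "\<dots> = ennreal (c ^ n) * ennreal (a.tilted n k (s * c))"
      by (subst nn_integral_cmult) (measurable, simp only: a.tilted_finite[OF sc])
    also have "\<dots> = ennreal (c ^ n * a.tilted n k (s * c))"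
      using c by (simp add: ennreal_mult')
    also have "c ^ n * a.tilted n k (s * c) = A * (d.T y ^ k * exp (- (s powr \<alpha> * d.T y)))"
    proof -
      have c\<alpha>: "c powr \<alpha> = d.T y" using y order by (simp add: c_def powr_powr)
      have "(s * c) powr \<alpha> = s powr \<alpha> * d.T y" using s c by (simp add: powr_mult c\<alpha>)
      moreover have "c ^ n * (s * c) powr (\<alpha> * real k - real n) = s powr (\<alpha> * real k - real n) * d.T y ^ k"
      proof -
        have "c ^ n * c powr (\<alpha> * real k - real n) = c powr (\<alpha> * real k)"
          using c by (simp add: powr_realpow[symmetric] powr_add[symmetric])
        also have "\<dots> = d.T y ^ k" using y c by (simp add: powr_powr[symmetric] c\<alpha> powr_realpow)
        finally show ?thesis using s c by (simp add: powr_mult)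
      qed
      ultimately show ?thesis
        unfolding a.tilted_eq[OF n k sc] A_def by (simp add: mult_ac)
    qed
    also have "ennreal \<dots> = ennreal A * ennreal (d.T y ^ k * exp (- (s powr \<alpha> * d.T y)))"
      using A0 by (rule ennreal_mult')
    finally show ?thesis by (simp only: c_def)
  qed
  have "(\<integral>\<^sup>+y. \<integral>\<^sup>+x. ennreal ((a.T x * d.T y powr (1 / \<alpha>)) ^ n * exp (- (s * (a.T x * d.T y powr (1 / \<alpha>))))) *
        indicator {k} (a.K x n) \<partial>M\<^sub>\<alpha> \<partial>M\<^sub>\<delta>) = (\<integral>\<^sup>+y. ennreal A * ennreal (d.T y ^ k * exp (- (s powr \<alpha> * d.T y))) \<partial>M\<^sub>\<delta>)"
    using d.AE_T_pos by (intro nn_integral_cong_AE, eventually_elim) (rule inner)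
  also have "\<dots> = ennreal A * (\<Sum>j=1..k. ennreal (d.tilted k j (s powr \<alpha>)))"
    using s k by (subst nn_integral_cmult) (measurable, simp add: d.nn_integral_T_power_exp)
  also have "\<dots> = ennreal (\<Sum>j=1..k. A * d.tilted k j (s powr \<alpha>))"
  proof -
    have "ennreal A * (\<Sum>j=1..k. ennreal (d.tilted k j (s powr \<alpha>))) = (\<Sum>j=1..k. ennreal (A * d.tilted k j (s powr \<alpha>)))"
      unfolding sum_distrib_left using A0 by (intro sum.cong refl ennreal_mult'[symmetric])
    also have "\<dots> = ennreal (\<Sum>j=1..k. A * d.tilted k j (s powr \<alpha>))"
      using A0 by (intro sum_ennreal mult_nonneg_nonneg d.tilted_nonneg)
    finally show ?thesis .
  qed
  also have "(\<Sum>j=1..k. A * d.tilted k j (s powr \<alpha>)) =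
      (\<Sum>j=1..k. a.block_prob n k * d.block_prob k j * (\<beta> * Gamma (real n) / Gamma (real j)) * (s powr (\<beta> * real j - real n) * exp (- (s powr \<beta>))))"
  proof (rule sum.cong)
    fix j assume "j \<in> {1..k}"
    then have j: "0 < j" "j \<le> k" by auto
    have s\<alpha>: "0 < s powr \<alpha>" using s by simp
    have "s powr (\<alpha> * real k - real n) * (s powr \<alpha>) powr (\<beta> / \<alpha> * real j - real k) = s powr (\<beta> * real j - real n)"
      using order by (simp add: powr_powr powr_add[symmetric] right_diff_distrib)
    moreover have "(s powr \<alpha>) powr (\<beta> / \<alpha>) = s powr \<beta>" using order by (simp add: powr_powr)
    \<comment> \<open>\<open>Gamma (real k)\<close> cancels between the two levels, and
      \<open>\<alpha> * (\<beta> / \<alpha>)\<close> gives the prefactor \<open>\<beta>\<close>, so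
      the constants are those of the \<open>\<beta>\<close> model with sizes \<open>n\<close> and
      \<open>j\<close>.\<close>
    ultimately show "A * d.tilted k j (s powr \<alpha>) = a.block_prob n k * d.block_prob k j * (\<beta> * Gamma (real n) / Gamma (real j)) * (s powr (\<beta> * real j - real n) * exp (- (s powr \<beta>)))"
      unfolding d.tilted_eq[OF k(1) j s\<alpha>] A_def using Gk order by (simp add: mult_ac)
  qed simp
  finally show ?thesis .
qed

text \<open>Two weighted laws of a positive variable are compared through their transforms with
  factor \<open>X ^ n\<close>: the product of masses on the event of \<open>k\<close> blocks, and
  the \<open>\<beta>\<close> mass with weight \<open>c j\<close> on the event of \<open>j\<close>
  blocks. The quotient in \<open>c j\<close> undoes the block probability inside the
  \<open>\<beta>\<close> transform.\<close>

proposition conditional_law_composition: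
  assumes n: "0 < n" and k: "0 < k" "k \<le> n" and \<phi>[measurable]: "\<phi> \<in> borel_measurable borel"
  shows "(\<integral>\<^sup>+x. (\<integral>\<^sup>+y. \<phi> (a.T x * d.T y powr (1 / \<alpha>)) \<partial>M\<^sub>\<delta>) * indicator {k} (a.K x n) \<partial>M\<^sub>\<alpha>) =
    (\<Sum>j=1..k. ennreal (a.block_prob n k * d.block_prob k j / b.block_prob n j) * (\<integral>\<^sup>+\<omega>. \<phi> (b.T \<omega>) * indicator {j} (b.K \<omega> n) \<partial>M\<^sub>\<beta>))"
proof -
  interpret pair_sigma_finite M\<^sub>\<delta> M\<^sub>\<alpha> ..
  define X where "X = (\<lambda>(y, x). a.T x * d.T y powr (1 / \<alpha>))"
  define W :: "'c \<times> 'a \<Rightarrow> ennreal" where "W = (\<lambda>(y, x). indicator {k} (a.K x n))"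
  define c where "c j = a.block_prob n k * d.block_prob k j / b.block_prob n j" for j
  define V :: "'b \<Rightarrow> ennreal" where "V \<omega> = (\<Sum>j=1..k. ennreal (c j) * indicator {j} (b.K \<omega> n))" for \<omega>
  have [measurable]: "X \<in> borel_measurable (M\<^sub>\<delta> \<Otimes>\<^sub>M M\<^sub>\<alpha>)" unfolding X_def by measurable
  have [measurable]: "W \<in> borel_measurable (M\<^sub>\<delta> \<Otimes>\<^sub>M M\<^sub>\<alpha>)" unfolding W_def by measurable
  have [measurable]: "V \<in> borel_measurable M\<^sub>\<beta>" unfolding V_def[abs_def] by measurable
  have c0: "0 \<le> c j" for j by (simp add: c_def a.block_prob_nonneg b.block_prob_nonneg d.block_prob_nonneg)
  have Vint: "(\<integral>\<^sup>+\<omega>. \<psi> (b.T \<omega>) * V \<omega> \<partial>M\<^sub>\<beta>) = (\<Sum>j=1..k. ennreal (c j) * (\<integral>\<^sup>+\<omega>. \<psi> (b.T \<omega>) * indicator {j} (b.K \<omega> n) \<partial>M\<^sub>\<beta>))"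
    if [measurable]: "\<psi> \<in> borel_measurable borel" for \<psi>
    unfolding V_def sum_distrib_left
    by (subst nn_integral_sum) (auto intro!: sum.cong simp: nn_integral_cmult[symmetric] mult_ac)
  have Wint: "(\<integral>\<^sup>+z. \<psi> (X z) * W z \<partial>(M\<^sub>\<delta> \<Otimes>\<^sub>M M\<^sub>\<alpha>)) = (\<integral>\<^sup>+y. \<integral>\<^sup>+x. \<psi> (a.T x * d.T y powr (1 / \<alpha>)) * indicator {k} (a.K x n) \<partial>M\<^sub>\<alpha> \<partial>M\<^sub>\<delta>)"
    if [measurable]: "\<psi> \<in> borel_measurable borel" for \<psi>
    by (subst a.nn_integral_fst[symmetric]) (auto simp: X_def W_def)
  have Vlap: "(\<integral>\<^sup>+\<omega>. ennreal (b.T \<omega> ^ n * exp (- (s * b.T \<omega>))) * V \<omega> \<partial>M\<^sub>\<beta>) =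
     ennreal (\<Sum>j=1..k. a.block_prob n k * d.block_prob k j * (\<beta> * Gamma (real n) / Gamma (real j)) * (s powr (\<beta> * real j - real n) * exp (- (s powr \<beta>))))"
    if s: "0 < s" for s
  proof -
    have "(\<integral>\<^sup>+\<omega>. ennreal (b.T \<omega> ^ n * exp (- (s * b.T \<omega>))) * V \<omega> \<partial>M\<^sub>\<beta>) = (\<Sum>j=1..k. ennreal (c j) * ennreal (b.tilted n j s))"
      by (subst Vint) (measurable, simp only: b.tilted_finite[OF s])
    also have "\<dots> = ennreal (\<Sum>j=1..k. c j * b.tilted n j s)"
      by (simp add: sum_ennreal[symmetric] b.tilted_nonneg c0 ennreal_mult')
    also have "(\<Sum>j=1..k. c j * b.tilted n j s) = (\<Sum>j=1..k. a.block_prob n k * d.block_prob k j * (\<beta> * Gamma (real n) / Gamma (real j)) * (s powr (\<beta> * real j - real n) * exp (- (s powr \<beta>))))"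
    proof (rule sum.cong)
      fix j assume "j \<in> {1..k}"
      then have j: "0 < j" "j \<le> n" using k by auto
      show "c j * b.tilted n j s = a.block_prob n k * d.block_prob k j * (\<beta> * Gamma (real n) / Gamma (real j)) * (s powr (\<beta> * real j - real n) * exp (- (s powr \<beta>)))"
        unfolding b.tilted_eq[OF n j s] c_def using b.block_prob_pos[OF j] by simp
    qed simp
    finally show ?thesis .
  qed
  have Wlap: "(\<integral>\<^sup>+z. ennreal (X z ^ n * exp (- (s * X z))) * W z \<partial>(M\<^sub>\<delta> \<Otimes>\<^sub>M M\<^sub>\<alpha>)) =
     ennreal (\<Sum>j=1..k. a.block_prob n k * d.block_prob k j * (\<beta> * Gamma (real n) / Gamma (real j)) * (s powr (\<beta> * real j - real n) * exp (- (s powr \<beta>))))"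
    if s: "0 < s" for s
    using Wint[of "\<lambda>t. ennreal (t ^ n * exp (- (s * t)))"] tilted_composition[OF n k s] by simp
  have posX: "AE z in M\<^sub>\<delta> \<Otimes>\<^sub>M M\<^sub>\<alpha>. 0 < X z"
  proof -
    have "AE y in M\<^sub>\<delta>. AE x in M\<^sub>\<alpha>. 0 < X (y, x)"
      using d.AE_T_pos
    proof eventually_elim
      case (elim y)
      show ?case using a.AE_T_pos by eventually_elim (use elim in \<open>simp add: X_def\<close>)
    qed
    then show ?thesis by (intro AE_pair_measure) auto
  qed
  have "(\<integral>\<^sup>+z. \<phi> (X z) * W z \<partial>(M\<^sub>\<delta> \<Otimes>\<^sub>M M\<^sub>\<alpha>)) = (\<integral>\<^sup>+\<omega>. \<phi> (b.T \<omega>) * V \<omega> \<partial>M\<^sub>\<beta>)"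
  proof (rule nn_integral_Laplace_unique[where n=n])
    show "(\<integral>\<^sup>+z. ennreal (X z ^ n * exp (- X z)) * W z \<partial>(M\<^sub>\<delta> \<Otimes>\<^sub>M M\<^sub>\<alpha>)) < \<infinity>"
      using Wlap[of 1] by simp
  qed (use posX b.AE_T_pos in \<open>auto simp: Wlap Vlap\<close>)
  also have "(\<integral>\<^sup>+z. \<phi> (X z) * W z \<partial>(M\<^sub>\<delta> \<Otimes>\<^sub>M M\<^sub>\<alpha>)) =
      (\<integral>\<^sup>+x. \<integral>\<^sup>+y. \<phi> (a.T x * d.T y powr (1 / \<alpha>)) * indicator {k} (a.K x n) \<partial>M\<^sub>\<delta> \<partial>M\<^sub>\<alpha>)"
    by (subst Wint, simp, rule Fubini'[symmetric]) measurable
  also have "\<dots> = (\<integral>\<^sup>+x. (\<integral>\<^sup>+y. \<phi> (a.T x * d.T y powr (1 / \<alpha>)) \<partial>M\<^sub>\<delta>) * indicator {k} (a.K x n) \<partial>M\<^sub>\<alpha>)"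
    by (intro nn_integral_cong nn_integral_multc) measurable
  finally show ?thesis by (simp add: Vint c_def)
qed

end

section \<open>Growth of the number of blocks\<close>

lemma suminf_ennreal_swap:
  fixes a :: "nat \<Rightarrow> nat \<Rightarrow> ennreal"
  shows "(\<Sum>n. \<Sum>j. a n j) = (\<Sum>j. \<Sum>n. a n j)"
proof -
  have "(\<Sum>n. \<Sum>j. a n j) = (\<integral>\<^sup>+n. (\<Sum>j. a n j) \<partial>count_space UNIV)"
    by (rule nn_integral_count_space_nat[symmetric])
  also have "\<dots> = (\<Sum>j. \<integral>\<^sup>+n. a n j \<partial>count_space UNIV)"
    by (rule nn_integral_suminf) simp
  finally show ?thesis by (simp add: nn_integral_count_space_nat)
qed

lemma suminf_indicator_singleton:
  fixes c :: "nat \<Rightarrow> ennreal"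
  shows "(\<Sum>j. c j * indicator {j} k) = c k"
  by (rule suminf_cmult_indicator) (auto simp: disjoint_family_on_def)

text \<open>Complement of a Chernoff event. The sign condition selects the values above
  \<open>x * m\<close> when \<open>x < 1\<close> and below it when \<open>x > 1\<close>, in either
  case the side that contains the mean.\<close>

lemma poisson_weight_half:
  assumes m: "0 \<le> m" and x: "0 < x" and small: "exp (- (poisson_rate x * m)) \<le> 1 / 2"
  shows "ennreal (1 / 2) \<le> (\<Sum>n. ennreal (poisson_weight m n) * indicator {n. (real n - x * m) * ln x < 0} n)"
proof -
  let ?G = "{n. 0 \<le> (real n - x * m) * ln x}"
  let ?a = "\<Sum>n. ennreal (poisson_weight m n) * indicator (- ?G) n"
  let ?b = "\<Sum>n. ennreal (poisson_weight m n) * indicator ?G n"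
  have "1 = (\<Sum>n. ennreal (poisson_weight m n))"
    using m poisson_weight_sums_1[of m] by (subst suminf_ennreal2) (auto simp: poisson_weight_nonneg sums_iff)
  also have "\<dots> = ?a + ?b"
    by (subst suminf_add) (auto intro!: suminf_cong split: split_indicator)
  also have "?b \<le> ennreal (1 / 2)"
    by (rule order_trans[OF poisson_weight_Chernoff[OF m x] ennreal_leI[OF small]]) simp
  finally have "1 \<le> ?a + ennreal (1 / 2)" by simp
  then have "ennreal (1 / 2) \<le> ?a"
  proof (cases ?a)
    case (real r)
    then have "ennreal 1 \<le> ennreal (r + 1 / 2)"
      using \<open>1 \<le> ?a + ennreal (1 / 2)\<close> by (simp only: ennreal_plus ennreal_1)
    then have "1 \<le> r + 1 / 2" using real(1) by (subst (asm) ennreal_le_iff) auto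
    then have "ennreal (1 / 2) \<le> ennreal r" by (intro ennreal_leI) simp
    then show ?thesis by (simp only: real)
  qed simp
  moreover have "- ?G = {n. (real n - x * m) * ln x < 0}" by auto
  ultimately show ?thesis by simp
qed

context stable_model
begin

text \<open>At \<open>u = l = t\<close> the generating function reduces to
  \<open>exp (- (t powr g) * (1 - z))\<close>, that of the Poisson law with mean
  \<open>t powr g\<close>; equality for all colours \<open>z\<close> between 0 and 1 determines
  every coefficient \<open>D j\<close>.\<close>

lemma poissonized_blocks:
  assumes t: "0 < t"
  shows "(\<Sum>n. \<integral>\<^sup>+\<omega>. ennreal (poisson_weight (t * T \<omega>) n) * c (K \<omega> n) \<partial>M) =
    (\<Sum>j. ennreal (poisson_weight (t powr g) j) * c j)"
proof -
  define D where "D j = (\<Sum>n. \<integral>\<^sup>+\<omega>. ennreal (poisson_weight (t * T \<omega>) n) * indicator {j} (K \<omega> n) \<partial>M)" for j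
  have [measurable]: "(\<lambda>\<omega>. poisson_weight (t * T \<omega>) n) \<in> borel_measurable M" for n
    unfolding poisson_weight_def by measurable
  have expand: "(\<Sum>n. \<integral>\<^sup>+\<omega>. ennreal (poisson_weight (t * T \<omega>) n) * c (K \<omega> n) \<partial>M) = (\<Sum>j. D j * c j)" for c
  proof -
    have "(\<Sum>n. \<integral>\<^sup>+\<omega>. ennreal (poisson_weight (t * T \<omega>) n) * c (K \<omega> n) \<partial>M) =
        (\<Sum>n. \<Sum>j. c j * (\<integral>\<^sup>+\<omega>. ennreal (poisson_weight (t * T \<omega>) n) * indicator {j} (K \<omega> n) \<partial>M))"
    proof (rule suminf_cong)
      fix n
      have "(\<integral>\<^sup>+\<omega>. ennreal (poisson_weight (t * T \<omega>) n) * c (K \<omega> n) \<partial>M) =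
          (\<integral>\<^sup>+\<omega>. (\<Sum>j. c j * (ennreal (poisson_weight (t * T \<omega>) n) * indicator {j} (K \<omega> n))) \<partial>M)"
        by (simp only: mult.left_commute[of "c _"] ennreal_suminf_cmult suminf_indicator_singleton)
      also have "\<dots> = (\<Sum>j. c j * (\<integral>\<^sup>+\<omega>. ennreal (poisson_weight (t * T \<omega>) n) * indicator {j} (K \<omega> n) \<partial>M))"
        by (simp add: nn_integral_suminf nn_integral_cmult)
      finally show "(\<integral>\<^sup>+\<omega>. ennreal (poisson_weight (t * T \<omega>) n) * c (K \<omega> n) \<partial>M) = \<dots>" .
    qed
    also have "\<dots> = (\<Sum>j. D j * c j)"
      unfolding D_def by (subst suminf_ennreal_swap) (simp add: mult.commute)
    finally show ?thesis .
  qed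
  have pw: "ennreal (poisson_weight (t * x) n) = ennreal (t ^ n / fact n) * ennreal (x ^ n * exp (- (t * x)))" for x n
    using t by (simp add: ennreal_mult'[symmetric] poisson_weight_def power_mult_distrib mult_ac)
  have gf: "(\<Sum>j. D j * ennreal (z ^ j)) = ennreal (exp (- (t powr g) * (1 - z)))" if z: "0 \<le> z" "z \<le> 1" for z
  proof -
    have "(\<Sum>j. D j * ennreal (z ^ j)) = (\<Sum>n. ennreal (t ^ n / fact n) *
        (\<integral>\<^sup>+\<omega>. ennreal (T \<omega> ^ n * exp (- (t * T \<omega>))) * ennreal (z ^ K \<omega> n) \<partial>M))"
      unfolding expand[symmetric] pw mult.assoc
      by (intro suminf_cong nn_integral_cmult) measurable
    then show ?thesis
      using blocks_generating_function[OF z, of t t] t by (simp add: mult.commute)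
  qed
  have D1: "(\<Sum>j. D j) = 1" using gf[of 1] by simp
  have "D j \<le> 1" for j
    unfolding D1[symmetric] using sum_le_suminf[of D "{j}"] by simp
  then have fin: "D j < \<infinity>" for j by (rule le_less_trans) simp
  then have Dr: "D j = ennreal (enn2real (D j))" for j by simp
  have "(\<lambda>j. enn2real (D j)) = poisson_weight (t powr g)"
  proof (rule powser_unique[OF zero_less_one])
    fix z :: real assume z: "0 \<le> z" "z \<le> 1"
    have "(\<Sum>j. ennreal (enn2real (D j) * z ^ j)) = ennreal (exp (- (t powr g) * (1 - z)))"
      unfolding gf[OF z, symmetric] using z by (simp add: ennreal_mult' Dr[symmetric])
    then show "(\<lambda>j. enn2real (D j) * z ^ j) sums exp (- (t powr g) * (1 - z))"
      using z by (intro sums_ennreal[THEN iffD1]) (auto simp: sums_iff)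
  qed (rule poisson_weight_pgf)
  then show ?thesis unfolding expand using Dr by metis
qed

end

section \<open>From Poisson sample sizes to fixed sample sizes\<close>

lemma summable_exp_powr:
  fixes c g :: real
  assumes "0 < c" "0 < g"
  shows "summable (\<lambda>m. exp (- (c * real m powr g)))"
proof (rule summable_comparison_test_bigo)
  show "summable (\<lambda>m. norm (real m powr (- 2)))" by (simp add: summable_real_powr_iff)
  show "(\<lambda>m. exp (- (c * real m powr g))) \<in> O(\<lambda>m. real m powr (- 2))"
    using assms by real_asymp
qed

text \<open>A squeeze in two stages: for fixed \<open>j\<close> the bounds converge to limits that
  miss \<open>x\<close> by a margin, and the margin vanishes as \<open>j\<close> grows.\<close>

lemma tendsto_between_families:
  fixes a :: "nat \<Rightarrow> real"
  assumes lo: "\<And>j. \<forall>\<^sub>F n in sequentially. l j n \<le> a n" "\<And>j. l j \<longlonglongrightarrow> L j" "L \<longlonglongrightarrow> x"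
    and hi: "\<And>j. \<forall>\<^sub>F n in sequentially. a n \<le> u j n" "\<And>j. u j \<longlonglongrightarrow> U j" "U \<longlonglongrightarrow> x"
  shows "a \<longlonglongrightarrow> x"
proof (rule order_tendstoI)
  fix y assume "y < x"
  then obtain j where "y < L j"
    using order_tendstoD(1)[OF lo(3)] by (meson eventually_happens' sequentially_bot)
  show "\<forall>\<^sub>F n in sequentially. y < a n"
    using order_tendstoD(1)[OF lo(2)[of j] \<open>y < L j\<close>] lo(1)[of j] by eventually_elim simp
next
  fix y assume "x < y"
  then obtain j where "U j < y"
    using order_tendstoD(2)[OF hi(3)] by (meson eventually_happens' sequentially_bot)
  show "\<forall>\<^sub>F n in sequentially. a n < y"
    using order_tendstoD(2)[OF hi(2)[of j] \<open>U j < y\<close>] hi(1)[of j] by eventually_elim simp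
qed

text \<open>Monotonicity lets the known sample sizes bracket an arbitrary \<open>n\<close>:
  \<open>m\<close> is the integer just above \<open>n / ((1 - \<epsilon> j) * S)\<close> for the
  upper bound and just below \<open>n / ((1 + \<epsilon> j) * S)\<close> for the lower one. Rounding
  \<open>m\<close> costs the terms \<open>1 / real n\<close>.\<close>

lemma block_growth_from_samples:
  fixes k :: "nat \<Rightarrow> nat" and \<epsilon> :: "nat \<Rightarrow> real"
  assumes mono: "\<And>m n. m \<le> n \<Longrightarrow> k m \<le> k n" and S: "0 < S" and g: "0 < g"
    and \<epsilon>: "\<And>j. 0 < \<epsilon> j" "\<And>j. \<epsilon> j < 1" "\<epsilon> \<longlonglongrightarrow> 0"
    and up: "\<And>j. \<forall>\<^sub>F m in sequentially. real (k (nat \<lfloor>(1 - \<epsilon> j) * (real m * S)\<rfloor>)) < (1 + \<epsilon> j) * real m powr g"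
    and lo: "\<And>j. \<forall>\<^sub>F m in sequentially. (1 - \<epsilon> j) * real m powr g < real (k (nat \<lfloor>(1 + \<epsilon> j) * (real m * S)\<rfloor>))"
  shows "(\<lambda>n. real n powr (- g) * real (k n)) \<longlonglongrightarrow> S powr (- g)"
proof (rule tendsto_between_families[where
      l="\<lambda>j n. (1 - \<epsilon> j) * (1 / ((1 + \<epsilon> j) * S) - 1 / real n) powr g" and L="\<lambda>j. (1 - \<epsilon> j) * (1 / ((1 + \<epsilon> j) * S) - 0) powr g" and
      u="\<lambda>j n. (1 + \<epsilon> j) * (1 / ((1 - \<epsilon> j) * S) + 1 / real n) powr g" and U="\<lambda>j. (1 + \<epsilon> j) * (1 / ((1 - \<epsilon> j) * S) + 0) powr g"])
  fix j
  define e where "e = \<epsilon> j"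
  have e: "0 < e" "e < 1" using \<epsilon> by (auto simp: e_def)
  define x where "x = (1 - e) * S"
  have x: "0 < x" using e S by (simp add: x_def)
  define y where "y = (1 + e) * S"
  have y: "0 < y" using e S by (simp add: y_def)
  have n_inf: "filterlim (\<lambda>n. nat \<lfloor>real n / c\<rfloor>) at_top sequentially" if "0 < c" for c
    using that by real_asymp
  have n_inf': "filterlim (\<lambda>n. Suc (nat \<lfloor>real n / c\<rfloor>)) at_top sequentially" if "0 < c" for c
    using n_inf[OF that] by (rule filterlim_compose[OF filterlim_Suc])
  show "\<forall>\<^sub>F n in sequentially. real n powr (- g) * real (k n) \<le> (1 + \<epsilon> j) * (1 / ((1 - \<epsilon> j) * S) + 1 / real n) powr g"
    using n_inf'[OF x, THEN filterlim_iff[THEN iffD1], rule_format, OF up[of j]] eventually_gt_at_top[of 0]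
  proof eventually_elim
    case (elim n)
    let ?m = "Suc (nat \<lfloor>real n / x\<rfloor>)"
    have m: "real n / x \<le> real ?m" "real ?m \<le> real n / x + 1" using x by (auto simp: floor_less_iff) linarith+
    then have "real n \<le> (1 - e) * (real ?m * S)" using x by (simp add: x_def field_simps)
    then have "n \<le> nat \<lfloor>(1 - e) * (real ?m * S)\<rfloor>" by linarith
    then have "real (k n) \<le> (1 + e) * real ?m powr g"
      using mono[of n] elim(1) unfolding e_def[symmetric] by (meson less_imp_le of_nat_le_iff order_trans)
    also have "\<dots> \<le> (1 + e) * (real n / x + 1) powr g"
      using m(2) e g by (intro mult_left_mono powr_mono2) auto
    also have "(real n / x + 1) powr g = real n powr g * (1 / x + 1 / real n) powr g"
      using elim(2) x by (simp add: powr_mult[symmetric] distrib_left)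
    finally have "real n powr (- g) * real (k n) \<le> real n powr (- g) * ((1 + e) * (real n powr g * (1 / x + 1 / real n) powr g))"
      by (intro mult_left_mono) auto
    also have "\<dots> = (1 + e) * (1 / x + 1 / real n) powr g"
      using elim(2) by (simp add: powr_minus field_simps)
    finally show ?case by (simp add: x_def e_def)
  qed
  show "(\<lambda>n. (1 + \<epsilon> j) * (1 / ((1 - \<epsilon> j) * S) + 1 / real n) powr g) \<longlonglongrightarrow> (1 + \<epsilon> j) * (1 / ((1 - \<epsilon> j) * S) + 0) powr g"
    using x unfolding e_def[symmetric] x_def[symmetric]
    by (intro tendsto_mult tendsto_const tendsto_powr tendsto_add lim_1_over_n) auto
  show "\<forall>\<^sub>F n in sequentially. (1 - \<epsilon> j) * (1 / ((1 + \<epsilon> j) * S) - 1 / real n) powr g \<le> real n powr (- g) * real (k n)"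
    using n_inf[OF y, THEN filterlim_iff[THEN iffD1], rule_format, OF lo[of j]] eventually_gt_at_top[of "nat \<lceil>y\<rceil>"]
  proof eventually_elim
    case (elim n)
    let ?m = "nat \<lfloor>real n / y\<rfloor>"
    \<comment> \<open>Beyond \<open>y\<close> the base \<open>real n / y - 1\<close> is nonnegative,
      as monotonicity of \<open>powr\<close> requires.\<close>
    have ny: "y < real n" "0 < n" using elim(2) y by linarith+
    have m: "real ?m \<le> real n / y" "real n / y - 1 \<le> real ?m" using y by auto
    have "(1 + e) * (real ?m * S) = real ?m * y" by (simp only: y_def mult_ac)
    also have "\<dots> \<le> real n / y * y" using y m(1) by (intro mult_right_mono) auto
    finally have "(1 + e) * (real ?m * S) \<le> real n" using y by simp
    then have "nat \<lfloor>(1 + e) * (real ?m * S)\<rfloor> \<le> n" by linarith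
    then have "(1 - e) * real ?m powr g \<le> real (k n)"
      using mono[of _ n] elim(1) unfolding e_def[symmetric] by (meson less_imp_le of_nat_le_iff order_trans)
    moreover have "(1 - e) * (real n / y - 1) powr g \<le> (1 - e) * real ?m powr g"
      using m(2) e g ny y by (intro mult_left_mono powr_mono2) (auto simp: field_simps)
    moreover have "(real n / y - 1) powr g = real n powr g * (1 / y - 1 / real n) powr g"
    proof -
      have "real n / y - 1 = real n * (1 / y - 1 / real n)" "0 \<le> 1 / y - 1 / real n"
        using ny y by (simp_all add: field_simps)
      then show ?thesis by (simp only: powr_mult)
    qed
    ultimately have "real n powr (- g) * ((1 - e) * (real n powr g * (1 / y - 1 / real n) powr g)) \<le> real n powr (- g) * real (k n)"
      by (intro mult_left_mono) auto
    moreover have "real n powr (- g) * ((1 - e) * (real n powr g * (1 / y - 1 / real n) powr g)) = (1 - e) * (1 / y - 1 / real n) powr g"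
      using ny by (simp add: powr_minus field_simps)
    ultimately show ?case by (simp only: y_def e_def)
  qed
  show "(\<lambda>n. (1 - \<epsilon> j) * (1 / ((1 + \<epsilon> j) * S) - 1 / real n) powr g) \<longlonglongrightarrow> (1 - \<epsilon> j) * (1 / ((1 + \<epsilon> j) * S) - 0) powr g"
    using y unfolding e_def[symmetric] y_def[symmetric]
    by (intro tendsto_mult tendsto_const tendsto_powr tendsto_diff lim_1_over_n) auto
next
  have eq: "S powr (- g) = (1 + 0) * (1 / ((1 - 0) * S) + 0) powr g" "S powr (- g) = (1 - 0) * (1 / ((1 + 0) * S) - 0) powr g"
    using S by (simp_all add: powr_minus powr_divide inverse_eq_divide)
  show "(\<lambda>j. (1 + \<epsilon> j) * (1 / ((1 - \<epsilon> j) * S) + 0) powr g) \<longlonglongrightarrow> S powr (- g)"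
    unfolding eq(1) using S \<epsilon>(3) by (intro tendsto_intros) auto
  show "(\<lambda>j. (1 - \<epsilon> j) * (1 / ((1 + \<epsilon> j) * S) - 0) powr g) \<longlonglongrightarrow> S powr (- g)"
    unfolding eq(2) using S \<epsilon>(3) by (intro tendsto_intros) auto
qed

section \<open>Almost sure growth under a reweighted law\<close>

locale reweighted_model = stable_model g M J I + s: sampled_partition N Q L
  for g and M :: "'a measure" and J I and N :: "'d measure" and Q L +
  fixes w :: "real \<Rightarrow> ennreal"
  assumes w [measurable]: "w \<in> borel_measurable borel"
    and reweight: "\<And>F. F \<in> borel_measurable seq_space \<Longrightarrow> (\<integral>\<^sup>+\<omega>. F (Q \<omega>) \<partial>N) = (\<integral>\<^sup>+\<omega>. w (T \<omega>) * F (P \<omega>) \<partial>M)"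
begin

abbreviation "S \<omega> \<equiv> mass_of_weights g (Q \<omega>)"
abbreviation "K_hat \<omega> n \<equiv> num_blocks (L \<omega>) n"

lemma S_measurable [measurable]: "(\<lambda>\<omega>. S \<omega>) \<in> borel_measurable N"
  by measurable

text \<open>Given the weights, both samples follow the same rule, so a density that depends on the
  mass alone carries over to events that involve the block count.\<close>

lemma nn_integral_reweighted:
  assumes [measurable]: "\<phi> \<in> borel_measurable borel"
  shows "(\<integral>\<^sup>+\<omega>. \<phi> (S \<omega>) * c (K_hat \<omega> n) \<partial>N) = (\<integral>\<^sup>+\<omega>. w (T \<omega>) * \<phi> (T \<omega>) * c (K \<omega> n) \<partial>M)"
proof -
  have "(\<integral>\<^sup>+\<omega>. \<phi> (S \<omega>) * c (K_hat \<omega> n) \<partial>N) = (\<integral>\<^sup>+\<omega>. \<phi> (S \<omega>) * (SUP m. block_weight n c m (Q \<omega>)) \<partial>N)"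
    by (rule s.nn_integral_block_weight) measurable
  also have "\<dots> = (\<integral>\<^sup>+\<omega>. w (T \<omega>) * (\<phi> (mass_of_weights g (P \<omega>)) * (SUP m. block_weight n c m (P \<omega>))) \<partial>M)"
    by (rule reweight) measurable
  also have "\<dots> = (\<integral>\<^sup>+\<omega>. (w (T \<omega>) * \<phi> (T \<omega>)) * (SUP m. block_weight n c m (P \<omega>)) \<partial>M)"
    using mass_of_weights_eq by (intro nn_integral_cong_AE) (auto simp: mult.assoc elim!: eventually_mono)
  also have "\<dots> = (\<integral>\<^sup>+\<omega>. w (T \<omega>) * \<phi> (T \<omega>) * c (K \<omega> n) \<partial>M)"
    using nn_integral_T_blocks[of "\<lambda>t. w t * \<phi> t" c n] by simp
  finally show ?thesis .
qed

lemma nn_integral_S: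
  assumes [measurable]: "\<phi> \<in> borel_measurable borel"
  shows "(\<integral>\<^sup>+\<omega>. \<phi> (S \<omega>) \<partial>N) = (\<integral>\<^sup>+\<omega>. w (T \<omega>) * \<phi> (T \<omega>) \<partial>M)"
  using nn_integral_reweighted[of \<phi> "\<lambda>_. 1"] by simp

text \<open>A density of total integral 1 is almost surely finite; this permits the later exhaustion
  by the sets where \<open>w\<close> is at most a constant.\<close>

lemma AE_S: "AE \<omega> in N. 0 < S \<omega> \<and> w (S \<omega>) < \<infinity>"
proof -
  have "(\<integral>\<^sup>+\<omega>. w (T \<omega>) \<partial>M) = 1"
    using nn_integral_S[of "\<lambda>_. 1"] by (simp add: s.emeasure_space_1)
  then have "AE \<omega> in M. w (T \<omega>) \<noteq> \<infinity>"
    by (intro nn_integral_PInf_AE) auto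
  then have "AE \<omega> in M. w (T \<omega>) * indicator {t. \<not> (0 < t \<and> w t < \<infinity>)} (T \<omega>) = 0"
    using AE_T_pos by eventually_elim (auto simp: less_top)
  then have "(\<integral>\<^sup>+\<omega>. indicator {t. \<not> (0 < t \<and> w t < \<infinity>)} (S \<omega>) \<partial>N) = 0"
    by (subst nn_integral_S) (measurable, simp add: nn_integral_0_iff_AE)
  then show ?thesis
    by (subst (asm) nn_integral_0_iff_AE) (auto elim!: eventually_mono split: split_indicator_asm)
qed

text \<open>Given the mass, a Poisson sample size lies with probability at least 1/2 on that side of
  \<open>x * (t * S \<omega>)\<close> where monotonicity of the block count preserves the bad event.
  At the Poisson size the count is exactly Poisson with mean \<open>t powr g\<close>. The bound
  \<open>C\<close> on \<open>w\<close> removes the reweighting, and \<open>\<theta>\<close> makes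
  the estimate of 1/2 uniform in the mass.\<close>

lemma blocks_deviation:
  assumes xy: "0 < x" "0 < y" "x < 1 \<and> 1 < y \<or> 1 < x \<and> y < 1" and t: "0 < t" and \<theta>: "0 < \<theta>"
    and small: "exp (- (poisson_rate x * (t * \<theta>))) \<le> 1 / 2"
  shows "emeasure N {\<omega>\<in>space N. \<theta> \<le> S \<omega> \<and> w (S \<omega>) \<le> of_nat C \<and>
      0 \<le> (real (K_hat \<omega> (nat \<lfloor>x * (t * S \<omega>)\<rfloor>)) - y * t powr g) * ln y}
    \<le> ennreal (2 * real C * exp (- (poisson_rate y * t powr g)))" (is "emeasure N ?U \<le> _")
proof -
  define A where "A = {s. \<theta> \<le> s \<and> w s \<le> of_nat C}"
  define B where "B = {k::nat. 0 \<le> (real k - y * t powr g) * ln y}"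
  have [measurable]: "A \<in> sets borel" unfolding A_def by measurable
  have [measurable]: "(\<lambda>s. ennreal (poisson_weight (t * s) n)) \<in> borel_measurable borel" for n
    unfolding poisson_weight_def by measurable
  have "(\<lambda>\<omega>. ennreal (poisson_weight (t * T \<omega>) n)) \<in> borel_measurable M" for n
    unfolding poisson_weight_def by measurable
  then have pw_meas: "(\<lambda>\<omega>. ennreal (poisson_weight (t * T \<omega>) n) * indicator B (K \<omega> n)) \<in> borel_measurable M" for n
    by (intro borel_measurable_times_ennreal measurable_indicator_num_blocks)
  have "(\<lambda>\<omega>. K_hat \<omega> (nat \<lfloor>x * (t * S \<omega>)\<rfloor>)) \<in> N \<rightarrow>\<^sub>M count_space UNIV"
    by (rule measurable_compose_countable[where f="\<lambda>n \<omega>. K_hat \<omega> n"]) measurable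
  then have [measurable]: "?U \<in> sets N" by measurable
  \<comment> \<open>The factor 2 compensates for the conditional probability of at least 1/2 that
    the Poisson size falls on the useful side.\<close>
  have pt: "indicator ?U \<omega> \<le> 2 * (\<Sum>n. (indicator A (S \<omega>) * ennreal (poisson_weight (t * S \<omega>) n)) * indicator B (K_hat \<omega> n))" for \<omega>
  proof (cases "\<omega> \<in> ?U")
    case True
    then have S: "\<theta> \<le> S \<omega>" "S \<omega> \<in> A" and bad: "K_hat \<omega> (nat \<lfloor>x * (t * S \<omega>)\<rfloor>) \<in> B"
      by (auto simp: A_def B_def)
    have "poisson_rate x * (t * \<theta>) \<le> poisson_rate x * (t * S \<omega>)"
      using poisson_rate_pos[of x] xy t S by (intro mult_left_mono) auto
    then have "exp (- (poisson_rate x * (t * S \<omega>))) \<le> 1 / 2"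
      using small by (intro order_trans[OF _ small]) simp
    then have half: "ennreal (1 / 2) \<le> (\<Sum>n. ennreal (poisson_weight (t * S \<omega>) n) * indicator {n. (real n - x * (t * S \<omega>)) * ln x < 0} n)"
      using t S \<theta> xy by (intro poisson_weight_half) auto
    have "K_hat \<omega> n \<in> B" if n: "(real n - x * (t * S \<omega>)) * ln x < 0" for n
      using xy(3)
    proof
      assume c: "x < 1 \<and> 1 < y"
      then have "x * (t * S \<omega>) < real n" using n xy by (auto simp: mult_less_0_iff)
      then have "nat \<lfloor>x * (t * S \<omega>)\<rfloor> \<le> n" by linarith
      then have "real (K_hat \<omega> (nat \<lfloor>x * (t * S \<omega>)\<rfloor>)) \<le> real (K_hat \<omega> n)" by (simp add: num_blocks_mono)
      then show ?thesis using bad c by (auto simp: B_def zero_le_mult_iff)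
    next
      assume c: "1 < x \<and> y < 1"
      then have "real n < x * (t * S \<omega>)" using n xy by (auto simp: mult_less_0_iff)
      then have "n \<le> nat \<lfloor>x * (t * S \<omega>)\<rfloor>" by linarith
      then have "real (K_hat \<omega> n) \<le> real (K_hat \<omega> (nat \<lfloor>x * (t * S \<omega>)\<rfloor>))" by (simp add: num_blocks_mono)
      then show ?thesis using bad c xy by (auto simp: B_def zero_le_mult_iff)
    qed
    then have "(\<Sum>n. ennreal (poisson_weight (t * S \<omega>) n) * indicator {n. (real n - x * (t * S \<omega>)) * ln x < 0} n) \<le>
        (\<Sum>n. (indicator A (S \<omega>) * ennreal (poisson_weight (t * S \<omega>) n)) * indicator B (K_hat \<omega> n))"
      using S by (intro suminf_le) (auto split: split_indicator)
    with half have "ennreal (1 / 2) \<le> (\<Sum>n. (indicator A (S \<omega>) * ennreal (poisson_weight (t * S \<omega>) n)) * indicator B (K_hat \<omega> n))"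
      by (rule order_trans)
    then have "2 * ennreal (1 / 2) \<le> 2 * (\<Sum>n. (indicator A (S \<omega>) * ennreal (poisson_weight (t * S \<omega>) n)) * indicator B (K_hat \<omega> n))"
      by (intro mult_left_mono) auto
    moreover have "2 * ennreal (1 / 2) = 1"
      using ennreal_mult''[of "1 / 2" 2] by simp
    ultimately show ?thesis using True by (simp only: indicator_simps)
  qed simp
  have "emeasure N ?U = (\<integral>\<^sup>+\<omega>. indicator ?U \<omega> \<partial>N)" by simp
  also have "\<dots> \<le> (\<integral>\<^sup>+\<omega>. 2 * (\<Sum>n. (indicator A (S \<omega>) * ennreal (poisson_weight (t * S \<omega>) n)) * indicator B (K_hat \<omega> n)) \<partial>N)"
    by (intro nn_integral_mono pt)
  also have "\<dots> = 2 * (\<Sum>n. \<integral>\<^sup>+\<omega>. (indicator A (S \<omega>) * ennreal (poisson_weight (t * S \<omega>) n)) * indicator B (K_hat \<omega> n) \<partial>N)"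
    by (subst nn_integral_cmult) (measurable, subst nn_integral_suminf, measurable)
  also have "\<dots> = 2 * (\<Sum>n. \<integral>\<^sup>+\<omega>. w (T \<omega>) * (indicator A (T \<omega>) * ennreal (poisson_weight (t * T \<omega>) n)) * indicator B (K \<omega> n) \<partial>M)"
    by (subst nn_integral_reweighted) measurable
  also have "\<dots> \<le> 2 * (\<Sum>n. \<integral>\<^sup>+\<omega>. of_nat C * (ennreal (poisson_weight (t * T \<omega>) n) * indicator B (K \<omega> n)) \<partial>M)"
    by (intro mult_left_mono suminf_le nn_integral_mono) (auto simp: A_def mult.assoc intro!: mult_right_mono split: split_indicator)
  also have "\<dots> = 2 * (of_nat C * (\<Sum>n. \<integral>\<^sup>+\<omega>. ennreal (poisson_weight (t * T \<omega>) n) * indicator B (K \<omega> n) \<partial>M))"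
    by (simp only: nn_integral_cmult[OF pw_meas] ennreal_suminf_cmult)
  also have "\<dots> \<le> 2 * (of_nat C * ennreal (exp (- (poisson_rate y * t powr g))))"
    unfolding poissonized_blocks[OF t] using xy
    by (intro mult_left_mono poisson_weight_Chernoff) (auto simp: B_def)
  also have "\<dots> = ennreal (2 * real C * exp (- (poisson_rate y * t powr g)))"
    by (simp add: ennreal_mult'' ennreal_of_nat_eq_real_of_nat mult.assoc)
  finally show ?thesis .
qed

text \<open>Borel-Cantelli along integer times \<open>m\<close>: the bounds decay like
  \<open>exp (- (c * real m powr g))\<close>, which is summable for every positive
  \<open>g\<close>.\<close>

lemma blocks_eventually:
  assumes xy: "0 < x" "0 < y" "x < 1 \<and> 1 < y \<or> 1 < x \<and> y < 1" and \<theta>: "0 < \<theta>"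
  shows "AE \<omega> in N. \<theta> \<le> S \<omega> \<and> w (S \<omega>) \<le> of_nat C \<longrightarrow>
    (\<forall>\<^sub>F m in sequentially. (real (K_hat \<omega> (nat \<lfloor>x * (real m * S \<omega>)\<rfloor>)) - y * real m powr g) * ln y < 0)"
proof -
  have rx: "0 < poisson_rate x" and ry: "0 < poisson_rate y" using xy by (auto intro!: poisson_rate_pos)
  have "\<forall>\<^sub>F m in sequentially. exp (- (poisson_rate x * (real m * \<theta>))) \<le> 1 / 2 \<and> 0 < m"
    using rx \<theta> by (intro eventually_conj eventually_gt_at_top) real_asymp
  then obtain m0 where m0: "\<And>m. m0 \<le> m \<Longrightarrow> exp (- (poisson_rate x * (real m * \<theta>))) \<le> 1 / 2 \<and> 0 < m"
    by (auto simp: eventually_sequentially)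
  define U where "U m = {\<omega>\<in>space N. \<theta> \<le> S \<omega> \<and> w (S \<omega>) \<le> of_nat C \<and>
      0 \<le> (real (K_hat \<omega> (nat \<lfloor>x * (real m * S \<omega>)\<rfloor>)) - y * real m powr g) * ln y}" for m
  have "(\<lambda>\<omega>. K_hat \<omega> (nat \<lfloor>x * (t * S \<omega>)\<rfloor>)) \<in> N \<rightarrow>\<^sub>M count_space UNIV" for t
    by (rule measurable_compose_countable[where f="\<lambda>n \<omega>. K_hat \<omega> n"]) measurable
  then have [measurable]: "U m \<in> sets N" for m unfolding U_def by measurable
  have "AE \<omega> in N. \<forall>\<^sub>F m in sequentially. \<omega> \<in> space N - U m"
  proof (rule borel_cantelli_AE1)
    show "summable (\<lambda>m. measure N (U m))"
    proof (rule summable_comparison_test)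
      show "\<exists>n0. \<forall>m\<ge>n0. norm (measure N (U m)) \<le> 2 * real C * exp (- (poisson_rate y * real m powr g))"
      proof (intro exI[of _ m0] allI impI)
        fix m assume m: "m0 \<le> m"
        have "ennreal (measure N (U m)) \<le> ennreal (2 * real C * exp (- (poisson_rate y * real m powr g)))"
          unfolding U_def s.emeasure_eq_measure[symmetric] using m0[OF m]
          by (intro blocks_deviation[OF xy _ \<theta>]) auto
        then show "norm (measure N (U m)) \<le> 2 * real C * exp (- (poisson_rate y * real m powr g))"
          by (subst (asm) ennreal_le_iff) auto
      qed
      show "summable (\<lambda>m. 2 * real C * exp (- (poisson_rate y * real m powr g)))"
        using ry g by (intro summable_mult summable_exp_powr) auto
    qed
  qed (auto simp: s.emeasure_eq_measure)
  then show ?thesis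
    by eventually_elim (auto simp: U_def not_le elim!: eventually_mono)
qed

text \<open>The thresholds \<open>1 / real (Suc i)\<close> for the mass and \<open>i\<close> for the
  density exhaust almost every outcome, and the margins \<open>\<epsilon> j\<close> are countable,
  so one null set serves all of them.\<close>

theorem blocks_limit:
  "AE \<omega> in N. (\<lambda>n. real n powr (- g) * real (K_hat \<omega> n)) \<longlonglongrightarrow> S \<omega> powr (- g)"
proof -
  define \<epsilon> where "\<epsilon> j = 1 / real (j + 2)" for j
  have \<epsilon>: "0 < \<epsilon> j" "\<epsilon> j < 1" for j by (auto simp: \<epsilon>_def)
  have "AE \<omega> in N. \<forall>i j. 1 / real (Suc i) \<le> S \<omega> \<and> w (S \<omega>) \<le> of_nat i \<longrightarrow>
    (\<forall>\<^sub>F m in sequentially. (real (K_hat \<omega> (nat \<lfloor>(1 - \<epsilon> j) * (real m * S \<omega>)\<rfloor>)) - (1 + \<epsilon> j) * real m powr g) * ln (1 + \<epsilon> j) < 0)"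
    using \<epsilon> by (intro AE_all_countable[THEN iffD2] allI blocks_eventually) (auto simp: add_pos_pos)
  moreover have "AE \<omega> in N. \<forall>i j. 1 / real (Suc i) \<le> S \<omega> \<and> w (S \<omega>) \<le> of_nat i \<longrightarrow>
    (\<forall>\<^sub>F m in sequentially. (real (K_hat \<omega> (nat \<lfloor>(1 + \<epsilon> j) * (real m * S \<omega>)\<rfloor>)) - (1 - \<epsilon> j) * real m powr g) * ln (1 - \<epsilon> j) < 0)"
    using \<epsilon> by (intro AE_all_countable[THEN iffD2] allI blocks_eventually) (auto simp: add_pos_pos)
  ultimately show ?thesis using AE_S
  proof eventually_elim
    case (elim \<omega>)
    obtain i1 where i1: "1 / S \<omega> \<le> real i1" using real_arch_simple by blast
    obtain i2 :: nat where i2: "w (S \<omega>) < of_nat i2"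
      using elim(3) ennreal_Ex_less_of_nat[of "w (S \<omega>)"] by (auto simp: less_top)
    define i where "i = max i1 i2"
    have "1 / S \<omega> \<le> real (Suc i)" using i1 by (simp add: i_def)
    then have "1 / real (Suc i) \<le> S \<omega>" using elim(3) by (simp add: field_simps)
    moreover have "w (S \<omega>) \<le> of_nat i"
      using i2 by (rule order_trans[OF less_imp_le]) (simp add: i_def)
    ultimately have "\<forall>\<^sub>F m in sequentially. (real (K_hat \<omega> (nat \<lfloor>(1 - \<epsilon> j) * (real m * S \<omega>)\<rfloor>)) - (1 + \<epsilon> j) * real m powr g) * ln (1 + \<epsilon> j) < 0"
      "\<forall>\<^sub>F m in sequentially. (real (K_hat \<omega> (nat \<lfloor>(1 + \<epsilon> j) * (real m * S \<omega>)\<rfloor>)) - (1 - \<epsilon> j) * real m powr g) * ln (1 - \<epsilon> j) < 0" for j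
      using elim(1,2) by blast+
    note ev = this
    show ?case
    proof (rule block_growth_from_samples[where \<epsilon>=\<epsilon>])
      show "\<forall>\<^sub>F m in sequentially. real (K_hat \<omega> (nat \<lfloor>(1 - \<epsilon> j) * (real m * S \<omega>)\<rfloor>)) < (1 + \<epsilon> j) * real m powr g" for j
        using ev(1)[of j] by eventually_elim (use \<epsilon>[of j] in \<open>auto simp: mult_less_0_iff\<close>)
      show "\<forall>\<^sub>F m in sequentially. (1 - \<epsilon> j) * real m powr g < real (K_hat \<omega> (nat \<lfloor>(1 + \<epsilon> j) * (real m * S \<omega>)\<rfloor>))" for j
        using ev(2)[of j] by eventually_elim (use \<epsilon>[of j] in \<open>auto simp: mult_less_0_iff\<close>)
      show "\<epsilon> \<longlonglongrightarrow> 0" unfolding \<epsilon>_def[abs_def] by real_asymp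
    qed (use \<epsilon> elim g in \<open>auto intro: num_blocks_mono\<close>)
  qed
qed

end

section \<open>Mittag-Leffler marks and subordination\<close>

text \<open>One variable at a time: with \<open>exp (- (m * X\<^sub>2 \<omega>))\<close> as weight,
  the first variable may be tested by an indicator, and this indicator is the weight in a second
  application for the other variable. Rectangles determine the joint law.\<close>

lemma nn_integral_Laplace_unique_2d:
  fixes X\<^sub>1 X\<^sub>2 :: "'a \<Rightarrow> real" and Y\<^sub>1 Y\<^sub>2 :: "'b \<Rightarrow> real"
  assumes "finite_measure M" "finite_measure N"
    and [measurable]: "X\<^sub>1 \<in> borel_measurable M" "X\<^sub>2 \<in> borel_measurable M"
      "Y\<^sub>1 \<in> borel_measurable N" "Y\<^sub>2 \<in> borel_measurable N"
    and X: "AE \<omega> in M. 0 < X\<^sub>1 \<omega> \<and> 0 < X\<^sub>2 \<omega>" and Y: "AE \<omega> in N. 0 < Y\<^sub>1 \<omega> \<and> 0 < Y\<^sub>2 \<omega>"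
    and eq: "\<And>l m. 0 < l \<Longrightarrow> 0 < m \<Longrightarrow> (\<integral>\<^sup>+\<omega>. ennreal (exp (- (l * X\<^sub>1 \<omega> + m * X\<^sub>2 \<omega>))) \<partial>M) =
      (\<integral>\<^sup>+\<omega>. ennreal (exp (- (l * Y\<^sub>1 \<omega> + m * Y\<^sub>2 \<omega>))) \<partial>N)"
    and [measurable]: "H \<in> borel_measurable (borel \<Otimes>\<^sub>M borel)"
  shows "(\<integral>\<^sup>+\<omega>. H (X\<^sub>1 \<omega>, X\<^sub>2 \<omega>) \<partial>M) = (\<integral>\<^sup>+\<omega>. H (Y\<^sub>1 \<omega>, Y\<^sub>2 \<omega>) \<partial>N)"
proof -
  interpret M: finite_measure M by fact
  interpret N: finite_measure N by fact
  have fin: "(\<integral>\<^sup>+\<omega>. F \<omega> \<partial>M) < \<infinity>" if "AE \<omega> in M. F \<omega> \<le> 1" for F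
  proof -
    have "(\<integral>\<^sup>+\<omega>. F \<omega> \<partial>M) \<le> (\<integral>\<^sup>+\<omega>. 1 \<partial>M)" using that by (rule nn_integral_mono_AE)
    then show ?thesis using M.emeasure_finite[of "space M"] by (auto simp: less_top[symmetric] top_unique)
  qed
  have X1: "AE \<omega> in M. 0 < X\<^sub>1 \<omega>" "AE \<omega> in M. 0 < X\<^sub>2 \<omega>" and Y1: "AE \<omega> in N. 0 < Y\<^sub>1 \<omega>" "AE \<omega> in N. 0 < Y\<^sub>2 \<omega>"
    using X Y by auto
  have step1: "(\<integral>\<^sup>+\<omega>. \<phi> (X\<^sub>1 \<omega>) * ennreal (exp (- (m * X\<^sub>2 \<omega>))) \<partial>M) = (\<integral>\<^sup>+\<omega>. \<phi> (Y\<^sub>1 \<omega>) * ennreal (exp (- (m * Y\<^sub>2 \<omega>))) \<partial>N)"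
    if "0 < m" and [measurable]: "\<phi> \<in> borel_measurable borel" for \<phi> m
  proof (rule nn_integral_Laplace_unique[where n=0, OF _ _ _ _ X1(1) Y1(1)])
    fix s :: real assume "0 < s"
    then show "(\<integral>\<^sup>+\<omega>. ennreal (X\<^sub>1 \<omega> ^ 0 * exp (- (s * X\<^sub>1 \<omega>))) * ennreal (exp (- (m * X\<^sub>2 \<omega>))) \<partial>M) =
       (\<integral>\<^sup>+\<omega>. ennreal (Y\<^sub>1 \<omega> ^ 0 * exp (- (s * Y\<^sub>1 \<omega>))) * ennreal (exp (- (m * Y\<^sub>2 \<omega>))) \<partial>N)"
      using eq[OF _ that(1), of s] by (simp add: ennreal_mult''[symmetric] exp_add[symmetric] algebra_simps)
  next
    show "(\<integral>\<^sup>+\<omega>. ennreal (X\<^sub>1 \<omega> ^ 0 * exp (- X\<^sub>1 \<omega>)) * ennreal (exp (- (m * X\<^sub>2 \<omega>))) \<partial>M) < \<infinity>"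
    proof (rule fin)
      show "AE \<omega> in M. ennreal (X\<^sub>1 \<omega> ^ 0 * exp (- X\<^sub>1 \<omega>)) * ennreal (exp (- (m * X\<^sub>2 \<omega>))) \<le> 1"
        using X
      proof eventually_elim
        case (elim \<omega>)
        then have "0 < X\<^sub>1 \<omega> + m * X\<^sub>2 \<omega>" using that(1) by (intro add_pos_pos mult_pos_pos) auto
        then show ?case by (simp add: ennreal_mult''[symmetric] exp_add[symmetric])
      qed
    qed
  qed measurable
  have step2: "(\<integral>\<^sup>+\<omega>. \<phi> (X\<^sub>2 \<omega>) * indicator A (X\<^sub>1 \<omega>) \<partial>M) = (\<integral>\<^sup>+\<omega>. \<phi> (Y\<^sub>2 \<omega>) * indicator A (Y\<^sub>1 \<omega>) \<partial>N)"
    if [measurable]: "\<phi> \<in> borel_measurable borel" "A \<in> sets borel" for \<phi> A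
  proof (rule nn_integral_Laplace_unique[where n=0, OF _ _ _ _ X1(2) Y1(2)])
    fix s :: real assume "0 < s"
    then show "(\<integral>\<^sup>+\<omega>. ennreal (X\<^sub>2 \<omega> ^ 0 * exp (- (s * X\<^sub>2 \<omega>))) * indicator A (X\<^sub>1 \<omega>) \<partial>M) =
       (\<integral>\<^sup>+\<omega>. ennreal (Y\<^sub>2 \<omega> ^ 0 * exp (- (s * Y\<^sub>2 \<omega>))) * indicator A (Y\<^sub>1 \<omega>) \<partial>N)"
      using step1[of s "indicator A"] by (simp add: mult.commute)
  next
    show "(\<integral>\<^sup>+\<omega>. ennreal (X\<^sub>2 \<omega> ^ 0 * exp (- X\<^sub>2 \<omega>)) * indicator A (X\<^sub>1 \<omega>) \<partial>M) < \<infinity>"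
    proof (rule fin)
      show "AE \<omega> in M. ennreal (X\<^sub>2 \<omega> ^ 0 * exp (- X\<^sub>2 \<omega>)) * indicator A (X\<^sub>1 \<omega>) \<le> 1"
        using X by eventually_elim (auto split: split_indicator)
    qed
  qed measurable
  let ?A = "distr M (borel \<Otimes>\<^sub>M borel) (\<lambda>\<omega>. (X\<^sub>1 \<omega>, X\<^sub>2 \<omega>))"
  let ?B = "distr N (borel \<Otimes>\<^sub>M borel) (\<lambda>\<omega>. (Y\<^sub>1 \<omega>, Y\<^sub>2 \<omega>))"
  have rect: "emeasure ?A (a \<times> b) = emeasure ?B (a \<times> b)" if [measurable]: "a \<in> sets borel" "b \<in> sets borel" for a b
  proof -
    have "emeasure ?A (a \<times> b) = (\<integral>\<^sup>+x. indicator (a \<times> b) x \<partial>?A)" by simp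
    also have "\<dots> = (\<integral>\<^sup>+\<omega>. indicator b (X\<^sub>2 \<omega>) * indicator a (X\<^sub>1 \<omega>) \<partial>M)"
      by (subst nn_integral_distr) (auto intro!: nn_integral_cong split: split_indicator)
    also have "\<dots> = (\<integral>\<^sup>+\<omega>. indicator b (Y\<^sub>2 \<omega>) * indicator a (Y\<^sub>1 \<omega>) \<partial>N)" by (rule step2) measurable
    also have "\<dots> = (\<integral>\<^sup>+x. indicator (a \<times> b) x \<partial>?B)"
      by (subst nn_integral_distr) (auto intro!: nn_integral_cong split: split_indicator)
    finally show ?thesis by simp
  qed
  have "?A = ?B"
  proof (rule measure_eqI_generator_eq[OF Int_stable_pair_measure_generator[of borel borel]])
    fix Z assume "Z \<in> {a \<times> b |a b. a \<in> sets (borel :: real measure) \<and> b \<in> sets (borel :: real measure)}"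
    then obtain a b where "Z = a \<times> b" "a \<in> sets borel" "b \<in> sets borel" by blast
    then show "emeasure ?A Z = emeasure ?B Z" using rect by simp
  next
    interpret A: finite_measure ?A by (rule M.finite_measure_distr) measurable
    show "emeasure ?A ((\<lambda>_. UNIV \<times> UNIV) (i::nat)) \<noteq> \<infinity>" for i using A.emeasure_finite by simp
  qed (auto simp: sets_pair_measure space_pair_measure intro!: exI[of _ "UNIV :: real set"])
  then have "(\<integral>\<^sup>+x. H x \<partial>?A) = (\<integral>\<^sup>+x. H x \<partial>?B)" by simp
  then show ?thesis by (simp add: nn_integral_distr)
qed

section \<open>Densities of the total mass and of its negative power\<close>

locale stable_model_density = stable_model +
  fixes f :: "real \<Rightarrow> real"
  assumes density: "density_of_total M J f"
begin

lemma f_nonneg: "0 \<le> f t"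
  using density by (simp add: density_of_total_def)

lemma f_measurable [measurable]: "f \<in> borel_measurable borel"
proof -
  have "(\<lambda>t. enn2real (ennreal (f t))) \<in> borel_measurable borel"
    using density by (intro measurable_compose[OF _ borel_measurable_enn2real]) (auto simp: density_of_total_def distributed_def)
  then show ?thesis by (simp add: f_nonneg)
qed

lemma nn_integral_T_density:
  assumes [measurable]: "F \<in> borel_measurable borel"
  shows "(\<integral>\<^sup>+\<omega>. F (T \<omega>) \<partial>M) = (\<integral>\<^sup>+t. F t * ennreal (f t) * indicator {0<..} t \<partial>lborel)"
proof -
  have "(\<integral>\<^sup>+\<omega>. F (T \<omega>) \<partial>M) = (\<integral>\<^sup>+\<omega>. F (T \<omega>) * indicator {0<..} (T \<omega>) \<partial>M)"
    using AE_T_pos by (intro nn_integral_cong_AE) (auto elim!: eventually_mono)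
  also have "\<dots> = (\<integral>\<^sup>+t. ennreal (f t) * (F t * indicator {0<..} t) \<partial>lborel)"
    by (rule distributed_nn_integral[symmetric, of M lborel]) (use density in \<open>auto simp: density_of_total_def\<close>)
  finally show ?thesis by (simp add: mult_ac)
qed

text \<open>The substitution \<open>t = s powr (- 1 / g)\<close> exhibits \<open>stable_g\<close> as
  the density of \<open>T powr (- g)\<close>.\<close>

lemma nn_integral_T_stable_g:
  assumes [measurable]: "F \<in> borel_measurable borel"
  shows "(\<integral>\<^sup>+\<omega>. F (T \<omega>) \<partial>M) = (\<integral>\<^sup>+s. F (s powr (- 1 / g)) * ennreal (stable_g g f s) * indicator {0<..} s \<partial>lborel)"
proof -
  have "(\<integral>\<^sup>+\<omega>. F (T \<omega>) \<partial>M) = (\<integral>\<^sup>+s. F (s powr (- 1 / g)) * ennreal (f (s powr (- 1 / g))) *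
      ennreal (\<bar>- 1 / g\<bar> * s powr (- 1 / g - 1)) * indicator {0<..} s \<partial>lborel)"
    unfolding nn_integral_T_density[OF assms] using g by (intro nn_integral_powr_substitution) auto
  then show ?thesis
    using g f_nonneg by (simp add: stable_g_def ennreal_mult''[symmetric] mult.assoc mult_ac)
qed

end

section \<open>Stable points with Mittag-Leffler marks\<close>

locale mittag_leffler_mixture = stable_triple \<alpha> \<beta> M\<^sub>\<alpha> J\<^sub>\<alpha> I\<^sub>\<alpha> M\<^sub>\<beta> J\<^sub>\<beta> I\<^sub>\<beta> M\<^sub>\<delta> J\<^sub>\<delta> I\<^sub>\<delta> +
    ad: stable_model_density \<alpha> M\<^sub>\<alpha> J\<^sub>\<alpha> I\<^sub>\<alpha> f\<^sub>\<alpha> + n: prob_space N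
  for \<alpha> \<beta> :: real and M\<^sub>\<alpha> :: "'a measure" and J\<^sub>\<alpha> I\<^sub>\<alpha> and M\<^sub>\<beta> :: "'b measure" and J\<^sub>\<beta> I\<^sub>\<beta>
    and M\<^sub>\<delta> :: "'c measure" and J\<^sub>\<delta> I\<^sub>\<delta> and f\<^sub>\<alpha> and N :: "'e measure" +
  fixes Z :: "'e \<Rightarrow> nat \<Rightarrow> real"
  assumes Z_indep: "n.indep_vars (\<lambda>_. borel) (\<lambda>k \<omega>. Z \<omega> k) UNIV"
    and Z_law: "\<And>k. distr N borel (\<lambda>\<omega>. Z \<omega> k) = mittag_leffler_law M\<^sub>\<alpha> J\<^sub>\<alpha> f\<^sub>\<alpha> \<alpha> (- \<beta>)"
begin

abbreviation "c\<^sub>\<beta> \<equiv> \<integral>\<omega>. a.T \<omega> powr \<beta> \<partial>M\<^sub>\<alpha>"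
abbreviation "\<zeta> \<equiv> mittag_leffler_law M\<^sub>\<alpha> J\<^sub>\<alpha> f\<^sub>\<alpha> \<alpha> (- \<beta>)"

lemma Z_measurable [measurable]: "(\<lambda>\<omega>. Z \<omega> k) \<in> borel_measurable N"
  using Z_indep by (simp add: n.indep_vars_def)

lemma sets_\<zeta> [measurable_cong]: "sets \<zeta> = sets borel"
  by (simp add: mittag_leffler_law_def)

lemma prob_\<zeta>: "prob_space \<zeta>"
  unfolding Z_law[of 0, symmetric] by (rule n.prob_space_distr) measurable

lemma c\<^sub>\<beta>_nonneg: "0 \<le> c\<^sub>\<beta>"
  by (intro integral_nonneg_AE) auto

text \<open>In the variable \<open>s = T powr (- \<alpha>)\<close> the factor
  \<open>s powr (- \<beta> / \<alpha>)\<close> is \<open>T powr \<beta>\<close>, so a mark is a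
  function of the \<open>\<alpha>\<close> mass under a biased law. This brings the Laplace transform
  of that mass into play.\<close>

lemma nn_integral_\<zeta>:
  assumes [measurable]: "F \<in> borel_measurable borel"
  shows "(\<integral>\<^sup>+z. F z \<partial>\<zeta>) = (\<integral>\<^sup>+\<omega>. F (a.T \<omega> powr (- \<alpha>)) * ennreal (a.T \<omega> powr \<beta> / c\<^sub>\<beta>) \<partial>M\<^sub>\<alpha>)"
proof -
  have [measurable]: "stable_g \<alpha> f\<^sub>\<alpha> \<in> borel_measurable borel" unfolding stable_g_def[abs_def] by measurable
  have "(\<integral>\<^sup>+z. F z \<partial>\<zeta>) = (\<integral>\<^sup>+s. indicator {0<..} s * ennreal (s powr (- \<beta> / \<alpha>) * stable_g \<alpha> f\<^sub>\<alpha> s / c\<^sub>\<beta>) * F s \<partial>lborel)"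
    unfolding mittag_leffler_law_def by (subst nn_integral_density) auto
  also have "\<dots> = (\<integral>\<^sup>+s. F ((s powr (- 1 / \<alpha>)) powr (- \<alpha>)) * ennreal ((s powr (- 1 / \<alpha>)) powr \<beta> / c\<^sub>\<beta>) * ennreal (stable_g \<alpha> f\<^sub>\<alpha> s) * indicator {0<..} s \<partial>lborel)"
  proof (rule nn_integral_cong)
    fix s :: real
    have "(s powr (- 1 / \<alpha>)) powr (- \<alpha>) = s" "(s powr (- 1 / \<alpha>)) powr \<beta> = s powr (- \<beta> / \<alpha>)" if "0 < s"
      using that order by (simp_all add: powr_powr)
    moreover have "0 \<le> stable_g \<alpha> f\<^sub>\<alpha> s" using order ad.f_nonneg by (simp add: stable_g_def)
    ultimately show "indicator {0<..} s * ennreal (s powr (- \<beta> / \<alpha>) * stable_g \<alpha> f\<^sub>\<alpha> s / c\<^sub>\<beta>) * F s =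
        F ((s powr (- 1 / \<alpha>)) powr (- \<alpha>)) * ennreal ((s powr (- 1 / \<alpha>)) powr \<beta> / c\<^sub>\<beta>) * ennreal (stable_g \<alpha> f\<^sub>\<alpha> s) * indicator {0<..} s"
      by (auto simp: ennreal_mult''[symmetric] mult.commute[of "F s"] mult.assoc split: split_indicator)
  qed
  also have "\<dots> = (\<integral>\<^sup>+\<omega>. F (a.T \<omega> powr (- \<alpha>)) * ennreal (a.T \<omega> powr \<beta> / c\<^sub>\<beta>) \<partial>M\<^sub>\<alpha>)"
    by (rule ad.nn_integral_T_stable_g[symmetric, of "\<lambda>t. F (t powr (- \<alpha>)) * ennreal (t powr \<beta> / c\<^sub>\<beta>)"]) measurable
  finally show ?thesis .
qed

text \<open>The Bochner integral \<open>c\<^sub>\<beta>\<close> would be 0 if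
  \<open>T powr \<beta>\<close> were not integrable. Division by 0 would then make
  \<open>\<zeta>\<close> the null measure, although it is the law of a mark.\<close>

lemma c\<^sub>\<beta>_pos: "0 < c\<^sub>\<beta>"
proof (rule ccontr)
  interpret z: prob_space \<zeta> by (rule prob_\<zeta>)
  assume "\<not> 0 < c\<^sub>\<beta>"
  then have "c\<^sub>\<beta> = 0" using c\<^sub>\<beta>_nonneg by simp
  then show False using nn_integral_\<zeta>[of "\<lambda>_. 1"] by (simp add: z.emeasure_space_1)
qed

lemma nn_integral_Z:
  assumes [measurable]: "F \<in> borel_measurable borel"
  shows "(\<integral>\<^sup>+\<omega>. F (Z \<omega> k) \<partial>N) = (\<integral>\<^sup>+z. F z \<partial>\<zeta>)"
  unfolding Z_law[of k, symmetric] by (simp add: nn_integral_distr)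

lemma AE_Z_pos: "AE \<omega> in N. \<forall>k. 0 < Z \<omega> k"
proof -
  have "AE \<omega> in N. 0 < Z \<omega> k" for k
  proof -
    have "(\<integral>\<^sup>+\<omega>. indicator {..0} (Z \<omega> k) \<partial>N) = 0"
      using a.AE_T_pos by (subst nn_integral_Z, simp, subst nn_integral_\<zeta>, simp, subst nn_integral_0_iff_AE) (auto elim!: eventually_mono)
    then show ?thesis by (subst (asm) nn_integral_0_iff_AE) (auto simp: indicator_eq_0_iff not_le)
  qed
  then show ?thesis by (simp add: AE_all_countable)
qed

text \<open>For a mark \<open>z = t powr (- \<alpha>)\<close> the substitution
  \<open>y = t * x powr (1 / \<alpha>)\<close> gives \<open>y powr \<alpha> * z = x\<close>. The
  bias \<open>t powr \<beta>\<close> absorbs every power of \<open>t\<close> from the intensity, and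
  what remains is the intensity of index \<open>\<beta> / \<alpha>\<close> in \<open>x\<close>.
  Averaging \<open>exp (- (l * (x powr (1 / \<alpha>) * t)))\<close> over the
  \<open>\<alpha>\<close> mass \<open>t\<close> yields
  \<open>exp (- (l powr \<alpha> * x))\<close>.\<close>

lemma mixed_exponent:
  assumes l: "0 \<le> l" and m: "0 \<le> m"
  shows "(\<integral>\<^sup>+y. \<integral>\<^sup>+z. ennreal (1 - exp (- (l * y + m * (y powr \<alpha> * z)))) \<partial>\<zeta> \<partial>stable_intensity \<beta>) =
    ennreal (Gamma (1 - \<beta> / \<alpha>) / (c\<^sub>\<beta> * Gamma (1 - \<beta>)) * (l powr \<alpha> + m) powr (\<beta> / \<alpha>))"
proof -
  let ?\<delta> = "\<beta> / \<alpha>" and ?\<kappa> = "Gamma (1 - \<beta> / \<alpha>) / (c\<^sub>\<beta> * Gamma (1 - \<beta>))"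
  define E where "E y z = ennreal (1 - exp (- (l * y + m * (y powr \<alpha> * z))))" for y z :: real
  define b where "b y = ennreal (\<beta> / Gamma (1 - \<beta>) * y powr (- \<beta> - 1))" for y
  define d where "d x = ennreal (?\<delta> / Gamma (1 - ?\<delta>) * x powr (- ?\<delta> - 1))" for x
  have [measurable]: "case_prod E \<in> borel_measurable (borel \<Otimes>\<^sub>M borel)"
    unfolding E_def case_prod_beta by measurable
  have [measurable]: "b \<in> borel_measurable borel" "d \<in> borel_measurable borel"
    unfolding b_def[abs_def] d_def[abs_def] by measurable
  have \<kappa>: "0 \<le> ?\<kappa>" using c\<^sub>\<beta>_pos b.Gamma_pos d.Gamma_pos by simp
  interpret z: prob_space \<zeta> by (rule prob_\<zeta>)
  interpret L: pair_sigma_finite M\<^sub>\<alpha> lborel ..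
  have inner: "ennreal (t powr \<beta> / c\<^sub>\<beta>) * (\<integral>\<^sup>+y. E y (t powr (- \<alpha>)) * b y * indicator {0<..} y \<partial>lborel) =
      (\<integral>\<^sup>+x. ennreal ?\<kappa> * (ennreal (1 - exp (- (l * (x powr (1 / \<alpha>) * t) + m * x))) * d x * indicator {0<..} x) \<partial>lborel)"
    if t: "0 < t" for t
  proof -
    have [measurable]: "(\<lambda>y. E y (t powr (- \<alpha>))) \<in> borel_measurable borel" unfolding E_def by measurable
    have "(\<integral>\<^sup>+y. E y (t powr (- \<alpha>)) * b y * indicator {0<..} y \<partial>lborel) =
        ennreal t * (\<integral>\<^sup>+x. E (t * x) (t powr (- \<alpha>)) * b (t * x) * indicator {0<..} x \<partial>lborel)"
      using t by (intro nn_integral_scale_substitution) measurable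
    also have "(\<integral>\<^sup>+x. E (t * x) (t powr (- \<alpha>)) * b (t * x) * indicator {0<..} x \<partial>lborel) =
        (\<integral>\<^sup>+x. E (t * x powr (1 / \<alpha>)) (t powr (- \<alpha>)) * b (t * x powr (1 / \<alpha>)) * ennreal (\<bar>1 / \<alpha>\<bar> * x powr (1 / \<alpha> - 1)) * indicator {0<..} x \<partial>lborel)"
      using order by (intro nn_integral_powr_substitution[of "\<lambda>x. E (t * x) (t powr (- \<alpha>)) * b (t * x)"]) (auto simp: E_def)
    finally have "ennreal (t powr \<beta> / c\<^sub>\<beta>) * (\<integral>\<^sup>+y. E y (t powr (- \<alpha>)) * b y * indicator {0<..} y \<partial>lborel) =
        (\<integral>\<^sup>+x. ennreal (t powr \<beta> / c\<^sub>\<beta>) * (ennreal t * (E (t * x powr (1 / \<alpha>)) (t powr (- \<alpha>)) * b (t * x powr (1 / \<alpha>)) * ennreal (\<bar>1 / \<alpha>\<bar> * x powr (1 / \<alpha> - 1)) * indicator {0<..} x)) \<partial>lborel)"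
      by (simp add: nn_integral_cmult E_def)
    also have "\<dots> = (\<integral>\<^sup>+x. ennreal ?\<kappa> * (ennreal (1 - exp (- (l * (x powr (1 / \<alpha>) * t) + m * x))) * d x * indicator {0<..} x) \<partial>lborel)"
    proof (rule nn_integral_cong)
      fix x :: real
      show "ennreal (t powr \<beta> / c\<^sub>\<beta>) * (ennreal t * (E (t * x powr (1 / \<alpha>)) (t powr (- \<alpha>)) * b (t * x powr (1 / \<alpha>)) * ennreal (\<bar>1 / \<alpha>\<bar> * x powr (1 / \<alpha> - 1)) * indicator {0<..} x)) =
        ennreal ?\<kappa> * (ennreal (1 - exp (- (l * (x powr (1 / \<alpha>) * t) + m * x))) * d x * indicator {0<..} x)"
      proof (cases "0 < x")
        case True
        have "(t * x powr (1 / \<alpha>)) powr \<alpha> * t powr (- \<alpha>) = x"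
          using t True order by (simp add: powr_mult powr_powr powr_minus)
        then have E: "E (t * x powr (1 / \<alpha>)) (t powr (- \<alpha>)) = ennreal (1 - exp (- (l * (x powr (1 / \<alpha>) * t) + m * x)))"
          by (simp add: E_def mult.commute)
        have "t powr \<beta> * (t * t powr (- \<beta> - 1)) = 1"
          using t by (simp add: powr_mult_base powr_add[symmetric])
        moreover have "(x powr (1 / \<alpha>)) powr (- \<beta> - 1) * x powr (1 / \<alpha> - 1) = x powr (- ?\<delta> - 1)"
        proof -
          have "1 / \<alpha> * (- \<beta> - 1) + (1 / \<alpha> - 1) = - ?\<delta> - 1" using order by (simp add: field_simps)
          then show ?thesis by (simp only: powr_powr powr_add[symmetric])
        qed
        ultimately have eq: "t powr \<beta> * (t * ((t * x powr (1 / \<alpha>)) powr (- \<beta> - 1) * x powr (1 / \<alpha> - 1))) = x powr (- ?\<delta> - 1)"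
          using t True by (simp add: powr_mult mult_ac)
        have "t powr \<beta> / c\<^sub>\<beta> * (t * (\<beta> / Gamma (1 - \<beta>) * (t * x powr (1 / \<alpha>)) powr (- \<beta> - 1) * (1 / \<alpha> * x powr (1 / \<alpha> - 1)))) =
            \<beta> / Gamma (1 - \<beta>) / c\<^sub>\<beta> / \<alpha> * (t powr \<beta> * (t * ((t * x powr (1 / \<alpha>)) powr (- \<beta> - 1) * x powr (1 / \<alpha> - 1))))"
          by (simp add: mult_ac)
        also have "\<dots> = ?\<kappa> * (?\<delta> / Gamma (1 - ?\<delta>) * x powr (- ?\<delta> - 1))"
          unfolding eq using d.Gamma_pos by (simp add: field_simps)
        finally have "ennreal (t powr \<beta> / c\<^sub>\<beta>) * (ennreal t * (b (t * x powr (1 / \<alpha>)) * ennreal (\<bar>1 / \<alpha>\<bar> * x powr (1 / \<alpha> - 1)))) =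
            ennreal ?\<kappa> * d x"
          using t True order c\<^sub>\<beta>_pos b.Gamma_pos d.Gamma_pos
          by (simp add: b_def d_def ennreal_mult''[symmetric] less_imp_neq[THEN not_sym])
        note eq = this
        let ?E = "ennreal (1 - exp (- (l * (x powr (1 / \<alpha>) * t) + m * x)))"
        have "ennreal (t powr \<beta> / c\<^sub>\<beta>) * (ennreal t * (?E * b (t * x powr (1 / \<alpha>)) * ennreal (\<bar>1 / \<alpha>\<bar> * x powr (1 / \<alpha> - 1)))) =
            ?E * (ennreal (t powr \<beta> / c\<^sub>\<beta>) * (ennreal t * (b (t * x powr (1 / \<alpha>)) * ennreal (\<bar>1 / \<alpha>\<bar> * x powr (1 / \<alpha> - 1)))))"
          by (simp only: mult_ac)
        also have "\<dots> = ennreal ?\<kappa> * (?E * d x)" unfolding eq by (rule mult.left_commute)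
        finally show ?thesis using True
          by (simp only: E indicator_simps(1) greaterThan_iff mult_1_right)
      qed simp
    qed
    finally show ?thesis .
  qed
  have "(\<integral>\<^sup>+y. \<integral>\<^sup>+z. E y z \<partial>\<zeta> \<partial>stable_intensity \<beta>) =
      (\<integral>\<^sup>+y. (\<integral>\<^sup>+\<omega>. E y (a.T \<omega> powr (- \<alpha>)) * ennreal (a.T \<omega> powr \<beta> / c\<^sub>\<beta>) \<partial>M\<^sub>\<alpha>) * b y * indicator {0<..} y \<partial>lborel)"
    unfolding b_def by (subst nn_integral_stable_intensity) (measurable, simp add: nn_integral_\<zeta>)
  also have "\<dots> = (\<integral>\<^sup>+y. (\<integral>\<^sup>+\<omega>. ennreal (a.T \<omega> powr \<beta> / c\<^sub>\<beta>) * (E y (a.T \<omega> powr (- \<alpha>)) * b y * indicator {0<..} y) \<partial>M\<^sub>\<alpha>) \<partial>lborel)"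
  proof (rule nn_integral_cong)
    fix y
    have [measurable]: "E y \<in> borel_measurable borel" unfolding E_def[abs_def] by measurable
    have "(\<integral>\<^sup>+\<omega>. E y (a.T \<omega> powr (- \<alpha>)) * ennreal (a.T \<omega> powr \<beta> / c\<^sub>\<beta>) \<partial>M\<^sub>\<alpha>) * (b y * indicator {0<..} y) =
        (\<integral>\<^sup>+\<omega>. E y (a.T \<omega> powr (- \<alpha>)) * ennreal (a.T \<omega> powr \<beta> / c\<^sub>\<beta>) * (b y * indicator {0<..} y) \<partial>M\<^sub>\<alpha>)"
      by (rule nn_integral_multc[symmetric]) measurable
    then show "(\<integral>\<^sup>+\<omega>. E y (a.T \<omega> powr (- \<alpha>)) * ennreal (a.T \<omega> powr \<beta> / c\<^sub>\<beta>) \<partial>M\<^sub>\<alpha>) * b y * indicator {0<..} y =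
        (\<integral>\<^sup>+\<omega>. ennreal (a.T \<omega> powr \<beta> / c\<^sub>\<beta>) * (E y (a.T \<omega> powr (- \<alpha>)) * b y * indicator {0<..} y) \<partial>M\<^sub>\<alpha>)"
      by (simp only: mult_ac)
  qed
  also have "\<dots> = (\<integral>\<^sup>+\<omega>. (\<integral>\<^sup>+y. ennreal (a.T \<omega> powr \<beta> / c\<^sub>\<beta>) * (E y (a.T \<omega> powr (- \<alpha>)) * b y * indicator {0<..} y) \<partial>lborel) \<partial>M\<^sub>\<alpha>)"
    by (rule L.Fubini') measurable
  also have "\<dots> = (\<integral>\<^sup>+\<omega>. (\<integral>\<^sup>+x. ennreal ?\<kappa> * (ennreal (1 - exp (- (l * (x powr (1 / \<alpha>) * a.T \<omega>) + m * x))) * d x * indicator {0<..} x) \<partial>lborel) \<partial>M\<^sub>\<alpha>)"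
    using a.AE_T_pos
  proof (intro nn_integral_cong_AE, eventually_elim)
    case (elim \<omega>)
    show ?case unfolding inner[OF elim(2), symmetric] by (rule nn_integral_cmult) measurable
  qed
  also have "\<dots> = (\<integral>\<^sup>+x. (\<integral>\<^sup>+\<omega>. ennreal ?\<kappa> * (ennreal (1 - exp (- (l * (x powr (1 / \<alpha>) * a.T \<omega>) + m * x))) * d x * indicator {0<..} x) \<partial>M\<^sub>\<alpha>) \<partial>lborel)"
    by (rule L.Fubini'[symmetric]) measurable
  also have "\<dots> = (\<integral>\<^sup>+x. ennreal ?\<kappa> * (ennreal (1 - exp (- ((l powr \<alpha> + m) * x))) * d x * indicator {0<..} x) \<partial>lborel)"
  proof (rule nn_integral_cong)
    fix x :: real
    have lap: "(\<integral>\<^sup>+\<omega>. ennreal (1 - exp (- (l * (x powr (1 / \<alpha>) * a.T \<omega>) + m * x))) \<partial>M\<^sub>\<alpha>) = ennreal (1 - exp (- ((l powr \<alpha> + m) * x)))"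
      if x: "0 < x"
    proof -
      have int: "(\<integral>\<^sup>+\<omega>. ennreal (exp (- (l * (x powr (1 / \<alpha>) * a.T \<omega>) + m * x))) \<partial>M\<^sub>\<alpha>) = ennreal (exp (- ((l powr \<alpha> + m) * x)))"
      proof -
        have "(\<integral>\<^sup>+\<omega>. ennreal (exp (- (l * (x powr (1 / \<alpha>) * a.T \<omega>) + m * x))) \<partial>M\<^sub>\<alpha>) =
            (\<integral>\<^sup>+\<omega>. ennreal (exp (- (m * x))) * ennreal (exp (- ((l * x powr (1 / \<alpha>)) * a.T \<omega>))) \<partial>M\<^sub>\<alpha>)"
          by (simp add: ennreal_mult''[symmetric] exp_add[symmetric] mult_ac add.commute)
        also have "\<dots> = ennreal (exp (- (m * x))) * ennreal (exp (- ((l * x powr (1 / \<alpha>)) powr \<alpha>)))"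
          using l by (simp add: nn_integral_cmult a.Laplace_T)
        also have "(l * x powr (1 / \<alpha>)) powr \<alpha> = l powr \<alpha> * x"
          using l x order by (simp add: powr_mult powr_powr)
        finally show ?thesis by (simp add: ennreal_mult''[symmetric] exp_add[symmetric] algebra_simps)
      qed
      have "(\<integral>\<^sup>+\<omega>. ennreal (1 - exp (- (l * (x powr (1 / \<alpha>) * a.T \<omega>) + m * x))) \<partial>M\<^sub>\<alpha>) =
          (\<integral>\<^sup>+\<omega>. 1 - ennreal (exp (- (l * (x powr (1 / \<alpha>) * a.T \<omega>) + m * x))) \<partial>M\<^sub>\<alpha>)"
        by (simp add: ennreal_minus[symmetric])
      also have "\<dots> = (\<integral>\<^sup>+\<omega>. 1 \<partial>M\<^sub>\<alpha>) - (\<integral>\<^sup>+\<omega>. ennreal (exp (- (l * (x powr (1 / \<alpha>) * a.T \<omega>) + m * x))) \<partial>M\<^sub>\<alpha>)"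
      proof (intro nn_integral_diff)
        show "AE \<omega> in M\<^sub>\<alpha>. ennreal (exp (- (l * (x powr (1 / \<alpha>) * a.T \<omega>) + m * x))) \<le> 1"
          using a.AE_T_pos
        proof eventually_elim
          case (elim \<omega>)
          then have "0 \<le> l * (x powr (1 / \<alpha>) * a.T \<omega>) + m * x"
            using l m x by (intro add_nonneg_nonneg mult_nonneg_nonneg) auto
          then show ?case by simp
        qed
      qed (use int in auto)
      finally show ?thesis unfolding int by (simp add: a.emeasure_space_1 ennreal_minus[symmetric])
    qed
    show "(\<integral>\<^sup>+\<omega>. ennreal ?\<kappa> * (ennreal (1 - exp (- (l * (x powr (1 / \<alpha>) * a.T \<omega>) + m * x))) * d x * indicator {0<..} x) \<partial>M\<^sub>\<alpha>) =
      ennreal ?\<kappa> * (ennreal (1 - exp (- ((l powr \<alpha> + m) * x))) * d x * indicator {0<..} x)"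
      by (cases "0 < x") (simp_all add: nn_integral_cmult nn_integral_multc lap del: minus_add_distrib)
  qed
  also have "\<dots> = ennreal ?\<kappa> * (\<integral>\<^sup>+x. ennreal (1 - exp (- ((l powr \<alpha> + m) * x))) \<partial>stable_intensity ?\<delta>)"
    by (subst nn_integral_cmult, measurable, subst nn_integral_stable_intensity) (measurable, simp add: d_def)
  also have "\<dots> = ennreal (?\<kappa> * (l powr \<alpha> + m) powr ?\<delta>)"
    using m by (subst stable_intensity_Laplace[OF d.g]) (auto intro!: ennreal_mult'[symmetric] \<kappa> simp del: times_divide_eq_left)
  finally show ?thesis unfolding E_def .
qed

text \<open>At \<open>l = 1\<close> and \<open>m = 0\<close> the marks drop out and the exponent is
  the plain \<open>\<beta>\<close>-stable one, whose value is 1. This evaluates the moment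
  \<open>c\<^sub>\<beta>\<close>.\<close>

lemma mixed_constant: "Gamma (1 - \<beta> / \<alpha>) / (c\<^sub>\<beta> * Gamma (1 - \<beta>)) = 1"
proof -
  interpret z: prob_space \<zeta> by (rule prob_\<zeta>)
  have "(\<integral>\<^sup>+y. \<integral>\<^sup>+z. ennreal (1 - exp (- (1 * y + 0 * (y powr \<alpha> * z)))) \<partial>\<zeta> \<partial>stable_intensity \<beta>) = ennreal (1 powr \<beta>)"
    using stable_intensity_Laplace[OF b.g, of 1] by (simp add: z.emeasure_space_1)
  from trans[OF mixed_exponent[of 1 0, OF zero_le_one order_refl, symmetric] this]
  have "ennreal (Gamma (1 - \<beta> / \<alpha>) / (c\<^sub>\<beta> * Gamma (1 - \<beta>))) = ennreal 1"
    using d.Gamma_pos[THEN less_imp_neq, THEN not_sym] by simp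
  then show ?thesis
    using c\<^sub>\<beta>_pos b.Gamma_pos d.Gamma_pos by (subst (asm) ennreal_inj) auto
qed

end

context mittag_leffler_mixture
begin

lemma AE_\<zeta>_pos: "AE z in \<zeta>. 0 < z"
proof -
  have "AE \<omega> in N. 0 < Z \<omega> 0" using AE_Z_pos by eventually_elim simp
  then show ?thesis unfolding Z_law[of 0, symmetric] by (subst AE_distr_iff) auto
qed

text \<open>The factor that a point of size \<open>y\<close> contributes to the joint transform of
  mass and marked sum once its mark has been averaged out.\<close>

definition mixed :: "real \<Rightarrow> real \<Rightarrow> real \<Rightarrow> real" where
  "mixed l m y = enn2real (\<integral>\<^sup>+z. ennreal (exp (- (l * y + m * (y powr \<alpha> * z)))) \<partial>\<zeta>)"

lemma mixed_measurable [measurable]: "mixed l m \<in> borel_measurable borel"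
proof -
  interpret z: prob_space \<zeta> by (rule prob_\<zeta>)
  show ?thesis unfolding mixed_def[abs_def] by measurable
qed

lemma mixed:
  assumes l: "0 \<le> l" and m: "0 \<le> m" and y: "0 < y"
  shows "0 \<le> mixed l m y" "mixed l m y \<le> 1"
    and "(\<integral>\<^sup>+z. ennreal (exp (- (l * y + m * (y powr \<alpha> * z)))) \<partial>\<zeta>) = ennreal (mixed l m y)"
    and "(\<integral>\<^sup>+z. ennreal (1 - exp (- (l * y + m * (y powr \<alpha> * z)))) \<partial>\<zeta>) = ennreal (1 - mixed l m y)"
  supply minus_add_distrib [simp del]
proof -
  interpret z: prob_space \<zeta> by (rule prob_\<zeta>)
  let ?I = "\<integral>\<^sup>+z. ennreal (exp (- (l * y + m * (y powr \<alpha> * z)))) \<partial>\<zeta>"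
  have le1: "AE z in \<zeta>. ennreal (exp (- (l * y + m * (y powr \<alpha> * z)))) \<le> 1"
    using AE_\<zeta>_pos
  proof eventually_elim
    case (elim z)
    then have "0 \<le> l * y + m * (y powr \<alpha> * z)" using l m y by (intro add_nonneg_nonneg mult_nonneg_nonneg) auto
    then show ?case by simp
  qed
  have "?I \<le> (\<integral>\<^sup>+z. 1 \<partial>\<zeta>)" using le1 by (rule nn_integral_mono_AE)
  then have I: "?I \<le> 1" by (simp add: z.emeasure_space_1)
  then have "?I < \<infinity>" by (rule le_less_trans) simp
  then show eq: "?I = ennreal (mixed l m y)" by (simp add: mixed_def)
  show "0 \<le> mixed l m y" by (simp add: mixed_def)
  show le: "mixed l m y \<le> 1" using I unfolding eq by simp
  have "(\<integral>\<^sup>+z. ennreal (1 - exp (- (l * y + m * (y powr \<alpha> * z)))) \<partial>\<zeta>) =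
      (\<integral>\<^sup>+z. 1 - ennreal (exp (- (l * y + m * (y powr \<alpha> * z)))) \<partial>\<zeta>)"
    by (simp add: ennreal_minus[symmetric])
  also have "\<dots> = (\<integral>\<^sup>+z. 1 \<partial>\<zeta>) - ?I"
    by (intro nn_integral_diff le1) (auto simp: eq)
  finally show "(\<integral>\<^sup>+z. ennreal (1 - exp (- (l * y + m * (y powr \<alpha> * z)))) \<partial>\<zeta>) = ennreal (1 - mixed l m y)"
    unfolding eq by (simp add: z.emeasure_space_1 ennreal_minus[symmetric] mixed_def)
qed

lemma mixed_intensity:
  assumes l: "0 \<le> l" and m: "0 \<le> m"
  shows "(\<integral>\<^sup>+y. ennreal (1 - mixed l m y) \<partial>stable_intensity \<beta>) = ennreal ((l powr \<alpha> + m) powr (\<beta> / \<alpha>))"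
  supply minus_add_distrib [simp del]
proof -
  interpret z: prob_space \<zeta> by (rule prob_\<zeta>)
  have "(\<integral>\<^sup>+y. ennreal (1 - mixed l m y) \<partial>stable_intensity \<beta>) =
      (\<integral>\<^sup>+y. \<integral>\<^sup>+z. ennreal (1 - exp (- (l * y + m * (y powr \<alpha> * z)))) \<partial>\<zeta> \<partial>stable_intensity \<beta>)"
    by (subst (1 2) nn_integral_stable_intensity)
       (auto intro!: nn_integral_cong simp: mixed(4)[OF l m] split: split_indicator)
  then show ?thesis
    using mixed_exponent[OF l m] by (simp only: mixed_constant mult_1)
qed

abbreviation "L \<omega> \<omega>' \<equiv> \<Sum>i. J\<^sub>\<beta> \<omega> i powr \<alpha> * Z \<omega>' i"

text \<open>Averaging the independent marks first replaces each factor by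
  \<open>mixed l m (J\<^sub>\<beta> \<omega> i)\<close>, a function of the point alone, to which the
  Poisson formula applies. The product form avoids the marked sum, whose convergence is not
  established at this stage.\<close>

lemma joint_Laplace_product:
  assumes l: "0 \<le> l" and m: "0 \<le> m"
  shows "(\<integral>\<^sup>+\<omega>. \<integral>\<^sup>+\<omega>'. (INF n. \<Prod>i<n. ennreal (exp (- (l * J\<^sub>\<beta> \<omega> i + m * (J\<^sub>\<beta> \<omega> i powr \<alpha> * Z \<omega>' i))))) \<partial>N \<partial>M\<^sub>\<beta>) =
    ennreal (exp (- ((l powr \<alpha> + m) powr (\<beta> / \<alpha>))))"
  supply minus_add_distrib [simp del]
proof -
  have "(\<integral>\<^sup>+\<omega>. \<integral>\<^sup>+\<omega>'. (INF n. \<Prod>i<n. ennreal (exp (- (l * J\<^sub>\<beta> \<omega> i + m * (J\<^sub>\<beta> \<omega> i powr \<alpha> * Z \<omega>' i))))) \<partial>N \<partial>M\<^sub>\<beta>) =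
      (\<integral>\<^sup>+\<omega>. (INF n. \<Prod>i<n. ennreal (mixed l m (J\<^sub>\<beta> \<omega> i))) \<partial>M\<^sub>\<beta>)"
    using b.AE_points
  proof (intro nn_integral_cong_AE, eventually_elim)
    case (elim \<omega>)
    then have J: "0 < J\<^sub>\<beta> \<omega> i" for i by simp
    let ?e = "\<lambda>i z. ennreal (exp (- (l * J\<^sub>\<beta> \<omega> i + m * (J\<^sub>\<beta> \<omega> i powr \<alpha> * z))))"
    have prod: "(\<integral>\<^sup>+\<omega>'. (\<Prod>i<n. ?e i (Z \<omega>' i)) \<partial>N) = (\<Prod>i<n. ennreal (mixed l m (J\<^sub>\<beta> \<omega> i)))" for n
    proof -
      have "n.indep_vars (\<lambda>_. borel) (\<lambda>i \<omega>'. ?e i (Z \<omega>' i)) {..<n}"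
        by (rule n.indep_vars_compose2[OF n.indep_vars_subset[OF Z_indep]]) auto
      then have "(\<integral>\<^sup>+\<omega>'. (\<Prod>i<n. ?e i (Z \<omega>' i)) \<partial>N) = (\<Prod>i<n. \<integral>\<^sup>+\<omega>'. ?e i (Z \<omega>' i) \<partial>N)"
        by (intro n.indep_vars_nn_integral) auto
      then show ?thesis
        by (simp add: nn_integral_Z[of "?e _"] mixed(3)[OF l m J])
    qed
    have "(\<integral>\<^sup>+\<omega>'. (INF n. \<Prod>i<n. ?e i (Z \<omega>' i)) \<partial>N) = (INF n. \<integral>\<^sup>+\<omega>'. (\<Prod>i<n. ?e i (Z \<omega>' i)) \<partial>N)"
    proof (rule nn_integral_monotone_convergence_INF_AE[where i=0])
      show "AE \<omega>' in N. (\<Prod>i<Suc n. ?e i (Z \<omega>' i)) \<le> (\<Prod>i<n. ?e i (Z \<omega>' i))" for n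
        using AE_Z_pos
      proof eventually_elim
        case (elim \<omega>')
        have "?e n (Z \<omega>' n) \<le> 1" using elim J[of n] l m by (simp add: less_imp_le)
        from mult_left_mono[OF this, of "\<Prod>i<n. ?e i (Z \<omega>' i)"] show ?case by simp
      qed
    qed (auto simp: n.emeasure_space_1)
    then show "(\<integral>\<^sup>+\<omega>'. (INF n. \<Prod>i<n. ?e i (Z \<omega>' i)) \<partial>N) = (INF n. \<Prod>i<n. ennreal (mixed l m (J\<^sub>\<beta> \<omega> i)))"
      by (simp only: prod)
  qed
  also have "\<dots> = ennreal (exp (- ((l powr \<alpha> + m) powr (\<beta> / \<alpha>))))"
    by (intro b.Laplace_functional_stable mixed_intensity mixed l m) auto
  finally show ?thesis .
qed

text \<open>Where the marked series diverges, the product vanishes for every \<open>m > 0\<close>.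
  At \<open>l = 0\<close> the probability \<open>p\<close> of a finite sum is therefore at least
  \<open>exp (- (m powr (\<beta> / \<alpha>)))\<close>, which tends to 1 as \<open>m\<close>
  decreases to 0.\<close>

lemma AE_mixture_summable:
  "AE \<omega> in M\<^sub>\<beta>. AE \<omega>' in N. (\<forall>k. 0 < Z \<omega>' k) \<and> summable (\<lambda>i. J\<^sub>\<beta> \<omega> i powr \<alpha> * Z \<omega>' i)"
  supply minus_add_distrib [simp del]
proof -
  interpret pair_sigma_finite M\<^sub>\<beta> N ..
  define R where "R \<omega> \<omega>' = (\<Sum>i. ennreal (J\<^sub>\<beta> \<omega> i powr \<alpha> * Z \<omega>' i))" for \<omega> \<omega>'
  have [measurable]: "case_prod R \<in> borel_measurable (M\<^sub>\<beta> \<Otimes>\<^sub>M N)"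
    unfolding R_def case_prod_beta by measurable
  define p where "p = (\<integral>\<^sup>+\<omega>. \<integral>\<^sup>+\<omega>'. indicator {..<top} (R \<omega> \<omega>') \<partial>N \<partial>M\<^sub>\<beta>)"
  have bound: "ennreal (exp (- ((l powr \<alpha> + m) powr (\<beta> / \<alpha>)))) \<le> p" if l: "0 \<le> l" and m: "0 < m" for l m
    unfolding joint_Laplace_product[OF l less_imp_le[OF m], symmetric] p_def
  proof (rule nn_integral_mono_AE)
    show "AE \<omega> in M\<^sub>\<beta>. (\<integral>\<^sup>+\<omega>'. (INF n. \<Prod>i<n. ennreal (exp (- (l * J\<^sub>\<beta> \<omega> i + m * (J\<^sub>\<beta> \<omega> i powr \<alpha> * Z \<omega>' i))))) \<partial>N) \<le>
        (\<integral>\<^sup>+\<omega>'. indicator {..<top} (R \<omega> \<omega>') \<partial>N)"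
      using b.AE_points
    proof eventually_elim
      case \<omega>: (elim \<omega>)
      show ?case
      proof (rule nn_integral_mono_AE)
        show "AE \<omega>' in N. (INF n. \<Prod>i<n. ennreal (exp (- (l * J\<^sub>\<beta> \<omega> i + m * (J\<^sub>\<beta> \<omega> i powr \<alpha> * Z \<omega>' i))))) \<le> indicator {..<top} (R \<omega> \<omega>')"
          using AE_Z_pos
        proof eventually_elim
          case (elim \<omega>')
          let ?a = "\<lambda>i. J\<^sub>\<beta> \<omega> i powr \<alpha> * Z \<omega>' i"
          let ?P = "\<lambda>n. \<Prod>i<n. ennreal (exp (- (l * J\<^sub>\<beta> \<omega> i + m * ?a i)))"
          have a0: "0 \<le> ?a i" for i using elim by (simp add: less_imp_le)
          have P: "?P n = ennreal (exp (- (l * (\<Sum>i<n. J\<^sub>\<beta> \<omega> i) + m * (\<Sum>i<n. ?a i))))" for n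
            by (simp add: prod_ennreal exp_sum[symmetric] sum_negf sum.distrib sum_distrib_left)
          show ?case
          proof (cases "R \<omega> \<omega>' < top")
            case True
            have "(INF n. ?P n) \<le> ?P 0" by (rule INF_lower) simp
            then show ?thesis using True by simp
          next
            case False
            have nsum: "\<not> summable ?a"
            proof
              assume "summable ?a"
              then have "R \<omega> \<omega>' = ennreal (\<Sum>i. ?a i)" unfolding R_def using a0 by (intro suminf_ennreal2) auto
              then show False using False by simp
            qed
            have "(INF n. ?P n) \<le> 0"
            proof (rule ennreal_le_epsilon)
              fix e :: real assume e: "0 < e"
              \<comment> \<open>Once the partial sum passes \<open>- ln e / m\<close>, its
                exponential factor alone pushes the product below \<open>e\<close>.\<close>
              have "\<exists>n. - ln e / m < (\<Sum>i<n. ?a i)"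
              proof (rule ccontr)
                assume "\<nexists>n. - ln e / m < (\<Sum>i<n. ?a i)"
                then have "summable ?a" by (intro summableI_nonneg_bounded[where x="- ln e / m"] a0) (auto simp: not_less)
                with nsum show False by simp
              qed
              then obtain n where "- ln e / m < (\<Sum>i<n. ?a i)" by blast
              then have "- ln e \<le> m * (\<Sum>i<n. ?a i)" using m by (simp add: field_simps)
              moreover have "0 \<le> l * (\<Sum>i<n. J\<^sub>\<beta> \<omega> i)" using \<omega> l by (intro mult_nonneg_nonneg sum_nonneg) (auto intro: less_imp_le)
              ultimately have "exp (- (l * (\<Sum>i<n. J\<^sub>\<beta> \<omega> i) + m * (\<Sum>i<n. ?a i))) \<le> exp (ln e)"
                unfolding exp_le_cancel_iff by linarith
              then have "?P n \<le> ennreal e" unfolding P using e by (intro ennreal_leI) simp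
              then show "(INF n. ?P n) \<le> 0 + ennreal e" by (intro INF_lower2[of n]) auto
            qed
            then show ?thesis by (rule order_trans) simp
          qed
        qed
      qed
    qed
  qed
  have p1: "p \<le> 1"
  proof -
    have "p \<le> (\<integral>\<^sup>+\<omega>. \<integral>\<^sup>+\<omega>'. 1 \<partial>N \<partial>M\<^sub>\<beta>)"
      unfolding p_def by (intro nn_integral_mono) (auto split: split_indicator)
    then show ?thesis by (simp add: n.emeasure_space_1 b.emeasure_space_1)
  qed
  have "(\<lambda>k. ennreal (exp (- ((0 powr \<alpha> + 1 / real (Suc k)) powr (\<beta> / \<alpha>))))) \<longlonglongrightarrow> ennreal (exp (- ((0 powr \<alpha> + 0) powr (\<beta> / \<alpha>))))"
    using order d.g LIMSEQ_inverse_real_of_nat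
    by (intro tendsto_ennrealI tendsto_exp tendsto_minus tendsto_powr' tendsto_add tendsto_const)
       (auto simp: inverse_eq_divide)
  then have "1 \<le> p"
    using bound[of 0 "1 / real (Suc k)" for k] d.g by (intro LIMSEQ_le_const2[of _ 1]) auto
  with p1 have "p = 1" by simp
  have "(\<integral>\<^sup>+\<omega>. \<integral>\<^sup>+\<omega>'. indicator {top} (R \<omega> \<omega>') \<partial>N \<partial>M\<^sub>\<beta>) + p = 1"
  proof -
    have "(\<integral>\<^sup>+\<omega>. \<integral>\<^sup>+\<omega>'. indicator {top} (R \<omega> \<omega>') \<partial>N \<partial>M\<^sub>\<beta>) + p =
        (\<integral>\<^sup>+\<omega>. \<integral>\<^sup>+\<omega>'. indicator {top} (R \<omega> \<omega>') + indicator {..<top} (R \<omega> \<omega>') \<partial>N \<partial>M\<^sub>\<beta>)"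
    proof -
      have "(\<integral>\<^sup>+\<omega>. \<integral>\<^sup>+\<omega>'. indicator {top} (R \<omega> \<omega>') \<partial>N \<partial>M\<^sub>\<beta>) + p =
          (\<integral>\<^sup>+\<omega>. (\<integral>\<^sup>+\<omega>'. indicator {top} (R \<omega> \<omega>') \<partial>N) + (\<integral>\<^sup>+\<omega>'. indicator {..<top} (R \<omega> \<omega>') \<partial>N) \<partial>M\<^sub>\<beta>)"
        unfolding p_def by (rule nn_integral_add[symmetric]) measurable
      also have "\<dots> = (\<integral>\<^sup>+\<omega>. \<integral>\<^sup>+\<omega>'. indicator {top} (R \<omega> \<omega>') + indicator {..<top} (R \<omega> \<omega>') \<partial>N \<partial>M\<^sub>\<beta>)"
        by (intro nn_integral_cong, rule nn_integral_add[symmetric]) measurable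
      finally show ?thesis .
    qed
    also have "\<dots> = (\<integral>\<^sup>+\<omega>. \<integral>\<^sup>+\<omega>'. 1 \<partial>N \<partial>M\<^sub>\<beta>)"
      by (intro nn_integral_cong) (auto simp: less_top split: split_indicator)
    finally show ?thesis by (simp add: n.emeasure_space_1 b.emeasure_space_1)
  qed
  then have "(\<integral>\<^sup>+\<omega>. \<integral>\<^sup>+\<omega>'. indicator {top} (R \<omega> \<omega>') \<partial>N \<partial>M\<^sub>\<beta>) = 0"
    using ennreal_add_diff_cancel_right[of 1 "\<integral>\<^sup>+\<omega>. \<integral>\<^sup>+\<omega>'. indicator {top} (R \<omega> \<omega>') \<partial>N \<partial>M\<^sub>\<beta>"] \<open>p = 1\<close> by simp
  moreover have "(\<lambda>\<omega>. \<integral>\<^sup>+\<omega>'. indicator {top} (R \<omega> \<omega>') \<partial>N) \<in> borel_measurable M\<^sub>\<beta>"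
    by measurable
  ultimately have "AE \<omega> in M\<^sub>\<beta>. (\<integral>\<^sup>+\<omega>'. indicator {top} (R \<omega> \<omega>') \<partial>N) = 0"
    by (simp only: nn_integral_0_iff_AE)
  then show ?thesis using b.AE_points AE_space
  proof eventually_elim
    case (elim \<omega>)
    have "(\<lambda>\<omega>'. indicator {top} (R \<omega> \<omega>') :: ennreal) \<in> borel_measurable N"
      using elim(3) by measurable
    then have "AE \<omega>' in N. indicator {top} (R \<omega> \<omega>') = (0 :: ennreal)"
      using elim(1) by (simp add: nn_integral_0_iff_AE)
    then show ?case using AE_Z_pos
    proof eventually_elim
      case (elim \<omega>')
      then have R: "R \<omega> \<omega>' \<noteq> top" by (auto split: split_indicator_asm)
      have "0 \<le> J\<^sub>\<beta> \<omega> i powr \<alpha> * Z \<omega>' i" for i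
        by (rule mult_nonneg_nonneg[OF powr_ge_zero less_imp_le[OF spec[OF elim(2)]]])
      then have "summable (\<lambda>i. J\<^sub>\<beta> \<omega> i powr \<alpha> * Z \<omega>' i)"
        using R unfolding R_def by (rule summable_suminf_not_top)
      then show ?case using elim by simp
    qed
  qed
qed

lemma joint_Laplace:
  assumes l: "0 < l" and m: "0 < m"
  shows "(\<integral>\<^sup>+\<omega>. \<integral>\<^sup>+\<omega>'. ennreal (exp (- (l * b.T \<omega> + m * L \<omega> \<omega>'))) \<partial>N \<partial>M\<^sub>\<beta>) =
    ennreal (exp (- ((l powr \<alpha> + m) powr (\<beta> / \<alpha>))))"
  supply minus_add_distrib [simp del]
  unfolding joint_Laplace_product[OF less_imp_le[OF l] less_imp_le[OF m], symmetric]
proof (rule nn_integral_cong_AE)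
  show "AE \<omega> in M\<^sub>\<beta>. (\<integral>\<^sup>+\<omega>'. ennreal (exp (- (l * b.T \<omega> + m * L \<omega> \<omega>'))) \<partial>N) =
    (\<integral>\<^sup>+\<omega>'. (INF n. \<Prod>i<n. ennreal (exp (- (l * J\<^sub>\<beta> \<omega> i + m * (J\<^sub>\<beta> \<omega> i powr \<alpha> * Z \<omega>' i))))) \<partial>N)"
    using b.AE_points AE_mixture_summable
  proof eventually_elim
    case \<omega>: (elim \<omega>)
    show ?case
    proof (rule nn_integral_cong_AE)
      show "AE \<omega>' in N. ennreal (exp (- (l * b.T \<omega> + m * L \<omega> \<omega>'))) =
        (INF n. \<Prod>i<n. ennreal (exp (- (l * J\<^sub>\<beta> \<omega> i + m * (J\<^sub>\<beta> \<omega> i powr \<alpha> * Z \<omega>' i)))))"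
        using \<omega>(2)
      proof eventually_elim
        case (elim \<omega>')
        show ?case
        proof (rule INF_eq_limit[symmetric])
          have "0 \<le> l * J\<^sub>\<beta> \<omega> i + m * (J\<^sub>\<beta> \<omega> i powr \<alpha> * Z \<omega>' i)" for i
            using \<omega>(1) elim l m by (intro add_nonneg_nonneg mult_nonneg_nonneg) (auto intro: less_imp_le)
          then show "decseq (\<lambda>n. \<Prod>i<n. ennreal (exp (- (l * J\<^sub>\<beta> \<omega> i + m * (J\<^sub>\<beta> \<omega> i powr \<alpha> * Z \<omega>' i)))))"
            by (intro decseq_prod_le_1) simp
          have "(\<lambda>n. \<Sum>i<n. l * J\<^sub>\<beta> \<omega> i + m * (J\<^sub>\<beta> \<omega> i powr \<alpha> * Z \<omega>' i)) \<longlonglongrightarrow> l * b.T \<omega> + m * L \<omega> \<omega>'"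
            unfolding total_mass_def sums_def[symmetric] using \<omega>(1) elim
            by (intro sums_add sums_mult summable_sums) auto
          then have "(\<lambda>n. ennreal (exp (- (\<Sum>i<n. l * J\<^sub>\<beta> \<omega> i + m * (J\<^sub>\<beta> \<omega> i powr \<alpha> * Z \<omega>' i))))) \<longlonglongrightarrow> ennreal (exp (- (l * b.T \<omega> + m * L \<omega> \<omega>')))"
            by (intro tendsto_ennrealI tendsto_exp tendsto_minus)
          then show "(\<lambda>n. \<Prod>i<n. ennreal (exp (- (l * J\<^sub>\<beta> \<omega> i + m * (J\<^sub>\<beta> \<omega> i powr \<alpha> * Z \<omega>' i))))) \<longlonglongrightarrow> ennreal (exp (- (l * b.T \<omega> + m * L \<omega> \<omega>')))"
            by (simp add: prod_ennreal exp_sum[symmetric] sum_negf del: minus_add_distrib)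
        qed
      qed
    qed
  qed
qed

text \<open>The stable subordinator of index \<open>\<beta>\<close> is the one of index \<open>\<alpha>\<close> evaluated at the one of index
  \<open>\<beta> / \<alpha>\<close>; \<open>L\<close> plays the role of the latter.\<close>

theorem joint_law:
  assumes [measurable]: "H \<in> borel_measurable (borel \<Otimes>\<^sub>M borel)"
  shows "(\<integral>\<^sup>+\<omega>. \<integral>\<^sup>+\<omega>'. H (b.T \<omega>, L \<omega> \<omega>') \<partial>N \<partial>M\<^sub>\<beta>) =
    (\<integral>\<^sup>+y. \<integral>\<^sup>+x. H (a.T x * d.T y powr (1 / \<alpha>), d.T y) \<partial>M\<^sub>\<alpha> \<partial>M\<^sub>\<delta>)"
  supply minus_add_distrib [simp del]
proof -
  have meas [measurable]: "(\<lambda>z. L (fst z) (snd z)) \<in> borel_measurable (M\<^sub>\<beta> \<Otimes>\<^sub>M N)"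
      "(\<lambda>z. b.T (fst z)) \<in> borel_measurable (M\<^sub>\<beta> \<Otimes>\<^sub>M N)"
      "(\<lambda>z. a.T (snd z) * d.T (fst z) powr (1 / \<alpha>)) \<in> borel_measurable (M\<^sub>\<delta> \<Otimes>\<^sub>M M\<^sub>\<alpha>)"
      "(\<lambda>z. d.T (fst z)) \<in> borel_measurable (M\<^sub>\<delta> \<Otimes>\<^sub>M M\<^sub>\<alpha>)"
    by measurable
  have exp_meas: "(\<lambda>z. ennreal (exp (- (l * b.T (fst z) + m * L (fst z) (snd z))))) \<in> borel_measurable (M\<^sub>\<beta> \<Otimes>\<^sub>M N)"
      "(\<lambda>z. ennreal (exp (- (l * (a.T (snd z) * d.T (fst z) powr (1 / \<alpha>)) + m * d.T (fst z))))) \<in> borel_measurable (M\<^sub>\<delta> \<Otimes>\<^sub>M M\<^sub>\<alpha>)" for l m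
    by measurable
  have H_meas: "(\<lambda>z. H (b.T (fst z), L (fst z) (snd z))) \<in> borel_measurable (M\<^sub>\<beta> \<Otimes>\<^sub>M N)"
      "(\<lambda>z. H (a.T (snd z) * d.T (fst z) powr (1 / \<alpha>), d.T (fst z))) \<in> borel_measurable (M\<^sub>\<delta> \<Otimes>\<^sub>M M\<^sub>\<alpha>)"
    by measurable
  interpret bn: pair_prob_space M\<^sub>\<beta> N ..
  interpret da: pair_prob_space M\<^sub>\<delta> M\<^sub>\<alpha> ..
  have "(\<integral>\<^sup>+z. H (b.T (fst z), L (fst z) (snd z)) \<partial>(M\<^sub>\<beta> \<Otimes>\<^sub>M N)) =
     (\<integral>\<^sup>+z. H (a.T (snd z) * d.T (fst z) powr (1 / \<alpha>), d.T (fst z)) \<partial>(M\<^sub>\<delta> \<Otimes>\<^sub>M M\<^sub>\<alpha>))"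
  proof (rule nn_integral_Laplace_unique_2d)
    show "AE z in M\<^sub>\<beta> \<Otimes>\<^sub>M N. 0 < b.T (fst z) \<and> 0 < L (fst z) (snd z)"
    proof (rule bn.AE_pair_measure)
      show "AE \<omega> in M\<^sub>\<beta>. AE \<omega>' in N. 0 < b.T (fst (\<omega>, \<omega>')) \<and> 0 < L (fst (\<omega>, \<omega>')) (snd (\<omega>, \<omega>'))"
        using b.AE_points AE_mixture_summable
      proof eventually_elim
        case \<omega>: (elim \<omega>)
        show ?case using \<omega>(2)
        proof eventually_elim
          case (elim \<omega>')
          have "0 < L \<omega> \<omega>'"
            using elim \<omega>(1) by (intro suminf_pos) (auto simp: less_imp_neq[THEN not_sym])
          then show ?case using \<omega>(1) by simp
        qed
      qed
    qed measurable
    show "AE z in M\<^sub>\<delta> \<Otimes>\<^sub>M M\<^sub>\<alpha>. 0 < a.T (snd z) * d.T (fst z) powr (1 / \<alpha>) \<and> 0 < d.T (fst z)"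
    proof (rule da.AE_pair_measure)
      show "AE y in M\<^sub>\<delta>. AE x in M\<^sub>\<alpha>. 0 < a.T (snd (y, x)) * d.T (fst (y, x)) powr (1 / \<alpha>) \<and> 0 < d.T (fst (y, x))"
        using d.AE_T_pos
      proof eventually_elim
        case (elim y)
        show ?case using a.AE_T_pos by eventually_elim (use elim in simp)
      qed
    qed measurable
    fix l m :: real assume lm: "0 < l" "0 < m"
    have "(\<integral>\<^sup>+z. ennreal (exp (- (l * b.T (fst z) + m * L (fst z) (snd z)))) \<partial>(M\<^sub>\<beta> \<Otimes>\<^sub>M N)) =
        ennreal (exp (- ((l powr \<alpha> + m) powr (\<beta> / \<alpha>))))"
      by (simp only: n.nn_integral_fst[OF exp_meas(1), symmetric] fst_conv snd_conv joint_Laplace[OF lm])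
    \<comment> \<open>The value is read as the transform of the \<open>\<beta> / \<alpha>\<close>
      mass at \<open>l powr \<alpha> + m\<close>. The part \<open>l powr \<alpha> * d.T y\<close> is
      in turn the exponent of the \<open>\<alpha>\<close> mass scaled by
      \<open>d.T y powr (1 / \<alpha>)\<close>.\<close>
    also have "\<dots> = (\<integral>\<^sup>+y. ennreal (exp (- ((l powr \<alpha> + m) * d.T y))) \<partial>M\<^sub>\<delta>)"
      using lm by (intro d.Laplace_T[symmetric]) simp
    also have "\<dots> = (\<integral>\<^sup>+y. \<integral>\<^sup>+x. ennreal (exp (- (l * (a.T x * d.T y powr (1 / \<alpha>)) + m * d.T y))) \<partial>M\<^sub>\<alpha> \<partial>M\<^sub>\<delta>)"
      using d.AE_T_pos
    proof (intro nn_integral_cong_AE, eventually_elim)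
      case (elim y)
      have "(\<integral>\<^sup>+x. ennreal (exp (- (l * (a.T x * d.T y powr (1 / \<alpha>)) + m * d.T y))) \<partial>M\<^sub>\<alpha>) =
          (\<integral>\<^sup>+x. ennreal (exp (- (m * d.T y))) * ennreal (exp (- ((l * d.T y powr (1 / \<alpha>)) * a.T x))) \<partial>M\<^sub>\<alpha>)"
        by (simp add: ennreal_mult''[symmetric] exp_add[symmetric] mult_ac add.commute minus_add_distrib)
      also have "\<dots> = ennreal (exp (- (m * d.T y))) * ennreal (exp (- ((l * d.T y powr (1 / \<alpha>)) powr \<alpha>)))"
        using lm by (simp add: nn_integral_cmult a.Laplace_T)
      also have "(l * d.T y powr (1 / \<alpha>)) powr \<alpha> = l powr \<alpha> * d.T y"
        using lm elim order by (simp add: powr_mult powr_powr)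
      also have "ennreal (exp (- (m * d.T y))) * ennreal (exp (- (l powr \<alpha> * d.T y))) = ennreal (exp (- (m * d.T y)) * exp (- (l powr \<alpha> * d.T y)))"
        by (rule ennreal_mult''[symmetric]) simp
      also have "exp (- (m * d.T y)) * exp (- (l powr \<alpha> * d.T y)) = exp (- ((l powr \<alpha> + m) * d.T y))"
        by (simp only: exp_add[symmetric] distrib_right minus_add_distrib add.commute)
      finally show ?case by (rule sym)
    qed
    also have "\<dots> = (\<integral>\<^sup>+z. ennreal (exp (- (l * (a.T (snd z) * d.T (fst z) powr (1 / \<alpha>)) + m * d.T (fst z)))) \<partial>(M\<^sub>\<delta> \<Otimes>\<^sub>M M\<^sub>\<alpha>))"
      by (simp only: a.nn_integral_fst[OF exp_meas(2), symmetric] fst_conv snd_conv)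
    finally show "(\<integral>\<^sup>+z. ennreal (exp (- (l * b.T (fst z) + m * L (fst z) (snd z)))) \<partial>(M\<^sub>\<beta> \<Otimes>\<^sub>M N)) = \<dots>" .
  qed (auto intro: bn.finite_measure_axioms da.finite_measure_axioms meas)
  then show ?thesis
    by (simp only: n.nn_integral_fst[OF H_meas(1), symmetric] a.nn_integral_fst[OF H_meas(2), symmetric] fst_conv snd_conv)
qed

end

section \<open>Conditioning on the mass and size-biasing\<close>

locale conditioned_model = stable_model_density +
  fixes \<kappa> :: "real \<Rightarrow> (nat \<Rightarrow> real) measure"
  assumes conditional: "PD_given_total M J \<kappa>"
begin

lemma \<kappa>_measurable [measurable]: "\<kappa> \<in> borel \<rightarrow>\<^sub>M subprob_algebra seq_space"
  using conditional by (auto simp: PD_given_total_def intro: measurable_prob_algebraD)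

lemma sets_\<kappa> [simp]: "sets (\<kappa> t) = sets seq_space"
  by (rule subprob_measurableD(2)[OF \<kappa>_measurable]) simp

lemma nn_integral_\<kappa>_measurable [measurable]:
  "F \<in> borel_measurable seq_space \<Longrightarrow> (\<lambda>t. \<integral>\<^sup>+p. F p \<partial>\<kappa> t) \<in> borel_measurable borel"
  by (rule measurable_compose[OF \<kappa>_measurable nn_integral_measurable_subprob_algebra])

text \<open>The conditional law is specified on rectangles. Two equalities of measures extend it to
  functions: first on \<open>seq_space\<close> for a fixed set of masses, then on the line for a
  fixed \<open>F\<close>.\<close>

lemma nn_integral_conditional:
  assumes F [measurable]: "F \<in> borel_measurable seq_space" and \<phi> [measurable]: "\<phi> \<in> borel_measurable borel"
  shows "(\<integral>\<^sup>+\<omega>. \<phi> (T \<omega>) * F (P \<omega>) \<partial>M) = (\<integral>\<^sup>+\<omega>. \<phi> (T \<omega>) * (\<integral>\<^sup>+p. F p \<partial>\<kappa> (T \<omega>)) \<partial>M)"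
proof -
  have on_set: "(\<integral>\<^sup>+\<omega>. indicator B (T \<omega>) * F (P \<omega>) \<partial>M) = (\<integral>\<^sup>+\<omega>. indicator B (T \<omega>) * (\<integral>\<^sup>+p. F p \<partial>\<kappa> (T \<omega>)) \<partial>M)"
    if [measurable]: "B \<in> sets borel" for B
  proof -
    let ?D = "density (distr M borel T) (indicator B)"
    let ?L = "distr (density M (\<lambda>\<omega>. indicator B (T \<omega>))) seq_space P"
    have \<kappa>D: "\<kappa> \<in> ?D \<rightarrow>\<^sub>M subprob_algebra seq_space" by measurable
    have sets_R: "sets (?D \<bind> \<kappa>) = sets seq_space" by (rule sets_bind) auto
    have "?L = ?D \<bind> \<kappa>"
    proof (rule measure_eqI)
      fix A assume "A \<in> sets ?L"
      then have A[measurable]: "A \<in> sets seq_space" by simp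
      have "emeasure ?L A = (\<integral>\<^sup>+\<omega>. indicator B (T \<omega>) * indicator (P -` A \<inter> space M) \<omega> \<partial>M)"
        by (simp add: emeasure_distr emeasure_density)
      also have "\<dots> = (\<integral>\<^sup>+\<omega>. indicator {\<omega>\<in>space M. P \<omega> \<in> A \<and> T \<omega> \<in> B} \<omega> \<partial>M)"
        by (intro nn_integral_cong) (auto split: split_indicator)
      also have "\<dots> = emeasure M {\<omega>\<in>space M. P \<omega> \<in> A \<and> T \<omega> \<in> B}"
        by (rule nn_integral_indicator) measurable
      also have "\<dots> = (\<integral>\<^sup>+t\<in>B. emeasure (\<kappa> t) A \<partial>distr M borel T)"
        using conditional A by (auto simp: PD_given_total_def)
      also have "\<dots> = (\<integral>\<^sup>+t. indicator B t * (\<integral>\<^sup>+p. indicator A p \<partial>\<kappa> t) \<partial>distr M borel T)"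
        using A by (intro nn_integral_cong) (simp add: mult.commute)
      also have "\<dots> = (\<integral>\<^sup>+t. (\<integral>\<^sup>+p. indicator A p \<partial>\<kappa> t) \<partial>?D)"
        by (subst nn_integral_density) auto
      also have "\<dots> = emeasure (?D \<bind> \<kappa>) A"
        by (subst nn_integral_bind[OF _ \<kappa>D, symmetric]) (auto simp: sets_R)
      finally show "emeasure ?L A = emeasure (?D \<bind> \<kappa>) A" .
    qed (simp add: sets_R)
    then have "(\<integral>\<^sup>+p. F p \<partial>?L) = (\<integral>\<^sup>+p. F p \<partial>(?D \<bind> \<kappa>))" by simp
    then show ?thesis
      by (subst (asm) nn_integral_bind[OF F \<kappa>D]) (simp add: nn_integral_distr nn_integral_density)
  qed
  let ?A = "distr (density M (\<lambda>\<omega>. F (P \<omega>))) borel T"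
  let ?B = "distr (density M (\<lambda>\<omega>. \<integral>\<^sup>+p. F p \<partial>\<kappa> (T \<omega>))) borel T"
  have "?A = ?B"
  proof (rule measure_eqI)
    fix B assume "B \<in> sets ?A"
    then have [measurable]: "B \<in> sets borel" by simp
    have ind: "indicator (T -` B \<inter> space M) \<omega> = (indicator B (T \<omega>) :: ennreal)" if "\<omega> \<in> space M" for \<omega>
      using that by (auto split: split_indicator)
    show "emeasure ?A B = emeasure ?B B"
      using on_set[of B]
      by (simp add: emeasure_distr emeasure_density ind mult.commute cong: nn_integral_cong)
  qed simp
  then have "(\<integral>\<^sup>+t. \<phi> t \<partial>?A) = (\<integral>\<^sup>+t. \<phi> t \<partial>?B)" by simp
  then show ?thesis
    by (simp add: nn_integral_distr nn_integral_density mult.commute)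
qed

text \<open>Since \<open>f\<close> is the density of \<open>T\<close>, mixing the conditional laws
  with density \<open>w t * f t\<close> amounts to giving the original weights the density
  \<open>w (T \<omega>)\<close>.\<close>

lemma nn_integral_PK:
  assumes F [measurable]: "F \<in> borel_measurable seq_space" and w [measurable]: "w \<in> borel_measurable borel"
  shows "(\<integral>\<^sup>+p. F p \<partial>PK f \<kappa> w) = (\<integral>\<^sup>+\<omega>. w (T \<omega>) * F (P \<omega>) \<partial>M)"
proof -
  have "\<kappa> \<in> density lborel (\<lambda>t. indicator {0<..} t * (w t * ennreal (f t))) \<rightarrow>\<^sub>M subprob_algebra seq_space"
    by measurable
  then have "(\<integral>\<^sup>+p. F p \<partial>PK f \<kappa> w) = (\<integral>\<^sup>+t. indicator {0<..} t * (w t * ennreal (f t)) * (\<integral>\<^sup>+p. F p \<partial>\<kappa> t) \<partial>lborel)"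
    unfolding PK_def by (subst nn_integral_bind[OF F]) (auto simp: nn_integral_density)
  also have "\<dots> = (\<integral>\<^sup>+\<omega>. w (T \<omega>) * (\<integral>\<^sup>+p. F p \<partial>\<kappa> (T \<omega>)) \<partial>M)"
    by (subst nn_integral_T_density[of "\<lambda>t. w t * (\<integral>\<^sup>+p. F p \<partial>\<kappa> t)"]) (auto intro!: nn_integral_cong simp: mult_ac)
  finally show ?thesis by (simp only: nn_integral_conditional[OF F w])
qed

end

lemma (in prob_space) nn_integral_indep_var:
  assumes indep: "indep_var S X U Y" and [measurable]: "\<Phi> \<in> borel_measurable (S \<Otimes>\<^sub>M U)"
  shows "(\<integral>\<^sup>+\<omega>. \<Phi> (X \<omega>, Y \<omega>) \<partial>M) = (\<integral>\<^sup>+\<omega>. \<integral>\<^sup>+\<omega>'. \<Phi> (X \<omega>, Y \<omega>') \<partial>M \<partial>M)"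
proof -
  have X[measurable]: "X \<in> M \<rightarrow>\<^sub>M S" and Y[measurable]: "Y \<in> M \<rightarrow>\<^sub>M U"
    using indep_var_rv1[OF indep] indep_var_rv2[OF indep] by auto
  interpret Y: prob_space "distr M U Y" by (rule prob_space_distr) measurable
  have "(\<integral>\<^sup>+\<omega>. \<Phi> (X \<omega>, Y \<omega>) \<partial>M) = (\<integral>\<^sup>+z. \<Phi> z \<partial>distr M (S \<Otimes>\<^sub>M U) (\<lambda>\<omega>. (X \<omega>, Y \<omega>)))"
    by (subst nn_integral_distr) auto
  also have "\<dots> = (\<integral>\<^sup>+z. \<Phi> z \<partial>(distr M S X \<Otimes>\<^sub>M distr M U Y))"
    by (simp only: indep_var_distribution_eq[THEN iffD1, OF indep, THEN conjunct2, THEN conjunct2])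
  also have "\<dots> = (\<integral>\<^sup>+x. \<integral>\<^sup>+y. \<Phi> (x, y) \<partial>distr M U Y \<partial>distr M S X)"
    by (rule Y.nn_integral_fst[symmetric]) measurable
  also have "\<dots> = (\<integral>\<^sup>+\<omega>. \<integral>\<^sup>+y. \<Phi> (X \<omega>, y) \<partial>distr M U Y \<partial>M)"
    by (rule nn_integral_distr) measurable
  also have "\<dots> = (\<integral>\<^sup>+\<omega>. \<integral>\<^sup>+\<omega>'. \<Phi> (X \<omega>, Y \<omega>') \<partial>M \<partial>M)"
    by (intro nn_integral_cong nn_integral_distr Y measurable_compose[OF measurable_Pair1'])
       (auto dest: measurable_space[OF X])
  finally show ?thesis .
qed

section \<open>Size-biased order as a random bijection\<close>

lemma suminf_ennreal_reindex:
  fixes a :: "nat \<Rightarrow> ennreal"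
  assumes "bij \<sigma>"
  shows "(\<Sum>k. a (\<sigma> k)) = (\<Sum>k. a k)"
  using nn_integral_bij_count_space[of \<sigma> UNIV UNIV a] assms
  by (simp add: nn_integral_count_space_nat)

lemma size_biased_hits_index:
  assumes M: "prob_space M" and P [measurable]: "P \<in> M \<rightarrow>\<^sub>M seq_space"
    and \<sigma> [measurable]: "\<And>k. (\<lambda>\<omega>. \<sigma> \<omega> k) \<in> M \<rightarrow>\<^sub>M count_space (UNIV :: nat set)"
    and pick: "\<And>A js. A \<in> sets seq_space \<Longrightarrow>
       emeasure M {\<omega>\<in>space M. P \<omega> \<in> A \<and> (\<forall>l<length js. \<sigma> \<omega> l = js ! l)} =
           (if distinct js
            then \<integral>\<^sup>+\<omega>. indicator A (P \<omega>) *
                   (\<Prod>l<length js. ennreal (P \<omega> (js ! l) / (1 - (\<Sum>m<l. P \<omega> (js ! m))))) \<partial>M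
            else 0)"
    and \<epsilon>: "0 < \<epsilon>" "\<epsilon> < 1"
  shows "AE \<omega> in M. \<epsilon> \<le> P \<omega> i \<and> (\<forall>k. 0 \<le> P \<omega> k) \<and> (\<forall>n. (\<Sum>k<n. P \<omega> k) \<le> 1) \<longrightarrow> (\<exists>l. \<sigma> \<omega> l = i)"
proof -
  interpret prob_space M by fact
  \<comment> \<open>Bounds on the partial sums form a measurable condition, and they keep every
    denominator at least \<open>P \<omega> i\<close> as long as \<open>i\<close> has not been
    drawn.\<close>
  define A where "A = {p \<in> space seq_space. \<epsilon> \<le> p i \<and> (\<forall>k. 0 \<le> p k) \<and> (\<forall>n. (\<Sum>k<n. p k) \<le> 1)}"
  have A[measurable]: "A \<in> sets seq_space"
    supply [measurable] = measurable_seq_space_component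
    unfolding A_def by measurable
  define E where "E js = {\<omega>\<in>space M. P \<omega> \<in> A \<and> (\<forall>l<length js. \<sigma> \<omega> l = js ! l)}" for js
  have E[measurable]: "E js \<in> sets M" for js unfolding E_def by measurable
  define U where "U n = {\<omega>\<in>space M. P \<omega> \<in> A \<and> (\<forall>l<n. \<sigma> \<omega> l \<noteq> i)}" for n
  have U[measurable]: "U n \<in> sets M" for n unfolding U_def by measurable
  \<comment> \<open>Draw sequences of length \<open>n\<close> that avoid \<open>i\<close>. There are
    countably many, and appending \<open>i\<close> describes a first hit at draw \<open>n\<close>,
    counted from 0.\<close>
  define S where "S n = {js. length js = n \<and> i \<notin> set js}" for n :: nat
  have len: "length js = n" if "js \<in> S n" for js n using that by (simp add: S_def)
  have step: "ennreal \<epsilon> * emeasure M (E js) \<le> emeasure M (E (js @ [i]))" if js: "js \<in> S n" for js n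
  proof (cases "distinct js")
    case True
    have i: "i \<notin> set js" using js by (simp add: S_def)
    let ?w = "\<lambda>\<omega> l. ennreal (P \<omega> (js ! l) / (1 - (\<Sum>m<l. P \<omega> (js ! m))))"
    have P_meas: "(\<lambda>\<omega>. P \<omega> k) \<in> borel_measurable M" for k
      by (rule measurable_compose[OF P measurable_seq_space_component])
    have "ennreal \<epsilon> * emeasure M (E js) = (\<integral>\<^sup>+\<omega>. ennreal \<epsilon> * (indicator A (P \<omega>) * (\<Prod>l<length js. ?w \<omega> l)) \<partial>M)"
      unfolding E_def pick[OF A] using True P_meas by (simp add: nn_integral_cmult)
    also have "\<dots> \<le> (\<integral>\<^sup>+\<omega>. indicator A (P \<omega>) * ((\<Prod>l<length js. ?w \<omega> l) * ennreal (P \<omega> i / (1 - (\<Sum>m<length js. P \<omega> (js ! m))))) \<partial>M)"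
    proof (rule nn_integral_mono)
      fix \<omega>
      have "ennreal \<epsilon> \<le> ennreal (P \<omega> i / (1 - (\<Sum>m<length js. P \<omega> (js ! m))))" if "P \<omega> \<in> A"
      proof -
        have p: "\<epsilon> \<le> P \<omega> i" "\<And>k. 0 \<le> P \<omega> k" "\<And>n. (\<Sum>k<n. P \<omega> k) \<le> 1" using that by (auto simp: A_def)
        let ?s = "\<Sum>m<length js. P \<omega> (js ! m)"
        have s: "?s = (\<Sum>k\<in>set js. P \<omega> k)"
          using True by (simp add: sum.distinct_set_conv_list sum_list_sum_nth atLeast0LessThan)
        obtain b where b: "insert i (set js) \<subseteq> {..<b}"
          using finite_nat_iff_bounded[of "insert i (set js)"] by auto
        have "P \<omega> i + ?s = (\<Sum>k\<in>insert i (set js). P \<omega> k)" using i by (simp add: s)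
        also have "\<dots> \<le> (\<Sum>k<b. P \<omega> k)" using p(2) b by (intro sum_mono2) auto
        finally have "P \<omega> i + ?s \<le> 1" using p(3)[of b] by simp
        moreover have "0 \<le> ?s" using p(2) by (intro sum_nonneg) auto
        moreover have "\<epsilon> * (1 - ?s) \<le> \<epsilon> * 1" using \<epsilon> \<open>0 \<le> ?s\<close> by (intro mult_left_mono) auto
        ultimately have "\<epsilon> * (1 - ?s) \<le> P \<omega> i" "0 < 1 - ?s" using p(1) \<epsilon> by linarith+
        then show ?thesis by (intro ennreal_leI) (simp add: pos_le_divide_eq)
      qed
      then have "ennreal \<epsilon> * (\<Prod>l<length js. ?w \<omega> l) \<le> (\<Prod>l<length js. ?w \<omega> l) * ennreal (P \<omega> i / (1 - (\<Sum>m<length js. P \<omega> (js ! m))))"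
        if "P \<omega> \<in> A"
        using that by (subst mult.commute) (intro mult_left_mono, auto)
      then show "ennreal \<epsilon> * (indicator A (P \<omega>) * (\<Prod>l<length js. ?w \<omega> l)) \<le>
          indicator A (P \<omega>) * ((\<Prod>l<length js. ?w \<omega> l) * ennreal (P \<omega> i / (1 - (\<Sum>m<length js. P \<omega> (js ! m)))))"
        by (auto split: split_indicator)
    qed
    also have "\<dots> = emeasure M (E (js @ [i]))"
    proof -
      have "(\<Prod>l<length (js @ [i]). ennreal (P \<omega> ((js @ [i]) ! l) / (1 - (\<Sum>m<l. P \<omega> ((js @ [i]) ! m))))) =
          (\<Prod>l<length js. ?w \<omega> l) * ennreal (P \<omega> i / (1 - (\<Sum>m<length js. P \<omega> (js ! m))))" for \<omega>
        by (simp add: nth_append)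
      then show ?thesis unfolding E_def pick[OF A] using True i by simp
    qed
    finally show ?thesis .
  next
    case False
    then have "emeasure M (E js) = 0" unfolding E_def by (simp only: pick[OF A] if_False)
    then show ?thesis by simp
  qed
  have split: "(\<Union>js\<in>S n. E js) = U n" for n
  proof safe
    fix js \<omega> assume "js \<in> S n" "\<omega> \<in> E js"
    then show "\<omega> \<in> U n" by (auto simp: S_def E_def U_def)
  next
    fix \<omega> assume "\<omega> \<in> U n"
    then have "map (\<sigma> \<omega>) [0..<n] \<in> S n" "\<omega> \<in> E (map (\<sigma> \<omega>) [0..<n])"
      by (auto simp: S_def E_def U_def)
    then show "\<omega> \<in> (\<Union>js\<in>S n. E js)" by blast
  qed
  have disj: "disjoint_family_on E (S n)" for n
    unfolding disjoint_family_on_def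
  proof (intro ballI impI)
    fix js ks assume js: "js \<in> S n" "ks \<in> S n" "js \<noteq> ks"
    then obtain l where "l < n" "js ! l \<noteq> ks ! l"
      using nth_equalityI[of js ks] len by metis
    then show "E js \<inter> E ks = {}" using js len by (auto simp: E_def)
  qed
  have E_snoc: "E (js @ [i]) = E js \<inter> {\<omega>\<in>space M. \<sigma> \<omega> n = i}" if "js \<in> S n" for js n
    using len[OF that] by (auto simp: E_def nth_append less_Suc_eq)
  have disj': "disjoint_family_on (\<lambda>js. E (js @ [i])) (S n)" for n
    using disj[of n] by (auto simp: disjoint_family_on_def E_snoc)
  have split': "(\<Union>js\<in>S n. E (js @ [i])) = U n - U (Suc n)" for n
  proof -
    have "(\<Union>js\<in>S n. E (js @ [i])) = (\<Union>js\<in>S n. E js) \<inter> {\<omega>\<in>space M. \<sigma> \<omega> n = i}"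
      by (simp add: E_snoc)
    also have "\<dots> = U n - U (Suc n)" unfolding split by (auto simp: U_def less_Suc_eq)
    finally show ?thesis .
  qed
  have "ennreal \<epsilon> * emeasure M (U n) \<le> emeasure M (U n - U (Suc n))" for n
  proof -
    have "ennreal \<epsilon> * emeasure M (U n) = (\<integral>\<^sup>+js. ennreal \<epsilon> * emeasure M (E js) \<partial>count_space (S n))"
      unfolding split[symmetric] by (subst emeasure_UN_countable[OF _ _ disj]) (auto simp: nn_integral_cmult)
    also have "\<dots> \<le> (\<integral>\<^sup>+js. emeasure M (E (js @ [i])) \<partial>count_space (S n))"
      using step by (intro nn_integral_mono) auto
    also have "\<dots> = emeasure M (U n - U (Suc n))"
      unfolding split'[symmetric] by (subst emeasure_UN_countable[OF _ _ disj']) auto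
    finally show ?thesis .
  qed
  then have lower: "\<epsilon> * measure M (U n) \<le> measure M (U n - U (Suc n))" for n
    using \<epsilon> by (simp add: emeasure_eq_measure ennreal_mult''[symmetric])
  have diff: "measure M (U n - U (Suc n)) = measure M (U n) - measure M (U (Suc n))" for n
    by (rule finite_measure_Diff[OF U U]) (auto simp: U_def less_Suc_eq)
  have dec: "measure M (U (Suc n)) \<le> (1 - \<epsilon>) * measure M (U n)" for n
    using lower[of n] unfolding diff left_diff_distrib by simp
  have geo: "measure M (U n) \<le> (1 - \<epsilon>) ^ n" for n
  proof (induction n)
    case (Suc n)
    have "measure M (U (Suc n)) \<le> (1 - \<epsilon>) * measure M (U n)" by (rule dec)
    also have "\<dots> \<le> (1 - \<epsilon>) * (1 - \<epsilon>) ^ n" using Suc \<epsilon> by (intro mult_left_mono) auto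
    finally show ?case by simp
  qed simp
  have zero: "(\<lambda>n. (1 - \<epsilon>) ^ n) \<longlonglongrightarrow> 0" using \<epsilon> by (intro LIMSEQ_power_zero) auto
  define V where "V = {\<omega>\<in>space M. P \<omega> \<in> A \<and> (\<forall>l. \<sigma> \<omega> l \<noteq> i)}"
  have V[measurable]: "V \<in> sets M" unfolding V_def by measurable
  have "measure M V \<le> measure M (U n)" for n by (intro finite_measure_mono) (auto simp: V_def U_def)
  then have "measure M V \<le> (1 - \<epsilon>) ^ n" for n using geo[of n] by (rule order_trans)
  then have "measure M V \<le> 0" by (intro LIMSEQ_le_const[OF zero]) auto
  then have "AE \<omega> in M. \<omega> \<notin> V"
    by (intro AE_not_in) (simp add: null_sets_def emeasure_eq_measure measure_le_0_iff)
  then show ?thesis using AE_space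
    by eventually_elim (use measurable_space[OF P] in \<open>auto simp: V_def A_def\<close>)
qed

text \<open>Lists with a repetition have probability 0 and are countable, which gives injectivity.
  Surjectivity follows from the hitting lemma along the thresholds \<open>1 / real (n + 2)\<close>,
  all below 1 and eventually below any given positive mass.\<close>

lemma size_biased_rearrangement_bij:
  assumes M: "prob_space M" and P: "P \<in> M \<rightarrow>\<^sub>M seq_space" and Q: "size_biased_rearrangement M P Q"
    and pos: "AE \<omega> in M. (\<forall>k. 0 < P \<omega> k) \<and> P \<omega> sums 1"
  obtains \<sigma> where "AE \<omega> in M. bij (\<sigma> \<omega>) \<and> (\<forall>k. Q \<omega> k = P \<omega> (\<sigma> \<omega> k))"
proof -
  interpret prob_space M by fact
  from Q obtain \<sigma> where \<sigma>: "\<And>k. (\<lambda>\<omega>. \<sigma> \<omega> k) \<in> M \<rightarrow>\<^sub>M count_space (UNIV :: nat set)"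
      "AE \<omega> in M. \<forall>k. Q \<omega> k = P \<omega> (\<sigma> \<omega> k)"
    and pick: "\<And>A js. A \<in> sets seq_space \<Longrightarrow>
       emeasure M {\<omega>\<in>space M. P \<omega> \<in> A \<and> (\<forall>l<length js. \<sigma> \<omega> l = js ! l)} =
           (if distinct js
            then \<integral>\<^sup>+\<omega>. indicator A (P \<omega>) *
                   (\<Prod>l<length js. ennreal (P \<omega> (js ! l) / (1 - (\<Sum>m<l. P \<omega> (js ! m))))) \<partial>M
            else 0)"
    unfolding size_biased_rearrangement_def by blast
  note [measurable] = \<sigma>(1)
  have "AE \<omega> in M. \<not> (\<forall>l<length js. \<sigma> \<omega> l = js ! l)" if "\<not> distinct js" for js
  proof -
    have "emeasure M {\<omega>\<in>space M. P \<omega> \<in> space seq_space \<and> (\<forall>l<length js. \<sigma> \<omega> l = js ! l)} = 0"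
      using that by (simp add: pick)
    then have "emeasure M {\<omega>\<in>space M. \<forall>l<length js. \<sigma> \<omega> l = js ! l} = 0"
      using measurable_space[OF P] by (simp cong: conj_cong)
    then show ?thesis by (intro AE_I[where N="{\<omega>\<in>space M. \<forall>l<length js. \<sigma> \<omega> l = js ! l}"]) auto
  qed
  then have "AE \<omega> in M. \<forall>js\<in>{js. \<not> distinct js}. \<not> (\<forall>l<length js. \<sigma> \<omega> l = js ! l)"
    by (intro AE_ball_countable[THEN iffD2]) auto
  then have inj: "AE \<omega> in M. inj (\<sigma> \<omega>)"
  proof eventually_elim
    case (elim \<omega>)
    have "distinct (map (\<sigma> \<omega>) [0..<n])" for n
      using elim[THEN bspec, of "map (\<sigma> \<omega>) [0..<n]"] by auto
    then have "inj_on (\<sigma> \<omega>) {..<n}" for n by (simp add: distinct_map atLeast0LessThan)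
    then show ?case
      by (intro injI) (metis inj_onD lessThan_iff less_Suc_eq_le max.cobounded1 max.cobounded2)
  qed
  have "AE \<omega> in M. \<forall>i n. 1 / real (n + 2) \<le> P \<omega> i \<and> (\<forall>k. 0 \<le> P \<omega> k) \<and> (\<forall>n. (\<Sum>k<n. P \<omega> k) \<le> 1) \<longrightarrow> (\<exists>l. \<sigma> \<omega> l = i)"
    by (intro AE_all_countable[THEN iffD2] allI size_biased_hits_index[OF M P \<sigma>(1) pick]) auto
  then have "AE \<omega> in M. bij (\<sigma> \<omega>) \<and> (\<forall>k. Q \<omega> k = P \<omega> (\<sigma> \<omega> k))"
    using inj pos \<sigma>(2)
  proof eventually_elim
    case (elim \<omega>)
    have "\<exists>l. \<sigma> \<omega> l = i" for i
    proof -
      obtain n where n: "1 / P \<omega> i \<le> real n" using real_arch_simple by blast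
      then have "1 / real (n + 2) \<le> P \<omega> i"
        using elim(3)[THEN conjunct1, THEN spec, of i] by (simp add: field_simps)
      moreover have "(\<Sum>k<m. P \<omega> k) \<le> 1" for m
        using elim(3) sum_le_suminf[of "P \<omega>" "{..<m}"] by (auto simp: sums_iff less_imp_le)
      ultimately show ?thesis using elim(1,3) by (meson less_imp_le)
    qed
    then have "surj (\<sigma> \<omega>)" by (metis surjI surj_def)
    then show ?case using elim(2,4) by (simp add: bij_def)
  qed
  then show ?thesis by (rule that)
qed

section \<open>The marked sum over reweighted weights\<close>

locale generalized_mixture = mittag_leffler_mixture \<alpha> \<beta> M\<^sub>\<alpha> J\<^sub>\<alpha> I\<^sub>\<alpha> M\<^sub>\<beta> J\<^sub>\<beta> I\<^sub>\<beta> M\<^sub>\<delta> J\<^sub>\<delta> I\<^sub>\<delta> f\<^sub>\<alpha> N Z +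
    bc: conditioned_model \<beta> M\<^sub>\<beta> J\<^sub>\<beta> I\<^sub>\<beta> f\<^sub>\<beta> \<kappa>\<^sub>\<beta>
  for \<alpha> \<beta> :: real and M\<^sub>\<alpha> :: "'a measure" and J\<^sub>\<alpha> I\<^sub>\<alpha> and M\<^sub>\<beta> :: "'b measure" and J\<^sub>\<beta> I\<^sub>\<beta>
    and M\<^sub>\<delta> :: "'c measure" and J\<^sub>\<delta> I\<^sub>\<delta> and f\<^sub>\<alpha> f\<^sub>\<beta> \<kappa>\<^sub>\<beta> and N :: "'e measure" and Z +
  fixes h :: "real \<Rightarrow> real" and P\<^sub>\<beta> P_tilde :: "'e \<Rightarrow> nat \<Rightarrow> real"
  assumes h_measurable [measurable]: "h \<in> borel_measurable borel"
    and P\<^sub>\<beta>_law: "distr N seq_space P\<^sub>\<beta> = PK f\<^sub>\<beta> \<kappa>\<^sub>\<beta> (\<lambda>t. ennreal (h t))"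
    and size_biased: "size_biased_rearrangement N P\<^sub>\<beta> P_tilde"
    and indep: "n.indep_var seq_space P\<^sub>\<beta> seq_space Z" "n.indep_var seq_space P_tilde seq_space Z"
begin

abbreviation "h\<^sub>\<alpha> \<equiv> h_tilde M\<^sub>\<delta> J\<^sub>\<delta> \<alpha> h"

lemma h\<^sub>\<alpha>_measurable [measurable]: "h\<^sub>\<alpha> \<in> borel_measurable borel"
  unfolding h_tilde_def[abs_def] by measurable

lemma rv [measurable]: "P\<^sub>\<beta> \<in> N \<rightarrow>\<^sub>M seq_space" "P_tilde \<in> N \<rightarrow>\<^sub>M seq_space" "Z \<in> N \<rightarrow>\<^sub>M seq_space"
  using n.indep_var_rv1[OF indep(1)] n.indep_var_rv1[OF indep(2)] n.indep_var_rv2[OF indep(1)] by auto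

text \<open>Valued in \<open>ennreal\<close>, so that it is measurable and invariant under
  reordering before convergence is known.\<close>

definition mix :: "(nat \<Rightarrow> real) \<Rightarrow> (nat \<Rightarrow> real) \<Rightarrow> ennreal" where
  "mix p z = (\<Sum>k. ennreal (p k powr \<alpha> * z k))"

lemma mix_measurable [measurable]: "(\<lambda>x. mix (fst x) (snd x)) \<in> borel_measurable (seq_space \<Otimes>\<^sub>M seq_space)"
proof -
  have [measurable]: "(\<lambda>x. fst x k) \<in> borel_measurable (seq_space \<Otimes>\<^sub>M seq_space)"
      "(\<lambda>x. snd x k) \<in> borel_measurable (seq_space \<Otimes>\<^sub>M seq_space)" for k
    by (rule measurable_compose[OF measurable_fst measurable_seq_space_component]
        measurable_compose[OF measurable_snd measurable_seq_space_component])+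
  show ?thesis unfolding mix_def by measurable
qed

lemma mix_measurable_snd [measurable]: "mix p \<in> borel_measurable seq_space"
  supply [measurable] = measurable_seq_space_component
  unfolding mix_def[abs_def] by measurable

lemma nn_integral_P\<^sub>\<beta>:
  assumes [measurable]: "F \<in> borel_measurable seq_space"
  shows "(\<integral>\<^sup>+\<omega>. F (P\<^sub>\<beta> \<omega>) \<partial>N) = (\<integral>\<^sup>+\<omega>. ennreal (h (b.T \<omega>)) * F (b.P \<omega>) \<partial>M\<^sub>\<beta>)"
proof -
  have "(\<integral>\<^sup>+\<omega>. F (P\<^sub>\<beta> \<omega>) \<partial>N) = (\<integral>\<^sup>+p. F p \<partial>distr N seq_space P\<^sub>\<beta>)"
    by (rule nn_integral_distr[symmetric]) measurable
  then show ?thesis unfolding P\<^sub>\<beta>_law by (simp add: bc.nn_integral_PK)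
qed

text \<open>Normalization divides the marked sum by \<open>b.T \<omega> powr \<alpha>\<close>. Under
  the subordination this quotient is
  \<open>d.T y / (a.T x * d.T y powr (1 / \<alpha>)) powr \<alpha>\<close>, in which
  \<open>d.T y\<close> cancels. It survives only inside \<open>h\<close>, and integrating it out
  produces \<open>h\<^sub>\<alpha>\<close>.\<close>

lemma nn_integral_mix:
  assumes G [measurable]: "G \<in> borel_measurable borel"
  shows "(\<integral>\<^sup>+\<omega>. G (mix (P\<^sub>\<beta> \<omega>) (Z \<omega>)) \<partial>N) = (\<integral>\<^sup>+x. h\<^sub>\<alpha> (a.T x) * G (ennreal (a.T x powr (- \<alpha>))) \<partial>M\<^sub>\<alpha>)"
proof -
  have "(\<integral>\<^sup>+\<omega>. G (mix (P\<^sub>\<beta> \<omega>) (Z \<omega>)) \<partial>N) = (\<integral>\<^sup>+\<omega>. \<integral>\<^sup>+\<omega>'. G (mix (P\<^sub>\<beta> \<omega>) (Z \<omega>')) \<partial>N \<partial>N)"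
    using n.nn_integral_indep_var[OF indep(1), of "\<lambda>x. G (mix (fst x) (snd x))"] by simp
  also have "\<dots> = (\<integral>\<^sup>+\<omega>. ennreal (h (b.T \<omega>)) * (\<integral>\<^sup>+\<omega>'. G (mix (b.P \<omega>) (Z \<omega>')) \<partial>N) \<partial>M\<^sub>\<beta>)"
  proof (rule nn_integral_P\<^sub>\<beta>)
    have "(\<lambda>x. G (mix (fst x) (Z (snd x)))) \<in> borel_measurable (seq_space \<Otimes>\<^sub>M N)"
    proof (rule measurable_compose[OF _ G], rule measurable_compose[of "\<lambda>x. (fst x, Z (snd x))", OF _ mix_measurable, simplified])
    qed measurable
    then show "(\<lambda>p. \<integral>\<^sup>+\<omega>'. G (mix p (Z \<omega>')) \<partial>N) \<in> borel_measurable seq_space"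
      by (intro n.borel_measurable_nn_integral) (simp add: case_prod_beta)
  qed
  also have "\<dots> = (\<integral>\<^sup>+\<omega>. \<integral>\<^sup>+\<omega>'. ennreal (h (b.T \<omega>)) * G (ennreal (L \<omega> \<omega>' / b.T \<omega> powr \<alpha>)) \<partial>N \<partial>M\<^sub>\<beta>)"
  proof (rule nn_integral_cong_AE)
    show "AE \<omega> in M\<^sub>\<beta>. ennreal (h (b.T \<omega>)) * (\<integral>\<^sup>+\<omega>'. G (mix (b.P \<omega>) (Z \<omega>')) \<partial>N) =
      (\<integral>\<^sup>+\<omega>'. ennreal (h (b.T \<omega>)) * G (ennreal (L \<omega> \<omega>' / b.T \<omega> powr \<alpha>)) \<partial>N)"
      using b.AE_points AE_mixture_summable
    proof eventually_elim
      case \<omega>: (elim \<omega>)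
      have "ennreal (h (b.T \<omega>)) * (\<integral>\<^sup>+\<omega>'. G (mix (b.P \<omega>) (Z \<omega>')) \<partial>N) =
          (\<integral>\<^sup>+\<omega>'. ennreal (h (b.T \<omega>)) * G (mix (b.P \<omega>) (Z \<omega>')) \<partial>N)"
        by (rule nn_integral_cmult[symmetric]) measurable
      also have "\<dots> = (\<integral>\<^sup>+\<omega>'. ennreal (h (b.T \<omega>)) * G (ennreal (L \<omega> \<omega>' / b.T \<omega> powr \<alpha>)) \<partial>N)"
      proof (rule nn_integral_cong_AE)
        show "AE \<omega>' in N. ennreal (h (b.T \<omega>)) * G (mix (b.P \<omega>) (Z \<omega>')) =
            ennreal (h (b.T \<omega>)) * G (ennreal (L \<omega> \<omega>' / b.T \<omega> powr \<alpha>))"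
          using \<omega>(2)
        proof eventually_elim
          case (elim \<omega>')
          have "0 \<le> J\<^sub>\<beta> \<omega> k powr \<alpha> * Z \<omega>' k / b.T \<omega> powr \<alpha>" for k
            by (intro divide_nonneg_nonneg mult_nonneg_nonneg powr_ge_zero less_imp_le[OF spec[OF conjunct1[OF elim]]])
          then have "(\<Sum>k. ennreal (J\<^sub>\<beta> \<omega> k powr \<alpha> * Z \<omega>' k / b.T \<omega> powr \<alpha>)) = ennreal (\<Sum>k. J\<^sub>\<beta> \<omega> k powr \<alpha> * Z \<omega>' k / b.T \<omega> powr \<alpha>)"
            using elim by (intro suminf_ennreal2 summable_divide) auto
          moreover have "b.P \<omega> k powr \<alpha> * Z \<omega>' k = J\<^sub>\<beta> \<omega> k powr \<alpha> * Z \<omega>' k / b.T \<omega> powr \<alpha>" for k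
            using \<omega>(1) by (simp add: normalized_def powr_divide less_imp_le)
          ultimately show ?case using elim by (simp add: mix_def suminf_divide)
        qed
      qed
      finally show ?case .
    qed
  qed
  also have "\<dots> = (\<integral>\<^sup>+y. \<integral>\<^sup>+x. ennreal (h (a.T x * d.T y powr (1 / \<alpha>))) * G (ennreal (d.T y / (a.T x * d.T y powr (1 / \<alpha>)) powr \<alpha>)) \<partial>M\<^sub>\<alpha> \<partial>M\<^sub>\<delta>)"
    using joint_law[of "\<lambda>x. ennreal (h (fst x)) * G (ennreal (snd x / fst x powr \<alpha>))"] by simp
  also have "\<dots> = (\<integral>\<^sup>+y. \<integral>\<^sup>+x. ennreal (h (a.T x * d.T y powr (1 / \<alpha>))) * G (ennreal (a.T x powr (- \<alpha>))) \<partial>M\<^sub>\<alpha> \<partial>M\<^sub>\<delta>)"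
  proof (rule nn_integral_cong_AE)
    show "AE y in M\<^sub>\<delta>. (\<integral>\<^sup>+x. ennreal (h (a.T x * d.T y powr (1 / \<alpha>))) * G (ennreal (d.T y / (a.T x * d.T y powr (1 / \<alpha>)) powr \<alpha>)) \<partial>M\<^sub>\<alpha>) =
      (\<integral>\<^sup>+x. ennreal (h (a.T x * d.T y powr (1 / \<alpha>))) * G (ennreal (a.T x powr (- \<alpha>))) \<partial>M\<^sub>\<alpha>)"
      using d.AE_T_pos
    proof eventually_elim
      case y: (elim y)
      show ?case
      proof (rule nn_integral_cong_AE)
        show "AE x in M\<^sub>\<alpha>. ennreal (h (a.T x * d.T y powr (1 / \<alpha>))) * G (ennreal (d.T y / (a.T x * d.T y powr (1 / \<alpha>)) powr \<alpha>)) =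
            ennreal (h (a.T x * d.T y powr (1 / \<alpha>))) * G (ennreal (a.T x powr (- \<alpha>)))"
          using a.AE_T_pos
        proof eventually_elim
          case (elim x)
          have "d.T y / (a.T x * d.T y powr (1 / \<alpha>)) powr \<alpha> = a.T x powr (- \<alpha>)"
            using y elim order by (simp add: powr_mult powr_powr powr_minus field_simps)
          then show ?case by simp
        qed
      qed
    qed
  qed
  also have "\<dots> = (\<integral>\<^sup>+x. \<integral>\<^sup>+y. ennreal (h (a.T x * d.T y powr (1 / \<alpha>))) * G (ennreal (a.T x powr (- \<alpha>))) \<partial>M\<^sub>\<delta> \<partial>M\<^sub>\<alpha>)"
  proof -
    interpret pair_sigma_finite M\<^sub>\<delta> M\<^sub>\<alpha> ..
    show ?thesis by (rule Fubini'[symmetric]) measurable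
  qed
  also have "\<dots> = (\<integral>\<^sup>+x. h\<^sub>\<alpha> (a.T x) * G (ennreal (a.T x powr (- \<alpha>))) \<partial>M\<^sub>\<alpha>)"
    unfolding h_tilde_def by (intro nn_integral_cong nn_integral_multc) measurable
  finally show ?thesis .
qed

lemma Z_permuted_law:
  assumes "inj \<sigma>"
  shows "distr N seq_space (\<lambda>\<omega> k. Z \<omega> (\<sigma> k)) = distr N seq_space Z"
proof -
  have Z: "distr N seq_space Z = (\<Pi>\<^sub>M k\<in>UNIV. \<zeta>)"
    using Z_indep n.indep_vars_iff_distr_eq_PiM[where I=UNIV and M'="\<lambda>_. borel" and X="\<lambda>k \<omega>. Z \<omega> k"]
    by (simp add: Z_law seq_space_def restrict_UNIV)
  have sets: "sets (\<Pi>\<^sub>M k\<in>UNIV. \<zeta>) = sets seq_space"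
    unfolding seq_space_def by (intro sets_PiM_cong refl sets_\<zeta>)
  have perm [measurable]: "(\<lambda>z k. z (\<sigma> k)) \<in> seq_space \<rightarrow>\<^sub>M seq_space"
    unfolding seq_space_def by (rule measurable_PiM_single') (auto simp: space_PiM)
  have "distr N seq_space (\<lambda>\<omega> k. Z \<omega> (\<sigma> k)) = distr (distr N seq_space Z) seq_space (\<lambda>z k. z (\<sigma> k))"
    by (subst distr_distr) (auto simp: comp_def)
  also have "\<dots> = distr (\<Pi>\<^sub>M k\<in>UNIV. \<zeta>) (\<Pi>\<^sub>M k\<in>UNIV. \<zeta>) (\<lambda>z k. z (\<sigma> k))"
    unfolding Z by (intro distr_cong refl) (simp add: sets)
  also have "\<dots> = (\<Pi>\<^sub>M k\<in>UNIV. \<zeta>)"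
    using distr_PiM_reindex[of UNIV "\<lambda>_. \<zeta>" \<sigma> UNIV] assms prob_\<zeta> by (simp add: restrict_UNIV)
  finally show ?thesis unfolding Z .
qed

lemma AE_P\<^sub>\<beta>: "AE \<omega> in N. (\<forall>k. 0 < P\<^sub>\<beta> \<omega> k) \<and> P\<^sub>\<beta> \<omega> sums 1"
proof -
  \<comment> \<open>With the total taken in \<open>ennreal\<close>, the condition is a measurable
    property of the sequence and can be transported by the reweighting.\<close>
  define A where "A = {p \<in> space seq_space. \<not> ((\<forall>k. 0 < p k) \<and> (\<Sum>k. ennreal (p k)) = 1)}"
  have [measurable]: "A \<in> sets seq_space"
    supply [measurable] = measurable_seq_space_component
    unfolding A_def by measurable
  have "(\<integral>\<^sup>+\<omega>. indicator A (P\<^sub>\<beta> \<omega>) \<partial>N) = (\<integral>\<^sup>+\<omega>. ennreal (h (b.T \<omega>)) * indicator A (b.P \<omega>) \<partial>M\<^sub>\<beta>)"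
    by (rule nn_integral_P\<^sub>\<beta>) measurable
  also have "\<dots> = 0"
  proof -
    have "AE \<omega> in M\<^sub>\<beta>. b.P \<omega> \<in> ranked_simplex"
      using b.partition by (simp add: generates_partition_def)
    with b.AE_points have "AE \<omega> in M\<^sub>\<beta>. ennreal (h (b.T \<omega>)) * indicator A (b.P \<omega>) = 0"
    proof eventually_elim
      case (elim \<omega>)
      then have "0 < b.P \<omega> k" for k by (simp add: normalized_def)
      moreover have "(\<Sum>k. ennreal (b.P \<omega> k)) = 1"
        using elim(2) by (subst suminf_ennreal2) (auto simp: ranked_simplex_def sums_iff)
      ultimately show ?case by (simp add: A_def)
    qed
    then show ?thesis by (simp add: nn_integral_0_iff_AE)
  qed
  finally have "AE \<omega> in N. indicator A (P\<^sub>\<beta> \<omega>) = (0 :: ennreal)"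
    by (subst (asm) nn_integral_0_iff_AE) auto
  then show ?thesis using AE_space
  proof eventually_elim
    case (elim \<omega>)
    then have pos: "0 < P\<^sub>\<beta> \<omega> k" and sum: "(\<Sum>k. ennreal (P\<^sub>\<beta> \<omega> k)) = 1" for k
      using measurable_space[OF rv(1) elim(2)] by (auto simp: A_def indicator_eq_0_iff)
    have "(\<lambda>k. P\<^sub>\<beta> \<omega> k) sums 1"
      using pos sum by (intro sums_ennreal[THEN iffD1]) (auto simp: less_imp_le sums_iff)
    then show ?case using pos by simp
  qed
qed

text \<open>Each side becomes an iterated integral through its own independence from the marks. For
  a fixed outcome the order \<open>\<sigma> \<omega>\<close> is then a deterministic bijection,
  under which the marks keep their law and a nonnegative series keeps its sum.\<close>

lemma nn_integral_mix_tilde: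
  assumes G [measurable]: "G \<in> borel_measurable borel"
  shows "(\<integral>\<^sup>+\<omega>. G (mix (P_tilde \<omega>) (Z \<omega>)) \<partial>N) = (\<integral>\<^sup>+\<omega>. G (mix (P\<^sub>\<beta> \<omega>) (Z \<omega>)) \<partial>N)"
proof -
  obtain \<sigma> where \<sigma>: "AE \<omega> in N. bij (\<sigma> \<omega>) \<and> (\<forall>k. P_tilde \<omega> k = P\<^sub>\<beta> \<omega> (\<sigma> \<omega> k))"
    using size_biased_rearrangement_bij[OF n.prob_space_axioms rv(1) size_biased AE_P\<^sub>\<beta>] by blast
  have split: "(\<integral>\<^sup>+\<omega>. G (mix (Q \<omega>) (Z \<omega>)) \<partial>N) = (\<integral>\<^sup>+\<omega>. \<integral>\<^sup>+\<omega>'. G (mix (Q \<omega>) (Z \<omega>')) \<partial>N \<partial>N)"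
    if "n.indep_var seq_space Q seq_space Z" for Q
    using n.nn_integral_indep_var[OF that, of "\<lambda>x. G (mix (fst x) (snd x))"] by simp
  have "(\<integral>\<^sup>+\<omega>. \<integral>\<^sup>+\<omega>'. G (mix (P_tilde \<omega>) (Z \<omega>')) \<partial>N \<partial>N) = (\<integral>\<^sup>+\<omega>. \<integral>\<^sup>+\<omega>'. G (mix (P\<^sub>\<beta> \<omega>) (Z \<omega>')) \<partial>N \<partial>N)"
    using \<sigma>
  proof (intro nn_integral_cong_AE, eventually_elim)
    case (elim \<omega>)
    then have P: "P_tilde \<omega> = (\<lambda>k. P\<^sub>\<beta> \<omega> (\<sigma> \<omega> k))" and bij: "bij (\<sigma> \<omega>)" by auto
    have [measurable]: "(\<lambda>\<omega>' k. Z \<omega>' (\<sigma> \<omega> k)) \<in> N \<rightarrow>\<^sub>M seq_space"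
      unfolding seq_space_def by (rule measurable_PiM_single') auto
    have "(\<integral>\<^sup>+\<omega>'. G (mix (P_tilde \<omega>) (Z \<omega>')) \<partial>N) = (\<integral>\<^sup>+z. G (mix (P_tilde \<omega>) z) \<partial>distr N seq_space Z)"
      by (rule nn_integral_distr[symmetric]) measurable
    also have "\<dots> = (\<integral>\<^sup>+z. G (mix (P_tilde \<omega>) z) \<partial>distr N seq_space (\<lambda>\<omega>' k. Z \<omega>' (\<sigma> \<omega> k)))"
      by (simp only: Z_permuted_law[OF bij_is_inj[OF bij]])
    also have "\<dots> = (\<integral>\<^sup>+\<omega>'. G (mix (P_tilde \<omega>) (\<lambda>k. Z \<omega>' (\<sigma> \<omega> k))) \<partial>N)"
      by (rule nn_integral_distr) measurable
    also have "\<dots> = (\<integral>\<^sup>+\<omega>'. G (mix (P\<^sub>\<beta> \<omega>) (Z \<omega>')) \<partial>N)"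
      unfolding mix_def P
      using suminf_ennreal_reindex[OF bij, of "\<lambda>k. ennreal (P\<^sub>\<beta> \<omega> k powr \<alpha> * Z _ k)"] by simp
    finally show ?case .
  qed
  then show ?thesis unfolding split[OF indep(1)] split[OF indep(2)] .
qed

text \<open>The assumed law gives no mass to \<open>top\<close>, so the series converges almost
  surely and its real sum is \<open>enn2real\<close> of \<open>mix\<close>.\<close>

lemma mixture_sum:
  assumes law: "\<And>G. G \<in> borel_measurable borel \<Longrightarrow>
      (\<integral>\<^sup>+\<omega>. G (mix (Q \<omega>) (Z \<omega>)) \<partial>N) = (\<integral>\<^sup>+x. h\<^sub>\<alpha> (a.T x) * G (ennreal (a.T x powr (- \<alpha>))) \<partial>M\<^sub>\<alpha>)"
    and Q [measurable]: "Q \<in> N \<rightarrow>\<^sub>M seq_space"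
  shows "AE \<omega> in N. summable (\<lambda>k. Q \<omega> k powr \<alpha> * Z \<omega> k)"
    and "A \<in> sets borel \<Longrightarrow> emeasure (distr N borel (\<lambda>\<omega>. \<Sum>k. Q \<omega> k powr \<alpha> * Z \<omega> k)) A =
      (\<integral>\<^sup>+x. h\<^sub>\<alpha> (a.T x) * indicator A (a.T x powr (- \<alpha>)) \<partial>M\<^sub>\<alpha>)"
proof -
  have Qk: "(\<lambda>\<omega>. Q \<omega> k) \<in> borel_measurable N" for k
    by (rule measurable_compose[OF Q measurable_seq_space_component])
  have mixm [measurable]: "(\<lambda>\<omega>. mix (Q \<omega>) (Z \<omega>)) \<in> borel_measurable N"
    unfolding mix_def using Qk by measurable
  have "(\<integral>\<^sup>+\<omega>. indicator {top} (mix (Q \<omega>) (Z \<omega>)) \<partial>N) = 0"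
    by (subst law) auto
  then have "AE \<omega> in N. indicator {top} (mix (Q \<omega>) (Z \<omega>)) = (0 :: ennreal)"
    by (subst (asm) nn_integral_0_iff_AE) auto
  then have good: "AE \<omega> in N. summable (\<lambda>k. Q \<omega> k powr \<alpha> * Z \<omega> k) \<and> (\<Sum>k. Q \<omega> k powr \<alpha> * Z \<omega> k) = enn2real (mix (Q \<omega>) (Z \<omega>))"
    using AE_Z_pos
  proof eventually_elim
    case (elim \<omega>)
    then have top: "mix (Q \<omega>) (Z \<omega>) \<noteq> top" by (auto split: split_indicator_asm)
    have nn: "0 \<le> Q \<omega> k powr \<alpha> * Z \<omega> k" for k
      by (rule mult_nonneg_nonneg[OF powr_ge_zero less_imp_le[OF spec[OF elim(2)]]])
    then have summ: "summable (\<lambda>k. Q \<omega> k powr \<alpha> * Z \<omega> k)"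
      using top unfolding mix_def by (rule summable_suminf_not_top)
    then have "mix (Q \<omega>) (Z \<omega>) = ennreal (\<Sum>k. Q \<omega> k powr \<alpha> * Z \<omega> k)"
      unfolding mix_def using nn by (intro suminf_ennreal2) auto
    then show ?case using summ nn by (simp add: suminf_nonneg)
  qed
  then show "AE \<omega> in N. summable (\<lambda>k. Q \<omega> k powr \<alpha> * Z \<omega> k)" by (rule eventually_mono) simp
  assume [measurable]: "A \<in> sets borel"
  have [measurable]: "(\<lambda>\<omega>. \<Sum>k. Q \<omega> k powr \<alpha> * Z \<omega> k) \<in> borel_measurable N" using Qk by measurable
  have "emeasure (distr N borel (\<lambda>\<omega>. \<Sum>k. Q \<omega> k powr \<alpha> * Z \<omega> k)) A = (\<integral>\<^sup>+s. indicator A s \<partial>distr N borel (\<lambda>\<omega>. \<Sum>k. Q \<omega> k powr \<alpha> * Z \<omega> k))"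
    by simp
  also have "\<dots> = (\<integral>\<^sup>+\<omega>. indicator A (\<Sum>k. Q \<omega> k powr \<alpha> * Z \<omega> k) \<partial>N)"
    by (rule nn_integral_distr) measurable
  also have "\<dots> = (\<integral>\<^sup>+\<omega>. indicator A (enn2real (mix (Q \<omega>) (Z \<omega>))) \<partial>N)"
    by (intro nn_integral_cong_AE eventually_mono[OF good]) simp
  also have "\<dots> = (\<integral>\<^sup>+x. h\<^sub>\<alpha> (a.T x) * indicator A (enn2real (ennreal (a.T x powr (- \<alpha>)))) \<partial>M\<^sub>\<alpha>)"
    by (rule law) measurable
  finally show "emeasure (distr N borel (\<lambda>\<omega>. \<Sum>k. Q \<omega> k powr \<alpha> * Z \<omega> k)) A =
      (\<integral>\<^sup>+x. h\<^sub>\<alpha> (a.T x) * indicator A (a.T x powr (- \<alpha>)) \<partial>M\<^sub>\<alpha>)" by simp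
qed

end

section \<open>Conditioning on block counts and comparison of the limit laws\<close>

lemma (in stable_model) nn_integral_cond_expectation:
  assumes [measurable]: "X \<in> borel_measurable M" and k: "k \<in> {1..n}"
  shows "cond_expectation M X (K_event M I n k) = (\<integral>\<^sup>+\<omega>. X \<omega> * indicator {k} (K \<omega> n) \<partial>M) / ennreal (block_prob n k)"
  unfolding cond_expectation_def using k
  by (subst nn_integral_uniform_measure) (auto simp: emeasure_K_event indicator_K_event cong: nn_integral_cong)

lemma (in stable_model) cond_expectation_times:
  assumes "X \<in> borel_measurable M" and k: "k \<in> {1..n}"
  shows "cond_expectation M X (K_event M I n k) * emeasure M (K_event M I n k) = (\<integral>\<^sup>+\<omega>. X \<omega> * indicator {k} (K \<omega> n) \<partial>M)"
proof -
  have "0 < block_prob n k" using k by (intro block_prob_pos) auto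
  then show ?thesis
    unfolding nn_integral_cond_expectation[OF assms] emeasure_K_event
    by (intro ennreal_divide_times[THEN trans]) (simp add: ennreal_times_divide mult_divide_eq_ennreal)
qed

theorem proposition4p2:
  fixes \<alpha> \<beta> :: real
    and h f\<^sub>\<alpha> f\<^sub>\<beta> :: "real \<Rightarrow> real"
    and \<kappa>\<^sub>\<alpha> \<kappa>\<^sub>\<beta> :: "real \<Rightarrow> (nat \<Rightarrow> real) measure"
    and M\<^sub>\<alpha> :: "'a measure" and J\<^sub>\<alpha> :: "'a \<Rightarrow> nat \<Rightarrow> real" and I\<^sub>\<alpha> :: "'a \<Rightarrow> nat \<Rightarrow> nat"
    and M\<^sub>\<beta> :: "'b measure" and J\<^sub>\<beta> :: "'b \<Rightarrow> nat \<Rightarrow> real" and I\<^sub>\<beta> :: "'b \<Rightarrow> nat \<Rightarrow> nat"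
    and M\<^sub>\<delta> :: "'c measure" and J\<^sub>\<delta> :: "'c \<Rightarrow> nat \<Rightarrow> real" and I\<^sub>\<delta> :: "'c \<Rightarrow> nat \<Rightarrow> nat"
    and N :: "'d measure" and P_hat :: "'d \<Rightarrow> nat \<Rightarrow> real" and I_hat :: "'d \<Rightarrow> nat \<Rightarrow> nat"
    and N' :: "'e measure" and P\<^sub>\<beta> P_tilde Z\<^sub>M\<^sub>L :: "'e \<Rightarrow> nat \<Rightarrow> real"
  assumes "0 < \<beta>" and "\<beta> < \<alpha>" and "\<alpha> < 1"
    and "PD_model \<alpha> M\<^sub>\<alpha> J\<^sub>\<alpha> I\<^sub>\<alpha>" and "PD_model \<beta> M\<^sub>\<beta> J\<^sub>\<beta> I\<^sub>\<beta>" and "PD_model (\<beta> / \<alpha>) M\<^sub>\<delta> J\<^sub>\<delta> I\<^sub>\<delta>"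
    and "density_of_total M\<^sub>\<alpha> J\<^sub>\<alpha> f\<^sub>\<alpha>" and "density_of_total M\<^sub>\<beta> J\<^sub>\<beta> f\<^sub>\<beta>"
    and "PD_given_total M\<^sub>\<alpha> J\<^sub>\<alpha> \<kappa>\<^sub>\<alpha>" and "PD_given_total M\<^sub>\<beta> J\<^sub>\<beta> \<kappa>\<^sub>\<beta>"
    and "h \<in> borel_measurable borel" and "\<And>t. 0 < t \<Longrightarrow> 0 \<le> h t"
    and "(\<integral>\<^sup>+\<omega>. ennreal (h (total_mass J\<^sub>\<beta> \<omega>)) \<partial>M\<^sub>\<beta>) = 1"
    and "generates_partition N P_hat I_hat"
    and "distr N seq_space P_hat = PK f\<^sub>\<alpha> \<kappa>\<^sub>\<alpha> (h_tilde M\<^sub>\<delta> J\<^sub>\<delta> \<alpha> h)"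
    and "prob_space N'"
    and "P\<^sub>\<beta> \<in> N' \<rightarrow>\<^sub>M seq_space"
    and "distr N' seq_space P\<^sub>\<beta> = PK f\<^sub>\<beta> \<kappa>\<^sub>\<beta> (\<lambda>t. ennreal (h t))"
    and "size_biased_rearrangement N' P\<^sub>\<beta> P_tilde"
    and "prob_space.indep_vars N' (\<lambda>_. borel) (\<lambda>k \<omega>. Z\<^sub>M\<^sub>L \<omega> k) UNIV"
    and "\<And>k. distr N' borel (\<lambda>\<omega>. Z\<^sub>M\<^sub>L \<omega> k) = mittag_leffler_law M\<^sub>\<alpha> J\<^sub>\<alpha> f\<^sub>\<alpha> \<alpha> (- \<beta>)"
    and "prob_space.indep_var N' seq_space P\<^sub>\<beta> seq_space Z\<^sub>M\<^sub>L"
    and "prob_space.indep_var N' seq_space P_tilde seq_space Z\<^sub>M\<^sub>L"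
  shows
    "(\<forall>n. \<forall>k\<in>{1..n}.
        emeasure N (K_event N I_hat n k) =
          cond_expectation M\<^sub>\<alpha> (\<lambda>\<omega>. h_tilde M\<^sub>\<delta> J\<^sub>\<delta> \<alpha> h (total_mass J\<^sub>\<alpha> \<omega>)) (K_event M\<^sub>\<alpha> I\<^sub>\<alpha> n k) *
          emeasure M\<^sub>\<alpha> (K_event M\<^sub>\<alpha> I\<^sub>\<alpha> n k) \<and>
        cond_expectation M\<^sub>\<alpha> (\<lambda>\<omega>. h_tilde M\<^sub>\<delta> J\<^sub>\<delta> \<alpha> h (total_mass J\<^sub>\<alpha> \<omega>)) (K_event M\<^sub>\<alpha> I\<^sub>\<alpha> n k) *
          emeasure M\<^sub>\<alpha> (K_event M\<^sub>\<alpha> I\<^sub>\<alpha> n k) =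
          (\<Sum>j=1..k. emeasure M\<^sub>\<delta> (K_event M\<^sub>\<delta> I\<^sub>\<delta> k j) *
             cond_expectation M\<^sub>\<beta> (\<lambda>\<omega>. ennreal (h (total_mass J\<^sub>\<beta> \<omega>))) (K_event M\<^sub>\<beta> I\<^sub>\<beta> n j)) *
          emeasure M\<^sub>\<alpha> (K_event M\<^sub>\<alpha> I\<^sub>\<alpha> n k)) \<and>
     (\<exists>Z_hat \<in> borel_measurable N.
        (AE \<omega> in N.
           (\<lambda>n. real n powr (- \<alpha>) * real (num_blocks (I_hat \<omega>) n)) \<longlonglongrightarrow> Z_hat \<omega>) \<and>
        distributed N lborel Z_hat
          (\<lambda>s. indicator {0<..} s *
             ((\<integral>\<^sup>+\<omega>. ennreal (h (s powr (- 1 / \<alpha>) * total_mass J\<^sub>\<delta> \<omega> powr (1 / \<alpha>))) \<partial>M\<^sub>\<delta>) *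
              ennreal (stable_g \<alpha> f\<^sub>\<alpha> s))) \<and>
        (AE \<omega> in N'. summable (\<lambda>k. P\<^sub>\<beta> \<omega> k powr \<alpha> * Z\<^sub>M\<^sub>L \<omega> k)) \<and>
        distr N borel Z_hat = distr N' borel (\<lambda>\<omega>. \<Sum>k. P\<^sub>\<beta> \<omega> k powr \<alpha> * Z\<^sub>M\<^sub>L \<omega> k) \<and>
        (AE \<omega> in N'. summable (\<lambda>k. P_tilde \<omega> k powr \<alpha> * Z\<^sub>M\<^sub>L \<omega> k)) \<and>
        distr N borel Z_hat = distr N' borel (\<lambda>\<omega>. \<Sum>k. P_tilde \<omega> k powr \<alpha> * Z\<^sub>M\<^sub>L \<omega> k))"
proof -
  interpret mix: generalized_mixture \<alpha> \<beta> M\<^sub>\<alpha> J\<^sub>\<alpha> I\<^sub>\<alpha> M\<^sub>\<beta> J\<^sub>\<beta> I\<^sub>\<beta> M\<^sub>\<delta> J\<^sub>\<delta> I\<^sub>\<delta> f\<^sub>\<alpha> f\<^sub>\<beta> \<kappa>\<^sub>\<beta> N' Z\<^sub>M\<^sub>L h P\<^sub>\<beta> P_tilde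
  proof -
    interpret n: prob_space N' by fact
    show "generalized_mixture \<alpha> \<beta> M\<^sub>\<alpha> J\<^sub>\<alpha> I\<^sub>\<alpha> M\<^sub>\<beta> J\<^sub>\<beta> I\<^sub>\<beta> M\<^sub>\<delta> J\<^sub>\<delta> I\<^sub>\<delta> f\<^sub>\<alpha> f\<^sub>\<beta> \<kappa>\<^sub>\<beta> N' Z\<^sub>M\<^sub>L h P\<^sub>\<beta> P_tilde"
      by unfold_locales (use assms in auto)
  qed
  interpret ac: conditioned_model \<alpha> M\<^sub>\<alpha> J\<^sub>\<alpha> I\<^sub>\<alpha> f\<^sub>\<alpha> \<kappa>\<^sub>\<alpha>
    by unfold_locales (use assms in auto)
  let ?h = "h_tilde M\<^sub>\<delta> J\<^sub>\<delta> \<alpha> h"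
  \<comment> \<open>The integral formula for the mixed law identifies \<open>P_hat\<close> as the
    \<open>\<alpha>\<close> weights reweighted by \<open>?h\<close> of their mass.\<close>
  interpret rw: reweighted_model \<alpha> M\<^sub>\<alpha> J\<^sub>\<alpha> I\<^sub>\<alpha> N P_hat I_hat ?h
  proof unfold_locales
    show "generates_partition N P_hat I_hat" by fact
    then have [measurable]: "P_hat \<in> N \<rightarrow>\<^sub>M seq_space" by (simp add: generates_partition_def)
    show "?h \<in> borel_measurable borel" by measurable
    fix F :: "(nat \<Rightarrow> real) \<Rightarrow> ennreal" assume [measurable]: "F \<in> borel_measurable seq_space"
    have "(\<integral>\<^sup>+\<omega>. F (P_hat \<omega>) \<partial>N) = (\<integral>\<^sup>+p. F p \<partial>distr N seq_space P_hat)"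
      by (rule nn_integral_distr[symmetric]) measurable
    also have "\<dots> = (\<integral>\<^sup>+\<omega>. ?h (mix.a.T \<omega>) * F (mix.a.P \<omega>) \<partial>M\<^sub>\<alpha>)"
      unfolding assms by (rule ac.nn_integral_PK) measurable
    finally show "(\<integral>\<^sup>+\<omega>. F (P_hat \<omega>) \<partial>N) = (\<integral>\<^sup>+\<omega>. ?h (mix.a.T \<omega>) * F (mix.a.P \<omega>) \<partial>M\<^sub>\<alpha>)" .
  qed
  have blocks: "emeasure N (K_event N I_hat n k) = (\<integral>\<^sup>+\<omega>. ?h (mix.a.T \<omega>) * indicator {k} (mix.a.K \<omega> n) \<partial>M\<^sub>\<alpha>)" for n k
  proof -
    have [measurable]: "K_event N I_hat n k \<in> sets N" unfolding K_event_def by measurable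
    have "emeasure N (K_event N I_hat n k) = (\<integral>\<^sup>+\<omega>. indicator (K_event N I_hat n k) \<omega> \<partial>N)" by simp
    also have "\<dots> = (\<integral>\<^sup>+\<omega>. 1 * indicator {k} (rw.K_hat \<omega> n) \<partial>N)"
      by (intro nn_integral_cong) (auto simp: K_event_def split: split_indicator)
    also have "\<dots> = (\<integral>\<^sup>+\<omega>. ?h (mix.a.T \<omega>) * 1 * indicator {k} (mix.a.K \<omega> n) \<partial>M\<^sub>\<alpha>)"
      by (rule rw.nn_integral_reweighted) measurable
    finally show ?thesis by simp
  qed
  have conditional: "cond_expectation M\<^sub>\<alpha> (\<lambda>\<omega>. ?h (mix.a.T \<omega>)) (K_event M\<^sub>\<alpha> I\<^sub>\<alpha> n k) * emeasure M\<^sub>\<alpha> (K_event M\<^sub>\<alpha> I\<^sub>\<alpha> n k) =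
      (\<integral>\<^sup>+\<omega>. ?h (mix.a.T \<omega>) * indicator {k} (mix.a.K \<omega> n) \<partial>M\<^sub>\<alpha>)" if "k \<in> {1..n}" for n k
    by (rule mix.a.cond_expectation_times[OF _ that]) measurable
  have composition: "(\<integral>\<^sup>+\<omega>. ?h (mix.a.T \<omega>) * indicator {k} (mix.a.K \<omega> n) \<partial>M\<^sub>\<alpha>) =
      (\<Sum>j=1..k. emeasure M\<^sub>\<delta> (K_event M\<^sub>\<delta> I\<^sub>\<delta> k j) *
         cond_expectation M\<^sub>\<beta> (\<lambda>\<omega>. ennreal (h (mix.b.T \<omega>))) (K_event M\<^sub>\<beta> I\<^sub>\<beta> n j)) * emeasure M\<^sub>\<alpha> (K_event M\<^sub>\<alpha> I\<^sub>\<alpha> n k)"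
    if k: "k \<in> {1..n}" for n k
  proof -
    have "(\<integral>\<^sup>+\<omega>. ?h (mix.a.T \<omega>) * indicator {k} (mix.a.K \<omega> n) \<partial>M\<^sub>\<alpha>) =
        (\<Sum>j=1..k. ennreal (mix.a.block_prob n k * mix.d.block_prob k j / mix.b.block_prob n j) *
          (\<integral>\<^sup>+\<omega>. ennreal (h (mix.b.T \<omega>)) * indicator {j} (mix.b.K \<omega> n) \<partial>M\<^sub>\<beta>))"
      unfolding h_tilde_def using k by (intro mix.conditional_law_composition) auto
    also have "\<dots> = (\<Sum>j=1..k. emeasure M\<^sub>\<delta> (K_event M\<^sub>\<delta> I\<^sub>\<delta> k j) *
         cond_expectation M\<^sub>\<beta> (\<lambda>\<omega>. ennreal (h (mix.b.T \<omega>))) (K_event M\<^sub>\<beta> I\<^sub>\<beta> n j) * emeasure M\<^sub>\<alpha> (K_event M\<^sub>\<alpha> I\<^sub>\<alpha> n k))"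
    proof (rule sum.cong)
      fix j assume "j \<in> {1..k}"
      then have j: "j \<in> {1..n}" using k by auto
      let ?I = "\<integral>\<^sup>+\<omega>. ennreal (h (mix.b.T \<omega>)) * indicator {j} (mix.b.K \<omega> n) \<partial>M\<^sub>\<beta>"
      have b: "0 < mix.b.block_prob n j" using j by (intro mix.b.block_prob_pos) auto
      have "cond_expectation M\<^sub>\<beta> (\<lambda>\<omega>. ennreal (h (mix.b.T \<omega>))) (K_event M\<^sub>\<beta> I\<^sub>\<beta> n j) = ?I * ennreal (1 / mix.b.block_prob n j)"
        using b by (subst mix.b.nn_integral_cond_expectation[OF _ j])
          (auto simp: divide_ennreal_def inverse_ennreal inverse_eq_divide)
      moreover have "ennreal (mix.a.block_prob n k * mix.d.block_prob k j / mix.b.block_prob n j) =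
          ennreal (mix.a.block_prob n k) * ennreal (mix.d.block_prob k j) * ennreal (1 / mix.b.block_prob n j)"
        using b by (simp add: ennreal_mult'[symmetric] mix.a.block_prob_nonneg mix.d.block_prob_nonneg)
      ultimately show "ennreal (mix.a.block_prob n k * mix.d.block_prob k j / mix.b.block_prob n j) * ?I =
          emeasure M\<^sub>\<delta> (K_event M\<^sub>\<delta> I\<^sub>\<delta> k j) * cond_expectation M\<^sub>\<beta> (\<lambda>\<omega>. ennreal (h (mix.b.T \<omega>))) (K_event M\<^sub>\<beta> I\<^sub>\<beta> n j) *
          emeasure M\<^sub>\<alpha> (K_event M\<^sub>\<alpha> I\<^sub>\<alpha> n k)"
        by (simp only: mix.a.emeasure_K_event mix.d.emeasure_K_event mult_ac)
    qed simp
    finally show ?thesis by (simp only: sum_distrib_right)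
  qed
  \<comment> \<open>The mass recovered from \<open>P_hat\<close> makes the limit an explicit
    measurable function of the weights.\<close>
  define Z_hat where "Z_hat \<omega> = rw.S \<omega> powr (- \<alpha>)" for \<omega>
  have [measurable]: "Z_hat \<in> borel_measurable N" unfolding Z_hat_def by measurable
  have law: "emeasure (distr N borel Z_hat) A = (\<integral>\<^sup>+x. ?h (mix.a.T x) * indicator A (mix.a.T x powr (- \<alpha>)) \<partial>M\<^sub>\<alpha>)"
    if [measurable]: "A \<in> sets borel" for A
  proof -
    have "emeasure (distr N borel Z_hat) A = (\<integral>\<^sup>+s. indicator A s \<partial>distr N borel Z_hat)" by simp
    also have "\<dots> = (\<integral>\<^sup>+\<omega>. indicator A (rw.S \<omega> powr (- \<alpha>)) \<partial>N)"
      by (subst nn_integral_distr) (auto simp: Z_hat_def)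
    also have "\<dots> = (\<integral>\<^sup>+x. ?h (mix.a.T x) * indicator A (mix.a.T x powr (- \<alpha>)) \<partial>M\<^sub>\<alpha>)"
      by (rule rw.nn_integral_S) measurable
    finally show ?thesis .
  qed
  let ?dens = "\<lambda>s. indicator {0<..} s *
     ((\<integral>\<^sup>+\<omega>. ennreal (h (s powr (- 1 / \<alpha>) * total_mass J\<^sub>\<delta> \<omega> powr (1 / \<alpha>))) \<partial>M\<^sub>\<delta>) * ennreal (stable_g \<alpha> f\<^sub>\<alpha> s))"
  have dens_eq: "?dens = (\<lambda>s. indicator {0<..} s * (?h (s powr (- 1 / \<alpha>)) * ennreal (stable_g \<alpha> f\<^sub>\<alpha> s)))"
    by (simp only: h_tilde_def)
  have [measurable]: "stable_g \<alpha> f\<^sub>\<alpha> \<in> borel_measurable borel"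
    unfolding stable_g_def[abs_def] by measurable
  have dens_meas [measurable]: "?dens \<in> borel_measurable borel" unfolding dens_eq by measurable
  have "distr N lborel Z_hat = density lborel ?dens"
  proof (rule measure_eqI)
    fix A assume "A \<in> sets (distr N lborel Z_hat)"
    then have A [measurable]: "A \<in> sets borel" by simp
    have "emeasure (distr N lborel Z_hat) A = emeasure (distr N borel Z_hat) A"
      by (simp add: emeasure_distr)
    also have "\<dots> = (\<integral>\<^sup>+s. ?h (s powr (- 1 / \<alpha>)) * indicator A ((s powr (- 1 / \<alpha>)) powr (- \<alpha>)) *
        ennreal (stable_g \<alpha> f\<^sub>\<alpha> s) * indicator {0<..} s \<partial>lborel)"
      unfolding law[OF A] by (rule mix.ad.nn_integral_T_stable_g) measurable
    also have "\<dots> = (\<integral>\<^sup>+s. ?dens s * indicator A s \<partial>lborel)"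
      using mix.a.g
      by (intro nn_integral_cong) (auto simp: h_tilde_def powr_powr split: split_indicator)
    also have "\<dots> = emeasure (density lborel ?dens) A"
      by (rule emeasure_density[symmetric]) measurable
    finally show "emeasure (distr N lborel Z_hat) A = emeasure (density lborel ?dens) A" .
  qed simp
  then have density: "distributed N lborel Z_hat ?dens"
    unfolding distributed_def using dens_meas by (auto simp: measurable_lborel1)
  \<comment> \<open>Both mixtures and \<open>Z_hat\<close> are matched against one law, that of
    \<open>mix.a.T x powr (- \<alpha>)\<close> under the weight
    \<open>?h (mix.a.T x)\<close>.\<close>
  have mixture: "distr N borel Z_hat = distr N' borel (\<lambda>\<omega>. \<Sum>k. Q \<omega> k powr \<alpha> * Z\<^sub>M\<^sub>L \<omega> k)"
    if Q: "\<And>A. A \<in> sets borel \<Longrightarrow> emeasure (distr N' borel (\<lambda>\<omega>. \<Sum>k. Q \<omega> k powr \<alpha> * Z\<^sub>M\<^sub>L \<omega> k)) A =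
      (\<integral>\<^sup>+x. ?h (mix.a.T x) * indicator A (mix.a.T x powr (- \<alpha>)) \<partial>M\<^sub>\<alpha>)" for Q
    by (rule measure_eqI) (auto simp: law Q)
  have tilde: "(\<integral>\<^sup>+\<omega>. G (mix.mix (P_tilde \<omega>) (Z\<^sub>M\<^sub>L \<omega>)) \<partial>N') = (\<integral>\<^sup>+x. ?h (mix.a.T x) * G (ennreal (mix.a.T x powr (- \<alpha>))) \<partial>M\<^sub>\<alpha>)"
    if "G \<in> borel_measurable borel" for G
    using mix.nn_integral_mix_tilde[OF that] mix.nn_integral_mix[OF that] by simp
  show ?thesis
  proof (intro conjI allI ballI bexI[of _ Z_hat])
    fix n k :: nat assume k: "k \<in> {1..n}"
    show "emeasure N (K_event N I_hat n k) =
        cond_expectation M\<^sub>\<alpha> (\<lambda>\<omega>. ?h (mix.a.T \<omega>)) (K_event M\<^sub>\<alpha> I\<^sub>\<alpha> n k) * emeasure M\<^sub>\<alpha> (K_event M\<^sub>\<alpha> I\<^sub>\<alpha> n k)"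
      by (simp only: blocks conditional[OF k])
    show "cond_expectation M\<^sub>\<alpha> (\<lambda>\<omega>. ?h (mix.a.T \<omega>)) (K_event M\<^sub>\<alpha> I\<^sub>\<alpha> n k) * emeasure M\<^sub>\<alpha> (K_event M\<^sub>\<alpha> I\<^sub>\<alpha> n k) =
        (\<Sum>j=1..k. emeasure M\<^sub>\<delta> (K_event M\<^sub>\<delta> I\<^sub>\<delta> k j) *
           cond_expectation M\<^sub>\<beta> (\<lambda>\<omega>. ennreal (h (mix.b.T \<omega>))) (K_event M\<^sub>\<beta> I\<^sub>\<beta> n j)) * emeasure M\<^sub>\<alpha> (K_event M\<^sub>\<alpha> I\<^sub>\<alpha> n k)"
      unfolding conditional[OF k] by (rule composition[OF k])
  next
    show "AE \<omega> in N. (\<lambda>n. real n powr (- \<alpha>) * real (num_blocks (I_hat \<omega>) n)) \<longlonglongrightarrow> Z_hat \<omega>"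
      unfolding Z_hat_def by (rule rw.blocks_limit)
    show "distributed N lborel Z_hat ?dens" by (rule density)
    show "AE \<omega> in N'. summable (\<lambda>k. P\<^sub>\<beta> \<omega> k powr \<alpha> * Z\<^sub>M\<^sub>L \<omega> k)"
      by (rule mix.mixture_sum(1)[OF mix.nn_integral_mix mix.rv(1)])
    show "AE \<omega> in N'. summable (\<lambda>k. P_tilde \<omega> k powr \<alpha> * Z\<^sub>M\<^sub>L \<omega> k)"
      by (rule mix.mixture_sum(1)[OF tilde mix.rv(2)])
    show "distr N borel Z_hat = distr N' borel (\<lambda>\<omega>. \<Sum>k. P\<^sub>\<beta> \<omega> k powr \<alpha> * Z\<^sub>M\<^sub>L \<omega> k)"
      by (rule mixture[OF mix.mixture_sum(2)[OF mix.nn_integral_mix mix.rv(1)]])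
    show "distr N borel Z_hat = distr N' borel (\<lambda>\<omega>. \<Sum>k. P_tilde \<omega> k powr \<alpha> * Z\<^sub>M\<^sub>L \<omega> k)"
      by (rule mixture[OF mix.mixture_sum(2)[OF tilde mix.rv(2)]])
  qed measurable
qed

end
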